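(* Let $f:X_0=\mathbf{A}^n\to Y_0=\mathbf{A}^n$ be a Keller map, $V$ a codimension one component of its finiteness variety, $\Gamma$ an associated divisor mapping onto $V$, $v\in V$ a generic point (translated to $v=0$), $e\in\Gamma$ a point over $v$, and $u$ a branch with $u^m=x_1$ near $e$ (see context). After a suitable linear coordinate change of $Y_0$, write the evolution of $u$ along $f_1=r$, $f_i=0$ ($i\ge2$) as $$\frac{du}{dr} = u^{\hat K+1}\sum_{j\ge0} q_j(y_1,\dots,\hat y_l,\dots,y_n)\,u^{-j},$$ where $q_0\neq0$ at $e$. Then $\hat K$ is the ramification index of $f$ along $\Gamma$.
   Context: Work over $\mathbf{C}$. A Keller map is a polynomial map with Jacobian determinant identically $1$. $V_f\subset Y_0$ is the set of points over which $f$ is not proper; $V$ is a codimension one irreducible component. $X=\mathbf{P}^n\supset X_0$. $\hat X\to X$ is a proper birational morphism with $\hat X$ smooth, and $\Gamma\subset\hat X$ is a prime divisor over the hyperplane at infinity such that $f$ extends to a rational map that is defined generically on $\Gamma$ and maps $\Gamma$ generically finitely and etale onto $V$ (as reduced varieties). The ramification index of $f$ along $\Gamma$ is that of the extension of discrete valuation rings of $V$ in $\mathbf{C}(Y_0)$ and of $\Gamma$ in $\mathbf{C}(X_0)$. $m\ge1$ is the order of vanishing of $1/x_1$ along $\Gamma$, and $u$ is a local branch of $x_1^{1/m}$ near the generic point $e$, so $u^{-1}$ is a local equation of $\Gamma$. The point $v=f(e)$ is generic, so that $\Gamma\to V$ is etale at $e$ and, for a local equation $\chi$ of $V$, the set $\{\chi,y_1,\dots,\hat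 y_l,\dots,y_n\}$ (with $y_l$ omitted) is a system of local parameters of $Y_0$ at $v$; then $\{u^{-1},y_1,\dots,\hat y_l,\dots,y_n\}$ are local analytic parameters at $e$. The $q_j$ are power series in the parameters $y_1,\dots,\hat y_l,\dots,y_n$. *)

theory Defs
  imports
    "HOL-Analysis.Analysis"
    "HOL-Library.Poly_Mapping"
    "HOL-Library.Extended_Nat"
    "HOL-Computational_Algebra.Fraction_Field"
begin

section \<open>Polynomials and rational functions in the coordinates of affine space\<close>

text \<open>
  The index type \<open>'n\<close> is finite; its linear order only serves the instance that makes
  polynomials an integral domain.  Both coordinate rings \<open>\<complex>[X\<^sub>0]\<close> and \<open>\<complex>[Y\<^sub>0]\<close> are \<open>'n cpoly\<close>,
  both function fields are \<open>'n ratfun\<close>.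
\<close>

type_synonym 'n cpoly = "('n \<Rightarrow>\<^sub>0 nat) \<Rightarrow>\<^sub>0 complex"
type_synonym 'n ratfun = "'n cpoly fract"
type_synonym 'n cspace = "(complex, 'n) vec"
type_synonym 'n cmatrix = "((complex, 'n) vec, 'n) vec"

definition poly_subst :: "(complex \<Rightarrow> 'b) \<Rightarrow> ('n::finite \<Rightarrow> 'b) \<Rightarrow> 'n cpoly \<Rightarrow> 'b::comm_ring_1" where
  "poly_subst \<phi> a p =
     (\<Sum>\<alpha>\<in>Poly_Mapping.keys p. \<phi> (Poly_Mapping.lookup p \<alpha>) * (\<Prod>i\<in>UNIV. a i ^ Poly_Mapping.lookup \<alpha> i))"

definition peval :: "'n::finite cpoly \<Rightarrow> 'n cspace \<Rightarrow> complex" where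
  "peval p x = poly_subst (\<lambda>c. c) (\<lambda>i. x $ i) p"

definition pdiff :: "'n \<Rightarrow> 'n cpoly \<Rightarrow> 'n cpoly" where
  "pdiff i p = (\<Sum>\<alpha>\<in>Poly_Mapping.keys p.
     Poly_Mapping.single (\<alpha> - Poly_Mapping.single i 1)
       (of_nat (Poly_Mapping.lookup \<alpha> i) * Poly_Mapping.lookup p \<alpha>))"

definition rat_of_poly :: "'n::{finite,linorder} cpoly \<Rightarrow> 'n ratfun" where
  "rat_of_poly p = Fract p 1"

definition cst :: "complex \<Rightarrow> 'n::{finite,linorder} ratfun" where
  "cst c = rat_of_poly (Poly_Mapping.single 0 c)"

definition coord :: "'n \<Rightarrow> 'n::{finite,linorder} ratfun" where
  "coord i = rat_of_poly (Poly_Mapping.single (Poly_Mapping.single i 1) 1)"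

definition poly_map :: "('n \<Rightarrow> 'n cpoly) \<Rightarrow> 'n cspace \<Rightarrow> ('n::finite) cspace" where
  "poly_map F x = (\<chi> i. peval (F i) x)"

definition keller_map :: "('n::finite \<Rightarrow> 'n cpoly) \<Rightarrow> bool" where
  "keller_map F \<longleftrightarrow> det (\<chi> i j. pdiff j (F i)) = 1"


section \<open>Zariski closed subsets and the finiteness variety\<close>

definition zariski_closed :: "(('n::finite) cspace) set \<Rightarrow> bool" where
  "zariski_closed S \<longleftrightarrow> (\<exists>P. S = {x. \<forall>p\<in>P. peval p x = 0})"

definition zariski_irreducible :: "(('n::finite) cspace) set \<Rightarrow> bool" where
  "zariski_irreducible S \<longleftrightarrow> S \<noteq> {} \<and>
     (\<forall>A B. zariski_closed A \<and> zariski_closed B \<and> S \<subseteq> A \<union> B \<longrightarrow> S \<subseteq> A \<or> S \<subseteq> B)"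

definition codim_one :: "(('n::finite) cspace) set \<Rightarrow> bool" where
  "codim_one V \<longleftrightarrow> V \<noteq> UNIV \<and>
     \<not> (\<exists>W. zariski_closed W \<and> zariski_irreducible W \<and> V \<subset> W \<and> W \<noteq> UNIV)"

definition irreducible_component :: "(('n::finite) cspace) set \<Rightarrow> ('n cspace) set \<Rightarrow> bool" where
  "irreducible_component V S \<longleftrightarrow>
     V \<subseteq> S \<and> zariski_closed V \<and> zariski_irreducible V \<and>
     (\<forall>W. W \<subseteq> S \<and> zariski_closed W \<and> zariski_irreducible W \<and> V \<subseteq> W \<longrightarrow> W = V)"

definition vanishing_ideal :: "(('n::finite) cspace) set \<Rightarrow> 'n cpoly set" where
  "vanishing_ideal V = {p. \<forall>x\<in>V. peval p x = 0}"

text \<open>Properness is taken in the classical topology, as usual over \<open>\<complex>\<close>.\<close>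

definition proper_over :: "('n \<Rightarrow> 'n cpoly) \<Rightarrow> ('n::finite) cspace \<Rightarrow> bool" where
  "proper_over F y \<longleftrightarrow> (\<exists>W. open W \<and> y \<in> W \<and>
     proper_map (top_of_set (poly_map F -` W)) (top_of_set W) (poly_map F))"

definition finiteness_variety :: "('n \<Rightarrow> 'n cpoly) \<Rightarrow> (('n::finite) cspace) set" where
  "finiteness_variety F = {y. \<not> proper_over F y}"


section \<open>Local rings inside a function field\<close>

definition complex_subalgebra :: "'n::{finite,linorder} ratfun set \<Rightarrow> bool" where
  "complex_subalgebra A \<longleftrightarrow> range cst \<subseteq> A \<and> (\<forall>a\<in>A. \<forall>b\<in>A. a - b \<in> A \<and> a * b \<in> A)"

definition generated_algebra :: "'n::{finite,linorder} ratfun set \<Rightarrow> 'n ratfun set" where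
  "generated_algebra G = \<Inter>{A. complex_subalgebra A \<and> G \<subseteq> A}"

definition prime_ideal_of :: "'k::field set \<Rightarrow> 'k set \<Rightarrow> bool" where
  "prime_ideal_of A P \<longleftrightarrow> P \<subseteq> A \<and> 0 \<in> P \<and> 1 \<notin> P \<and>
     (\<forall>a\<in>P. \<forall>b\<in>P. a + b \<in> P) \<and> (\<forall>a\<in>A. \<forall>b\<in>P. a * b \<in> P) \<and>
     (\<forall>a\<in>A. \<forall>b\<in>A. a * b \<in> P \<longrightarrow> a \<in> P \<or> b \<in> P)"

definition localization :: "'k::field set \<Rightarrow> 'k set \<Rightarrow> 'k set" where
  "localization A P = {a / s | a s. a \<in> A \<and> s \<in> A - P}"

definition nonunits :: "'k::field set \<Rightarrow> 'k set" where
  "nonunits R = {h \<in> R. h = 0 \<or> inverse h \<notin> R}"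

definition dominates :: "'k::field set \<Rightarrow> 'k set \<Rightarrow> bool" where
  "dominates S R \<longleftrightarrow> R \<subseteq> S \<and> nonunits R \<subseteq> nonunits S"

definition valuation_ring :: "'n::{finite,linorder} ratfun set \<Rightarrow> bool" where
  "valuation_ring W \<longleftrightarrow> complex_subalgebra W \<and> (\<forall>h. h \<in> W \<or> inverse h \<in> W)"

definition ideal_span :: "'k::field set \<Rightarrow> 'k set \<Rightarrow> 'k set" where
  "ideal_span R B = {\<Sum>b\<in>B. r b * b | r. \<forall>b\<in>B. r b \<in> R}"

definition krull_dim :: "'k::field set \<Rightarrow> enat" where
  "krull_dim R = Sup {enat d | d. \<exists>P. (\<forall>i\<le>d. prime_ideal_of R (P i)) \<and> (\<forall>i<d. P i \<subset> P (Suc i))}"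

definition regular_local_ring :: "'k::field set \<Rightarrow> bool" where
  "regular_local_ring R \<longleftrightarrow>
     (\<exists>B. finite B \<and> B \<subseteq> R \<and> ideal_span R B = nonunits R \<and> enat (card B) = krull_dim R)"

definition uniformizer :: "'k::field set \<Rightarrow> 'k \<Rightarrow> bool" where
  "uniformizer R \<pi> \<longleftrightarrow> \<pi> \<noteq> 0 \<and> nonunits R = {\<pi> * s | s. s \<in> R}"

definition has_order :: "'k::field set \<Rightarrow> 'k \<Rightarrow> nat \<Rightarrow> bool" where
  "has_order R h k \<longleftrightarrow> (\<exists>\<pi> w. uniformizer R \<pi> \<and> w \<in> R - nonunits R \<and> h = \<pi> ^ k * w)"

text \<open>For discrete valuation rings \<open>R \<subseteq> S\<close>: the order in \<open>S\<close> of a uniformizer of \<open>R\<close>.\<close>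

definition ramification_index :: "'k::field set \<Rightarrow> 'k set \<Rightarrow> nat" where
  "ramification_index R S = (THE k. \<exists>\<pi>. uniformizer R \<pi> \<and> has_order S \<pi> k)"


section \<open>Varieties with function field \<open>\<complex>(X\<^sub>0)\<close>\<close>

text \<open>
  A variety birational to \<open>X\<^sub>0\<close> is given as a Zariski model: its scheme-theoretic points are
  identified with their local rings, which are subrings of the function field.  The scheme is a
  finite union of affine models, and irredundancy is separatedness.  A point \<open>R\<close> is a
  specialization of a point \<open>S\<close> iff \<open>R \<subseteq> S\<close>.  Birational morphisms inducing the identity on the
  function field are domination of local rings, and properness is the valuative criterion.
\<close>

definition affine_model :: "'n::{finite,linorder} ratfun set \<Rightarrow> 'n ratfun set set" where
  "affine_model A = {localization A P | P. prime_ideal_of A P}"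

definition variety_model :: "'n::{finite,linorder} ratfun set set \<Rightarrow> bool" where
  "variety_model X \<longleftrightarrow>
     (\<exists>\<A>. finite \<A> \<and> X = (\<Union>A\<in>\<A>. affine_model A) \<and>
        (\<forall>A\<in>\<A>. (\<exists>G. finite G \<and> A = generated_algebra G) \<and>
                 (\<forall>h. \<exists>a\<in>A. \<exists>b\<in>A. h = a / b))) \<and>
     X \<noteq> {} \<and>
     (\<forall>R\<in>X. \<forall>S\<in>X. (\<exists>W. valuation_ring W \<and> dominates W R \<and> dominates W S) \<longrightarrow> R = S)"

definition birational_morphism ::
    "'n::{finite,linorder} ratfun set set \<Rightarrow> 'n ratfun set set \<Rightarrow> bool" where
  "birational_morphism X' X \<longleftrightarrow> (\<forall>R\<in>X'. \<exists>S\<in>X. dominates R S)"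

definition proper_birational_morphism ::
    "'n::{finite,linorder} ratfun set set \<Rightarrow> 'n ratfun set set \<Rightarrow> bool" where
  "proper_birational_morphism X' X \<longleftrightarrow> birational_morphism X' X \<and>
     (\<forall>W. valuation_ring W \<and> (\<exists>S\<in>X. dominates W S) \<longrightarrow> (\<exists>R\<in>X'. dominates W R))"

text \<open>Over \<open>\<complex>\<close> a variety is smooth iff all its local rings are regular.\<close>

definition smooth_model :: "'n::{finite,linorder} ratfun set set \<Rightarrow> bool" where
  "smooth_model X \<longleftrightarrow> (\<forall>R\<in>X. regular_local_ring R)"

definition projective_space :: "'n::{finite,linorder} ratfun set set" where
  "projective_space =
     (\<Union>z \<in> insert 1 (range coord). affine_model (generated_algebra ((\<lambda>w. w / z) ` insert 1 (range coord))))"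

definition hyperplane_at_infinity :: "'n::{finite,linorder} ratfun set set" where
  "hyperplane_at_infinity = projective_space - affine_model (generated_algebra (range coord))"

definition prime_divisor :: "'n::{finite,linorder} ratfun set set \<Rightarrow> 'n ratfun set \<Rightarrow> bool" where
  "prime_divisor X \<Gamma> \<longleftrightarrow> \<Gamma> \<in> X \<and> krull_dim \<Gamma> = 1"

definition closed_points :: "'n::{finite,linorder} ratfun set set \<Rightarrow> 'n ratfun set set" where
  "closed_points X = {p \<in> X. \<forall>h\<in>p. \<exists>c. h - cst c \<in> nonunits p}"

definition value_at :: "'n::{finite,linorder} ratfun set \<Rightarrow> 'n ratfun \<Rightarrow> complex" where
  "value_at p h = (THE c. h - cst c \<in> nonunits p)"

text \<open>The classical topology on the closed points: coarsest making all rational functions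
  continuous on open domains of definition.\<close>

definition classical_topology :: "'n::{finite,linorder} ratfun set set \<Rightarrow> 'n ratfun set topology" where
  "classical_topology X = topology_generated_by
     {{p \<in> closed_points X. h \<in> p \<and> value_at p h \<in> W} | h W. open W}"


section \<open>The map \<open>f\<close> near \<open>\<Gamma>\<close> and near \<open>V\<close>\<close>

definition pullback :: "('n \<Rightarrow> 'n cpoly) \<Rightarrow> 'n::{finite,linorder} cpoly \<Rightarrow> 'n ratfun" where
  "pullback F p = poly_subst cst (\<lambda>i. rat_of_poly (F i)) p"

text \<open>The discrete valuation ring of \<open>V\<close> in \<open>\<complex>(Y\<^sub>0)\<close>, with \<open>\<complex>(Y\<^sub>0)\<close> embedded in \<open>\<complex>(X\<^sub>0)\<close> by \<open>f\<^sup>*\<close>.\<close>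

definition ring_of_component ::
    "('n \<Rightarrow> 'n cpoly) \<Rightarrow> ('n cspace) set \<Rightarrow> 'n::{finite,linorder} ratfun set" where
  "ring_of_component F V = {pullback F p / pullback F q | p q. q \<notin> vanishing_ideal V}"

text \<open>
  \<open>f\<close> is defined at the generic point of \<open>\<Gamma>\<close>, maps it to the generic point of \<open>V\<close>, and the
  residue field extension is finite.  For the reduced varieties, being etale at the generic
  point of \<open>\<Gamma>\<close> means that this extension is finite separable; separability is automatic in
  characteristic 0.
\<close>

definition maps_generically_finite_etale_onto ::
    "('n \<Rightarrow> 'n cpoly) \<Rightarrow> 'n ratfun set \<Rightarrow> (('n::{finite,linorder}) cspace) set \<Rightarrow> bool" where
  "maps_generically_finite_etale_onto F \<Gamma> V \<longleftrightarrow>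
     dominates \<Gamma> (ring_of_component F V) \<and>
     (\<exists>B. finite B \<and> B \<subseteq> \<Gamma> \<and>
        (\<forall>h\<in>\<Gamma>. \<exists>r. (\<forall>b\<in>B. r b \<in> ring_of_component F V) \<and> h - (\<Sum>b\<in>B. r b * b) \<in> nonunits \<Gamma>))"

definition ring_at :: "'n cspace \<Rightarrow> 'n::{finite,linorder} ratfun set" where
  "ring_at v = {rat_of_poly p / rat_of_poly q | p q. peval q v \<noteq> 0}"

definition local_equation ::
    "('n cspace) set \<Rightarrow> 'n cspace \<Rightarrow> 'n::{finite,linorder} ratfun \<Rightarrow> bool" where
  "local_equation V v \<psi> \<longleftrightarrow>
     {rat_of_poly p / rat_of_poly q | p q. p \<in> vanishing_ideal V \<and> peval q v \<noteq> 0}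
       = {\<psi> * s | s. s \<in> ring_at v}"

text \<open>
  The coordinates \<open>A (y - v)\<close> on \<open>Y\<^sub>0\<close>: translation of \<open>v\<close> to the origin followed by the linear
  change \<open>A\<close>.  With \<open>G = coord\<close> these are functions on \<open>Y\<^sub>0\<close>, with the components of \<open>f\<close> for \<open>G\<close>
  their pullbacks to \<open>X\<^sub>0\<close>.
\<close>

definition new_coord ::
    "'n cmatrix \<Rightarrow> 'n cspace \<Rightarrow> ('n \<Rightarrow> 'n ratfun) \<Rightarrow> 'n \<Rightarrow> 'n::{finite,linorder} ratfun" where
  "new_coord A v G i = (\<Sum>j\<in>UNIV. cst (A $ i $ j) * (G j - cst (v $ j)))"

abbreviation new_comp ::
    "('n \<Rightarrow> 'n cpoly) \<Rightarrow> 'n cmatrix \<Rightarrow> 'n cspace \<Rightarrow> 'n \<Rightarrow> 'n::{finite,linorder} ratfun" where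
  "new_comp F A v \<equiv> new_coord A v (\<lambda>j. rat_of_poly (F j))"

text \<open>\<open>{\<psi>, y\<^sub>1, \<dots>, y\<^sub>n}\<close> without \<open>y\<^sub>l\<close> is a system of local parameters at \<open>v\<close>: these \<open>n\<close> functions
  generate the maximal ideal of the \<open>n\<close>-dimensional regular local ring at \<open>v\<close>.\<close>

definition local_parameters_omitting ::
    "'n ratfun \<Rightarrow> 'n cmatrix \<Rightarrow> 'n cspace \<Rightarrow> 'n::{finite,linorder} \<Rightarrow> bool" where
  "local_parameters_omitting \<psi> A v l \<longleftrightarrow>
     ideal_span (ring_at v) (insert \<psi> (new_coord A v coord ` (UNIV - {l}))) = nonunits (ring_at v)"

text \<open>A linear change is suitable if the new \<open>y\<^sub>1\<close>-axis, along which \<open>u\<close> evolves, meets \<open>V\<close>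
  transversally at \<open>v\<close>.\<close>

definition suitable_change ::
    "'n \<Rightarrow> 'n ratfun \<Rightarrow> 'n cspace \<Rightarrow> ('n::{finite,linorder}) cmatrix \<Rightarrow> bool" where
  "suitable_change i1 \<psi> v A \<longleftrightarrow> invertible A \<and> local_parameters_omitting \<psi> A v i1"

definition point_over ::
    "('n \<Rightarrow> 'n cpoly) \<Rightarrow> 'n ratfun set set \<Rightarrow> 'n ratfun set \<Rightarrow> 'n cspace \<Rightarrow> 'n::{finite,linorder} ratfun set \<Rightarrow> bool" where
  "point_over F X \<Gamma> v e \<longleftrightarrow> e \<in> closed_points X \<and> e \<subseteq> \<Gamma> \<and>
     (\<forall>i. rat_of_poly (F i) \<in> e \<and> value_at e (rat_of_poly (F i)) = v $ i)"

text \<open>A branch of \<open>x\<^sub>1\<^sup>1\<^sup>/\<^sup>m\<close> near \<open>e\<close>, off \<open>\<Gamma>\<close>; a closed point \<open>p\<close> lies on \<open>\<Gamma>\<close> iff \<open>p \<subseteq> \<Gamma>\<close>.\<close>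

definition root_branch ::
    "'n ratfun set set \<Rightarrow> 'n ratfun set \<Rightarrow> 'n ratfun set \<Rightarrow> 'n::{finite,linorder} \<Rightarrow> nat \<Rightarrow>
     ('n ratfun set \<Rightarrow> complex) \<Rightarrow> bool" where
  "root_branch X \<Gamma> e i1 m u \<longleftrightarrow>
     (\<exists>U. openin (classical_topology X) U \<and> e \<in> U \<and>
        continuous_map (subtopology (classical_topology X) (U - {p. p \<subseteq> \<Gamma>})) euclidean u \<and>
        (\<forall>p\<in>U. \<not> p \<subseteq> \<Gamma> \<longrightarrow> coord i1 \<in> p \<and> u p ^ m = value_at p (coord i1)))"

text \<open>
  Local analytic parameters at \<open>e\<close>: centred at \<open>e\<close>, a homeomorphism from a neighbourhood of \<open>e\<close>
  onto an open subset of \<open>\<complex>\<^sup>n\<close>, and every function regular at \<open>e\<close> is a convergent power series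
  in them.
\<close>

definition analytic_parameters ::
    "'n ratfun set set \<Rightarrow> 'n ratfun set \<Rightarrow> ('n::{finite,linorder} \<Rightarrow> 'n ratfun set \<Rightarrow> complex) \<Rightarrow> bool" where
  "analytic_parameters X e \<theta> \<longleftrightarrow>
     (\<forall>i. \<theta> i e = 0) \<and>
     (\<exists>U W. openin (classical_topology X) U \<and> e \<in> U \<and> open W \<and>
        homeomorphic_map (subtopology (classical_topology X) U) (top_of_set W)
          (\<lambda>p. (\<chi> i. \<theta> i p) :: 'n cspace)) \<and>
     (\<forall>h\<in>e. \<exists>U c. openin (classical_topology X) U \<and> e \<in> U \<and>
        (\<forall>p\<in>U. h \<in> p \<and>
           ((\<lambda>\<alpha> :: 'n \<Rightarrow> nat. c \<alpha> * (\<Prod>i\<in>UNIV. \<theta> i p ^ \<alpha> i)) has_sum value_at p h) UNIV))"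

text \<open>The functions \<open>y\<^sub>i\<close> (\<open>i \<noteq> l\<close>), with \<open>u\<^sup>-\<^sup>1\<close>, extended by 0 to \<open>\<Gamma>\<close>, in the place of \<open>y\<^sub>l\<close>.\<close>

definition parameters_at_infinity ::
    "('n \<Rightarrow> 'n cpoly) \<Rightarrow> 'n cmatrix \<Rightarrow> 'n cspace \<Rightarrow> 'n ratfun set \<Rightarrow>
     ('n ratfun set \<Rightarrow> complex) \<Rightarrow> 'n \<Rightarrow> 'n::{finite,linorder} \<Rightarrow> 'n ratfun set \<Rightarrow> complex" where
  "parameters_at_infinity F A v \<Gamma> u l i p =
     (if i = l then (if p \<subseteq> \<Gamma> then 0 else inverse (u p)) else value_at p (new_comp F A v i))"

text \<open>
  Near \<open>e\<close>, the evolution of \<open>u\<close> along the curves \<open>f\<^sub>1 = r\<close>, \<open>f\<^sub>i = c\<^sub>i\<close> (\<open>i \<noteq> 1\<close>) of \<open>X\<^sub>0\<close>, for all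
  \<open>c \<in> C\<close>, is \<open>du/dr = u\<^sup>K\<^sup>+\<^sup>1 (\<Sum>j. q\<^sub>j u\<^sup>-\<^sup>j)\<close>.  A curve is any continuous local parametrization by
  \<open>r\<close>; \<open>q j \<alpha>\<close> is the coefficient in \<open>q\<^sub>j\<close> of the monomial \<open>y\<^sup>\<alpha>\<close>, and only monomials without
  \<open>y\<^sub>l\<close> occur.
\<close>

definition evolution_expansion ::
    "('n \<Rightarrow> 'n cpoly) \<Rightarrow> 'n ratfun set set \<Rightarrow> 'n cmatrix \<Rightarrow> 'n cspace \<Rightarrow> 'n ratfun set \<Rightarrow>
     ('n ratfun set \<Rightarrow> complex) \<Rightarrow> 'n \<Rightarrow> 'n::{finite,linorder} \<Rightarrow> ('n cspace) set \<Rightarrow>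
     int \<Rightarrow> (nat \<Rightarrow> ('n \<Rightarrow> nat) \<Rightarrow> complex) \<Rightarrow> bool" where
  "evolution_expansion F X A v e u i1 l C K q \<longleftrightarrow>
     (\<exists>U. openin (classical_topology X) U \<and> e \<in> U \<and>
       (\<forall>c\<in>C. \<forall>S \<gamma>. open S \<and> continuous_map (top_of_set S) (classical_topology X) \<gamma> \<and>
          (\<forall>r\<in>S. \<gamma> r \<in> U \<and> range coord \<subseteq> \<gamma> r \<and>
             value_at (\<gamma> r) (new_comp F A v i1) = r \<and>
             (\<forall>i. i \<noteq> i1 \<longrightarrow> value_at (\<gamma> r) (new_comp F A v i) = c $ i)) \<longrightarrow>
          (\<forall>r\<in>S. \<exists>s.
             ((\<lambda>(j, \<alpha>). q j \<alpha> * inverse (u (\<gamma> r)) ^ j *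
                 (\<Prod>i\<in>UNIV - {l}. value_at (\<gamma> r) (new_comp F A v i) ^ \<alpha> i)) has_sum s)
               (UNIV \<times> {\<alpha>. \<alpha> l = 0}) \<and>
             ((\<lambda>r. u (\<gamma> r)) has_field_derivative u (\<gamma> r) powi (K + 1) * s) (at r))))"

end

theory Submission
  imports Defs "HOL-Complex_Analysis.Complex_Analysis"
begin

no_notation fps_nth (infixl "$" 75)

text \<open>
  Let \<open>p\<close> be the pullback of a local equation of \<open>V\<close>, \<open>k\<close> its order along \<open>\<Gamma>\<close> and \<open>m\<close> that of \<open>1/x\<^sub>1\<close>, so that
  \<open>w = p\<^sup>m x\<^sub>1\<^sup>k\<close> is a unit at the generic point of \<open>\<Gamma>\<close>. The vector fields \<open>D\<close> dual to the components of \<open>f\<close>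
  act on \<open>\<complex>(Y\<^sub>0)\<close> as partial derivatives. They have poles of order at most \<open>k - 1\<close> along \<open>\<Gamma>\<close>: a larger pole
  would give a nonzero derivation of the residue field of \<open>\<Gamma>\<close> over that of \<open>V\<close>, or else make the order
  of \<open>p\<close> drop by too much. Hence \<open>p D(w)/w\<close> vanishes on \<open>\<Gamma>\<close>, and the logarithmic derivative of \<open>w\<close> gives
  \<open>k p D(x\<^sub>1)/x\<^sub>1 = p D(w)/w - m D(p)\<close>. Over a generic point of \<open>V\<close> all these functions are regular on \<open>\<Gamma>\<close>,
  \<open>D(p)\<close> does not vanish by transversality, and \<open>p\<close> has the size of \<open>u\<^sup>-\<^sup>k\<close>; so \<open>du/dr\<close> is \<open>u\<^sup>k\<^sup>+\<^sup>1\<close> times a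
  function bounded above and away from 0.

  The exponent is unique because the curve \<open>y\<^sub>i = 0\<close> (\<open>i \<noteq> 1\<close>) has points off \<open>\<Gamma>\<close> arbitrarily close to \<open>e\<close>,
  along which two expansions of \<open>du/dr\<close> can be compared as \<open>u\<close> tends to infinity.
\<close>

section \<open>Polynomials\<close>

text \<open>In local coordinates with p = \<pi>^k, the bound k - 1 on the poles is visible in d/dp =
  (1/(k \<pi>^(k-1))) d/d\<pi>. The proof obtains it inside the function field, from derivations
  alone. The obstacle is the passage to a closed point e: an element of the local ring of \<Gamma>
  may have poles at closed points of \<Gamma>, and a unit of that ring may have zeros there. Because
  the residue extension is algebraic, one polynomial outside the ideal of V controls such a function
  at all e over v at once; a product of such polynomials cuts out the excluded set. Size estimates
  alone do not give an expansion of du/dr. The function that is expanded is regular at e and has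
  size |u|^(-N) with N = k (m - 1): the identity for D(x_1), rewritten with w = p^m x_1^k, carries a
  factor p^(m-1), and p has size |u|^(-k). Its power series has to be divisible by the N-th power of
  the parameter 1/u. This is proved on one-variable slices, where the upper estimate kills the low
  coefficients and the lower one keeps the N-th coefficient at the origin nonzero.\<close>

lemma poly_mapping_additive_induct [case_names zero single add]:
  assumes "P 0" "\<And>k v. P (Poly_Mapping.single k v)"
    and "\<And>p q. P p \<Longrightarrow> P q \<Longrightarrow> P (p + q)"
  shows "P (p :: 'a \<Rightarrow>\<^sub>0 'b::comm_monoid_add)"
proof (induction p rule: update_induct)
  case const
  show ?case by fact
next
  case (update p k v)
  have "Poly_Mapping.update k v p = p + Poly_Mapping.single k v"
    using update(1) by (intro poly_mapping_eqI)
      (auto simp: lookup_update lookup_add lookup_single in_keys_iff when_def)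
  with update assms show ?case by simp
qed

abbreviation cpoly_const :: "complex \<Rightarrow> 'n cpoly" where
  "cpoly_const c \<equiv> Poly_Mapping.single 0 c"

abbreviation cpoly_var :: "'n \<Rightarrow> 'n cpoly" where
  "cpoly_var i \<equiv> Poly_Mapping.single (Poly_Mapping.single i (Suc 0)) 1"

text \<open>Constants and coordinates generate the polynomial ring, so identities between
  homomorphisms or between derivations need checking only there.\<close>

lemma cpoly_induct [case_names const var add mult]:
  fixes p :: "'n::finite cpoly"
  assumes c: "\<And>c. P (cpoly_const c)" and v: "\<And>i. P (cpoly_var i)"
    and a: "\<And>p q. P p \<Longrightarrow> P q \<Longrightarrow> P (p + q)" and m: "\<And>p q. P p \<Longrightarrow> P q \<Longrightarrow> P (p * q)"
  shows "P p"
proof (induction p rule: poly_mapping_additive_induct)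
  case zero
  show ?case using c[of 0] by simp
next
  case (single \<alpha> c)
  have "P (Poly_Mapping.single \<alpha> 1)"
  proof (induction \<alpha> rule: poly_mapping_additive_induct)
    case zero
    show ?case using assms(1)[of 1] by simp
  next
    case (single k n)
    show ?case
    proof (induction n)
      case 0
      show ?case using assms(1)[of 1] by simp
    next
      case (Suc n)
      have "Poly_Mapping.single (Poly_Mapping.single k (Suc n)) (1::complex)
          = Poly_Mapping.single (Poly_Mapping.single k n) 1 * cpoly_var k"
        by (simp add: mult_single single_add[symmetric])
      then show ?case using Suc v m by metis
    qed
  next
    case (add \<alpha> \<beta>)
    have "Poly_Mapping.single (\<alpha> + \<beta>) (1::complex) = Poly_Mapping.single \<alpha> 1 * Poly_Mapping.single \<beta> 1"
      by (simp add: mult_single)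
    then show ?case using add m by metis
  qed
  moreover have "Poly_Mapping.single \<alpha> c = cpoly_const c * Poly_Mapping.single \<alpha> 1"
    by (simp add: mult_single)
  ultimately show ?case using c m by metis
next
  case (add p q)
  then show ?case by (rule a)
qed

definition ring_hom_on :: "('a::comm_ring_1 \<Rightarrow> 'b::comm_ring_1) \<Rightarrow> bool" where
  "ring_hom_on h \<longleftrightarrow> h 1 = 1 \<and> (\<forall>a b. h (a + b) = h a + h b) \<and> (\<forall>a b. h (a * b) = h a * h b)"

lemma ring_homD:
  assumes "ring_hom_on h"
  shows "h 1 = 1" "h (a + b) = h a + h b" "h (a * b) = h a * h b" "h 0 = 0" "h (- a) = - h a"
    "h (a - b) = h a - h b" "h (a ^ n) = h a ^ n"
    "h (sum f S) = (\<Sum>x\<in>S. h (f x))" "h (prod f S) = (\<Prod>x\<in>S. h (f x))" "h (of_nat n) = of_nat n"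
    "h (of_int k) = of_int k"
proof -
  show 1: "h 1 = 1" and 2: "\<And>a b. h (a + b) = h a + h b" and 3: "\<And>a b. h (a * b) = h a * h b"
    using assms by (auto simp: ring_hom_on_def)
  show 4: "h 0 = 0" using 2[of 0 0] by simp
  show 5: "h (- a) = - h a" for a using 2[of a "- a"] 4 by (simp add: eq_neg_iff_add_eq_0 add.commute)
  show "h (a - b) = h a - h b" using 2[of a "- b"] 5 by simp
  show "h (a ^ n) = h a ^ n" by (induction n) (auto simp: 1 3)
  show "h (sum f S) = (\<Sum>x\<in>S. h (f x))" by (induction S rule: infinite_finite_induct) (auto simp: 2 4)
  show "h (prod f S) = (\<Prod>x\<in>S. h (f x))" by (induction S rule: infinite_finite_induct) (auto simp: 1 3)
  show 6: "h (of_nat n) = of_nat n" for n by (induction n) (auto simp: 1 2 4)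
  show "h (of_int k) = of_int k" by (cases k rule: int_cases2) (auto simp: 5 6)
qed

lemma poly_subst_add:
  assumes "ring_hom_on \<phi>"
  shows "poly_subst \<phi> a (p + q) = poly_subst \<phi> a p + poly_subst \<phi> a q"
  unfolding poly_subst_def
  by (rule setsum_keys_plus_distrib) (auto simp: ring_homD[OF assms] distrib_right)

lemma poly_subst_single:
  assumes "ring_hom_on \<phi>"
  shows "poly_subst \<phi> a (Poly_Mapping.single \<alpha> c) = \<phi> c * (\<Prod>i\<in>UNIV. a i ^ Poly_Mapping.lookup \<alpha> i)"
  unfolding poly_subst_def by (auto simp: ring_homD[OF assms])

lemma poly_subst_const:
  assumes "ring_hom_on \<phi>"
  shows "poly_subst \<phi> a (cpoly_const c) = \<phi> c"
  by (simp add: poly_subst_single[OF assms])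

lemma poly_subst_var:
  assumes "ring_hom_on \<phi>"
  shows "poly_subst \<phi> a (cpoly_var i) = a i"
proof -
  have "(\<Prod>j\<in>UNIV. a j ^ Poly_Mapping.lookup (Poly_Mapping.single i 1) j) = (\<Prod>j\<in>UNIV. if j = i then a i else 1)"
    by (rule prod.cong) (auto simp: lookup_single when_def)
  then show ?thesis by (simp add: poly_subst_single[OF assms] ring_homD[OF assms])
qed

lemma poly_subst_mult:
  assumes "ring_hom_on \<phi>"
  shows "poly_subst \<phi> a (p * q) = poly_subst \<phi> a p * poly_subst \<phi> a q"
proof (induction p rule: poly_mapping_additive_induct)
  case zero
  show ?case by (simp add: poly_subst_def)
next
  case (single \<alpha> c)
  show ?case
  proof (induction q rule: poly_mapping_additive_induct)
    case zero
    show ?case by (simp add: poly_subst_def)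
  next
    case (single \<beta> d)
    show ?case by (simp add: mult_single poly_subst_single[OF assms] ring_homD[OF assms] lookup_add
          power_add prod.distrib algebra_simps)
  next
    case (add p q)
    then show ?case by (simp add: poly_subst_add[OF assms] distrib_left)
  qed
next
  case (add p q)
  then show ?case by (simp add: poly_subst_add[OF assms] distrib_right)
qed

lemma ring_hom_poly_subst: "ring_hom_on \<phi> \<Longrightarrow> ring_hom_on (poly_subst \<phi> a)"
  using poly_subst_const[of \<phi> a 1]
  by (auto simp: ring_hom_on_def poly_subst_add poly_subst_mult)

lemma ring_hom_id: "ring_hom_on (\<lambda>c. c)"
  by (auto simp: ring_hom_on_def)

lemma ring_hom_cpoly_const: "ring_hom_on cpoly_const"
  by (auto simp: ring_hom_on_def single_add mult_single)

lemma ring_hom_comp: "ring_hom_on f \<Longrightarrow> ring_hom_on g \<Longrightarrow> ring_hom_on (\<lambda>x. f (g x))"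
  by (auto simp: ring_hom_on_def)

lemma ring_hom_cpoly_eqI:
  fixes h k :: "'n::finite cpoly \<Rightarrow> 'b::comm_ring_1"
  assumes "ring_hom_on h" "ring_hom_on k"
    and "\<And>c. h (cpoly_const c) = k (cpoly_const c)" "\<And>i. h (cpoly_var i) = k (cpoly_var i)"
  shows "h p = k p"
  by (induction p rule: cpoly_induct) (simp_all only: assms(3,4) ring_homD[OF assms(1)] ring_homD[OF assms(2)])

lemma ring_hom_peval: "ring_hom_on (\<lambda>p. peval p x)"
  unfolding peval_def by (rule ring_hom_poly_subst[OF ring_hom_id])

lemmas peval_hom = ring_homD[OF ring_hom_peval]

lemma peval_const [simp]: "peval (cpoly_const c) x = c"
  unfolding peval_def by (rule poly_subst_const[OF ring_hom_id])

lemma peval_var [simp]: "peval (cpoly_var i) x = x $ i"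
  unfolding peval_def by (rule poly_subst_var[OF ring_hom_id])

lemma ring_hom_rat_of_poly: "ring_hom_on rat_of_poly"
  by (auto simp: ring_hom_on_def rat_of_poly_def One_fract_def)

lemmas rat_of_poly_hom = ring_homD[OF ring_hom_rat_of_poly]

lemma rat_of_poly_eq_iff [simp]: "rat_of_poly p = rat_of_poly q \<longleftrightarrow> p = q"
  by (simp add: rat_of_poly_def eq_fract)

lemma rat_of_poly_eq_0_iff [simp]: "rat_of_poly p = 0 \<longleftrightarrow> p = 0"
  using rat_of_poly_eq_iff[of p 0] by (simp add: rat_of_poly_hom)

lemma ring_hom_cst: "ring_hom_on cst"
  unfolding cst_def by (rule ring_hom_comp[OF ring_hom_rat_of_poly ring_hom_cpoly_const])

lemmas cst_hom = ring_homD[OF ring_hom_cst]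

lemma cst_eq_iff [simp]: "cst c = cst d \<longleftrightarrow> c = d"
  by (metis cst_def rat_of_poly_eq_iff lookup_single_eq)

lemma cst_eq_0_iff [simp]: "cst c = 0 \<longleftrightarrow> c = 0"
  using cst_eq_iff[of c 0] by (simp add: cst_hom)

lemma cst_inverse: "cst (inverse c) = inverse (cst c)"
proof (cases "c = 0")
  case False
  then have "cst c * cst (inverse c) = 1" by (simp add: cst_hom(3)[symmetric] cst_hom)
  then show ?thesis by (metis inverse_unique)
qed (simp add: cst_hom)

lemma coord_eq: "coord i = rat_of_poly (cpoly_var i)"
  by (simp add: coord_def)

lemma ring_hom_pullback: "ring_hom_on (pullback F)"
  unfolding pullback_def by (rule ring_hom_poly_subst[OF ring_hom_cst])

lemma pullback_const [simp]: "pullback F (cpoly_const c) = cst c"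
  unfolding pullback_def by (rule poly_subst_const[OF ring_hom_cst])

lemma pullback_var [simp]: "pullback F (cpoly_var i) = rat_of_poly (F i)"
  unfolding pullback_def by (rule poly_subst_var[OF ring_hom_cst])

section \<open>Derivations\<close>

definition derivation :: "('a::comm_ring_1 \<Rightarrow> 'a) \<Rightarrow> bool" where
  "derivation D \<longleftrightarrow> (\<forall>a b. D (a + b) = D a + D b) \<and> (\<forall>a b. D (a * b) = D a * b + a * D b)"

lemma derivationD:
  assumes "derivation D"
  shows "D (a + b) = D a + D b" "D (a * b) = D a * b + a * D b" "D 0 = 0" "D 1 = 0" "D (- a) = - D a"
    "D (a - b) = D a - D b" "D (a ^ n) = of_nat n * a ^ (n - 1) * D a"
    "D (sum f S) = (\<Sum>x\<in>S. D (f x))"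
proof -
  show 1: "\<And>a b. D (a + b) = D a + D b" and 2: "\<And>a b. D (a * b) = D a * b + a * D b"
    using assms by (auto simp: derivation_def)
  show 3: "D 0 = 0" using 1[of 0 0] by simp
  show 4: "D 1 = 0" using 2[of 1 1] by simp
  show 5: "D (- a) = - D a" for a using 1[of a "- a"] 3 by (simp add: eq_neg_iff_add_eq_0 add.commute)
  show "D (a - b) = D a - D b" using 1[of a "- b"] 5 by simp
  show "D (sum f S) = (\<Sum>x\<in>S. D (f x))" by (induction S rule: infinite_finite_induct) (auto simp: 1 3)
  show "D (a ^ n) = of_nat n * a ^ (n - 1) * D a"
  proof (induction n)
    case (Suc n)
    show ?case
    proof (cases n)
      case (Suc k)
      with Suc.IH show ?thesis by (simp add: 2 algebra_simps)
    qed (simp add: 2 4)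
  qed (simp add: 4)
qed

lemma pdiff_add: "pdiff i (p + q) = pdiff i p + pdiff i q"
  unfolding pdiff_def
  by (rule setsum_keys_plus_distrib) (auto simp: distrib_left single_add)

lemma pdiff_single: "pdiff i (Poly_Mapping.single \<alpha> c) =
    Poly_Mapping.single (\<alpha> - Poly_Mapping.single i 1) (of_nat (Poly_Mapping.lookup \<alpha> i) * c)"
  by (auto simp: pdiff_def)

lemma pdiff_const [simp]: "pdiff i (cpoly_const c) = 0"
  by (simp add: pdiff_single)

lemma pdiff_var [simp]: "pdiff i (cpoly_var j) = (if i = j then 1 else 0)"
  by (auto simp: pdiff_single lookup_single when_def)

lemma pdiff_mult:
  "pdiff i (p * q) = pdiff i p * q + p * pdiff i (q :: 'n cpoly)"
proof (induction p rule: poly_mapping_additive_induct)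
  case zero
  show ?case by (simp add: pdiff_def)
next
  case (single \<alpha> c)
  show ?case
  proof (induction q rule: poly_mapping_additive_induct)
    case zero
    show ?case by (simp add: pdiff_def)
  next
    case (single \<beta> d)
    have e: "Poly_Mapping.single (\<alpha> + \<beta> - Poly_Mapping.single i (Suc 0)) (of_nat (Poly_Mapping.lookup \<alpha> i) * x) =
       Poly_Mapping.single (\<alpha> - Poly_Mapping.single i (Suc 0) + \<beta>) (of_nat (Poly_Mapping.lookup \<alpha> i) * x)"
      for \<alpha> \<beta> :: "'n \<Rightarrow>\<^sub>0 nat" and x :: complex
    proof (cases "Poly_Mapping.lookup \<alpha> i = 0")
      case False
      then have "\<alpha> + \<beta> - Poly_Mapping.single i (Suc 0) = \<alpha> - Poly_Mapping.single i (Suc 0) + \<beta>"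
        by (intro poly_mapping_eqI) (auto simp: lookup_add lookup_minus lookup_single when_def)
      then show ?thesis by simp
    qed simp
    have "pdiff i (Poly_Mapping.single \<alpha> c * Poly_Mapping.single \<beta> d) =
       Poly_Mapping.single (\<alpha> + \<beta> - Poly_Mapping.single i (Suc 0)) (of_nat (Poly_Mapping.lookup \<alpha> i) * (c * d))
     + Poly_Mapping.single (\<beta> + \<alpha> - Poly_Mapping.single i (Suc 0)) (of_nat (Poly_Mapping.lookup \<beta> i) * (c * d))"
      by (simp add: mult_single pdiff_single lookup_add distrib_right single_add add.commute)
    then show ?case
      unfolding e by (simp add: mult_single pdiff_single ac_simps)
  next
    case (add p q)
    then show ?case by (simp add: pdiff_add algebra_simps)
  qed
next
  case (add p q)
  then show ?case by (simp add: pdiff_add algebra_simps)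
qed

lemma derivation_pdiff: "derivation (pdiff i)"
  by (simp add: derivation_def pdiff_add pdiff_mult)

lemma lookup_pdiff:
  "Poly_Mapping.lookup (pdiff i p) \<beta> =
     of_nat (Suc (Poly_Mapping.lookup \<beta> i)) * Poly_Mapping.lookup p (\<beta> + Poly_Mapping.single i 1)"
proof (induction p rule: poly_mapping_additive_induct)
  case zero
  show ?case by (simp add: pdiff_def)
next
  case (single \<alpha> c)
  show ?case
  proof (cases "\<alpha> = \<beta> + Poly_Mapping.single i 1")
    case True
    then show ?thesis by (simp add: pdiff_single lookup_add)
  next
    case False
    have "\<alpha> = (\<alpha> - Poly_Mapping.single i 1) + Poly_Mapping.single i 1" if "Poly_Mapping.lookup \<alpha> i \<noteq> 0"
      using that by (intro poly_mapping_eqI) (auto simp: lookup_add lookup_minus lookup_single when_def)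
    with False have "Poly_Mapping.lookup \<alpha> i = 0 \<or> \<alpha> - Poly_Mapping.single i 1 \<noteq> \<beta>" by metis
    with False show ?thesis by (auto simp: pdiff_single lookup_single when_def)
  qed
next
  case (add p q)
  then show ?case by (simp add: pdiff_add lookup_add algebra_simps)
qed

text \<open>In characteristic 0 a nonconstant polynomial has a nonzero partial derivative, of
  smaller degree; repeated differentiation therefore ends in a nonzero constant. This is applied to
  the kernel of the pullback and to the ideal of V.\<close>

lemma nonzero_const_of_pdiff_closed:
  fixes I :: "'n::finite cpoly set"
  assumes closed: "\<And>p i. p \<in> I \<Longrightarrow> pdiff i p \<in> I" and p: "p \<in> I" "p \<noteq> 0"
  shows "\<exists>c. c \<noteq> 0 \<and> cpoly_const c \<in> I"
proof -
  let ?deg = "\<lambda>\<alpha> :: 'n \<Rightarrow>\<^sub>0 nat. \<Sum>i\<in>UNIV. Poly_Mapping.lookup \<alpha> i"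
  have "\<exists>c. c \<noteq> 0 \<and> cpoly_const c \<in> I"
    if "p \<in> I" "p \<noteq> 0" "\<forall>\<alpha>\<in>Poly_Mapping.keys p. ?deg \<alpha> \<le> d" for p d
    using that
  proof (induction d arbitrary: p)
    case 0
    then have "\<alpha> = 0" if "\<alpha> \<in> Poly_Mapping.keys p" for \<alpha>
      using that by (intro poly_mapping_eqI) auto
    then have "Poly_Mapping.lookup p \<alpha> = 0" if "\<alpha> \<noteq> 0" for \<alpha>
      using that by (meson in_keys_iff)
    then have "p = cpoly_const (Poly_Mapping.lookup p 0)"
      by (intro poly_mapping_eqI) (auto simp: lookup_single when_def)
    with 0 show ?case by (metis single_zero)
  next
    case (Suc d)
    show ?case
    proof (cases "\<exists>\<alpha>\<in>Poly_Mapping.keys p. \<exists>i. Poly_Mapping.lookup \<alpha> i > 0")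
      case True
      then obtain \<alpha> i where \<alpha>: "\<alpha> \<in> Poly_Mapping.keys p" "Poly_Mapping.lookup \<alpha> i > 0" by blast
      have "\<alpha> = (\<alpha> - Poly_Mapping.single i 1) + Poly_Mapping.single i 1"
        using \<alpha>(2) by (intro poly_mapping_eqI) (auto simp: lookup_add lookup_minus lookup_single when_def)
      then have "Poly_Mapping.lookup (pdiff i p) (\<alpha> - Poly_Mapping.single i 1) \<noteq> 0"
        using \<alpha>(1) unfolding lookup_pdiff by (metis in_keys_iff mult_eq_0_iff of_nat_eq_0_iff nat.distinct(1))
      then have nz: "pdiff i p \<noteq> 0" by auto
      have "?deg \<beta> \<le> d" if "\<beta> \<in> Poly_Mapping.keys (pdiff i p)" for \<beta>
      proof -
        have "\<beta> + Poly_Mapping.single i 1 \<in> Poly_Mapping.keys p"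
          using that by (auto simp: in_keys_iff lookup_pdiff)
        then have "?deg (\<beta> + Poly_Mapping.single i 1) \<le> Suc d" using Suc.prems by blast
        moreover have "(\<Sum>j\<in>UNIV. Poly_Mapping.lookup (Poly_Mapping.single i (1::nat)) j) = (\<Sum>j\<in>UNIV. if j = i then 1 else 0)"
          by (rule sum.cong) (auto simp: lookup_single when_def)
        ultimately show ?thesis by (simp add: lookup_add sum.distrib)
      qed
      then show ?thesis using Suc.IH[OF closed[OF Suc.prems(1)] nz] by blast
    next
      case False
      then show ?thesis using Suc.IH[OF Suc.prems(1,2)] by auto
    qed
  qed
  moreover have "\<exists>d. \<forall>\<alpha>\<in>Poly_Mapping.keys p. ?deg \<alpha> \<le> d"
    using finite_imageI[OF finite_keys, of ?deg p] by (meson finite_nat_set_iff_bounded_le image_eqI)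
  ultimately show ?thesis using p by blast
qed

lemma derivation_poly_subst:
  fixes a :: "'n::finite \<Rightarrow> 'b::comm_ring_1"
  assumes \<phi>: "ring_hom_on \<phi>" and D: "derivation D" and const: "\<And>c. D (\<phi> c) = 0"
  shows "D (poly_subst \<phi> a p) = (\<Sum>j\<in>UNIV. poly_subst \<phi> a (pdiff j p) * D (a j))"
proof (induction p rule: cpoly_induct)
  case (const c)
  show ?case by (simp add: poly_subst_const[OF \<phi>] assms(3) ring_homD[OF ring_hom_poly_subst[OF \<phi>]])
next
  case (var i)
  have "(\<Sum>j\<in>UNIV. poly_subst \<phi> a (pdiff j (cpoly_var i)) * D (a j)) = (\<Sum>j\<in>UNIV. if j = i then D (a j) else 0)"
    by (rule sum.cong) (auto simp: ring_homD[OF ring_hom_poly_subst[OF \<phi>]])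
  then show ?case by (simp add: poly_subst_var[OF \<phi>])
next
  case (add p q)
  then show ?case
    by (simp add: derivationD[OF D] pdiff_add ring_homD[OF ring_hom_poly_subst[OF \<phi>]] distrib_right sum.distrib)
next
  case (mult p q)
  then show ?case
    by (simp add: derivationD[OF D] pdiff_mult ring_homD[OF ring_hom_poly_subst[OF \<phi>]] distrib_right
       distrib_left sum.distrib sum_distrib_left sum_distrib_right ac_simps)
qed

text \<open>The quotient rule. The choice runs over all representations of \<open>h\<close> as a
  fraction; that they all give the same value is the content of
  \<open>frac_deriv_Fract\<close>.\<close>

definition frac_deriv :: "('a::idom \<Rightarrow> 'a) \<Rightarrow> 'a fract \<Rightarrow> 'a fract" where
  "frac_deriv \<delta> h = (SOME d. \<exists>a b. b \<noteq> 0 \<and> h = Fract a b \<and> d = Fract (\<delta> a * b - a * \<delta> b) (b * b))"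

lemma frac_deriv_Fract:
  assumes \<delta>: "derivation \<delta>" and "b \<noteq> 0"
  shows "frac_deriv \<delta> (Fract a b) = Fract (\<delta> a * b - a * \<delta> b) (b * b)"
  unfolding frac_deriv_def
proof (rule some_equality)
  show "\<exists>a' b'. b' \<noteq> 0 \<and> Fract a b = Fract a' b' \<and>
     Fract (\<delta> a * b - a * \<delta> b) (b * b) = Fract (\<delta> a' * b' - a' * \<delta> b') (b' * b')"
    using assms by blast
next
  fix d assume "\<exists>a' b'. b' \<noteq> 0 \<and> Fract a b = Fract a' b' \<and> d = Fract (\<delta> a' * b' - a' * \<delta> b') (b' * b')"
  then obtain a' b' where *: "b' \<noteq> 0" "Fract a b = Fract a' b'" "d = Fract (\<delta> a' * b' - a' * \<delta> b') (b' * b')"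
    by blast
  have e: "a * b' = a' * b" using * assms by (simp add: eq_fract)
  then have "\<delta> (a * b') = \<delta> (a' * b)" by simp
  then have e': "\<delta> a * b' + a * \<delta> b' = \<delta> a' * b + a' * \<delta> b" by (simp add: derivationD[OF \<delta>])
  have "(\<delta> a' * b' - a' * \<delta> b') * (b * b) = (\<delta> a * b - a * \<delta> b) * (b' * b')"
    using e e' by algebra
  then show "d = Fract (\<delta> a * b - a * \<delta> b) (b * b)"
    using * assms by (simp add: eq_fract)
qed

lemma derivation_frac_deriv:
  assumes \<delta>: "derivation \<delta>"
  shows "derivation (frac_deriv \<delta>)"
  unfolding derivation_def
proof (intro conjI allI)
  fix x y :: "'a fract"
  obtain a b where x: "x = Fract a b" "b \<noteq> 0" by (cases x) auto
  obtain c d where y: "y = Fract c d" "d \<noteq> 0" by (cases y) auto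
  show "frac_deriv \<delta> (x + y) = frac_deriv \<delta> x + frac_deriv \<delta> y"
    using x y by (simp add: frac_deriv_Fract[OF \<delta>] eq_fract derivationD[OF \<delta>] algebra_simps)
  show "frac_deriv \<delta> (x * y) = frac_deriv \<delta> x * y + x * frac_deriv \<delta> y"
    using x y by (simp add: frac_deriv_Fract[OF \<delta>] eq_fract derivationD[OF \<delta>] algebra_simps)
qed

lemma frac_deriv_rat_of_poly:
  "derivation \<delta> \<Longrightarrow> frac_deriv \<delta> (rat_of_poly p) = rat_of_poly (\<delta> p)"
  by (simp add: rat_of_poly_def frac_deriv_Fract derivationD)

section \<open>Subrings of the function field\<close>

lemma complex_subalgebraD:
  assumes "complex_subalgebra A"
  shows "cst c \<in> A" "0 \<in> A" "1 \<in> A" "a \<in> A \<Longrightarrow> b \<in> A \<Longrightarrow> a - b \<in> A" "a \<in> A \<Longrightarrow> b \<in> A \<Longrightarrow> a * b \<in> A"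
    "a \<in> A \<Longrightarrow> - a \<in> A" "a \<in> A \<Longrightarrow> b \<in> A \<Longrightarrow> a + b \<in> A" "a \<in> A \<Longrightarrow> a ^ n \<in> A"
    "(\<And>x. x \<in> S \<Longrightarrow> f x \<in> A) \<Longrightarrow> sum f S \<in> A" "(\<And>x. x \<in> S \<Longrightarrow> f x \<in> A) \<Longrightarrow> prod f S \<in> A"
    "of_nat n \<in> A"
proof -
  show 1: "cst c \<in> A" for c using assms by (auto simp: complex_subalgebra_def)
  show 2: "0 \<in> A" "1 \<in> A" using 1[of 0] 1[of 1] by (auto simp: cst_hom)
  show 3: "a \<in> A \<Longrightarrow> b \<in> A \<Longrightarrow> a - b \<in> A" and 4: "a \<in> A \<Longrightarrow> b \<in> A \<Longrightarrow> a * b \<in> A" for a b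
    using assms by (auto simp: complex_subalgebra_def)
  show 5: "a \<in> A \<Longrightarrow> - a \<in> A" for a using 3[of 0 a] 2 by simp
  show 6: "a \<in> A \<Longrightarrow> b \<in> A \<Longrightarrow> a + b \<in> A" for a b using 3[of a "- b"] 5 by simp
  show "a \<in> A \<Longrightarrow> a ^ n \<in> A" by (induction n) (auto simp: 2 4)
  show "(\<And>x. x \<in> S \<Longrightarrow> f x \<in> A) \<Longrightarrow> sum f S \<in> A"
    by (induction S rule: infinite_finite_induct) (auto simp: 2 6)
  show "(\<And>x. x \<in> S \<Longrightarrow> f x \<in> A) \<Longrightarrow> prod f S \<in> A"
    by (induction S rule: infinite_finite_induct) (auto simp: 2 4)
  show "of_nat n \<in> A" by (induction n) (auto simp: 2 6)
qed

lemma complex_subalgebra_generated_algebra: "complex_subalgebra (generated_algebra G)"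
  by (auto simp: generated_algebra_def complex_subalgebra_def)

lemma generated_algebra_superset: "G \<subseteq> generated_algebra G"
  by (auto simp: generated_algebra_def)

lemma generated_algebra_least: "complex_subalgebra A \<Longrightarrow> G \<subseteq> A \<Longrightarrow> generated_algebra G \<subseteq> A"
  by (auto simp: generated_algebra_def)

lemma det_ring_hom:
  assumes "ring_hom_on h"
  shows "h (det M) = det (\<chi> i j. h (M $ i $ j))"
  by (simp add: det_def ring_homD[OF assms])

section \<open>Vector fields dual to the components of a Keller map\<close>

text \<open>Cramer's rule: with determinant 1 the entries of the inverse are themselves
  determinants, hence polynomials. The rule is applied over the fraction field, and the result
  descends by injectivity of \<open>rat_of_poly\<close>.\<close>

lemma keller_map_cofactors:
  fixes F :: "'n::{finite,linorder} \<Rightarrow> 'n cpoly"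
  assumes "keller_map F"
  shows "\<exists>G. \<forall>i j. (\<Sum>k\<in>UNIV. pdiff k (F i) * G k j) = (if i = j then 1 else 0)"
proof -
  define M :: "(('n cpoly, 'n) vec, 'n) vec" where "M = (\<chi> i k. pdiff k (F i))"
  define A :: "(('n ratfun, 'n) vec, 'n) vec" where "A = (\<chi> i k. rat_of_poly (M $ i $ k))"
  define G where "G k j = det (\<chi> i k'. if k' = k then if i = j then 1 else 0 else M $ i $ k')" for k j
  have dA: "det A = 1"
    using assms det_ring_hom[OF ring_hom_rat_of_poly, of M] by (simp add: A_def keller_map_def M_def rat_of_poly_hom)
  have "(\<Sum>k\<in>UNIV. pdiff k (F i) * G k j) = (if i = j then 1 else 0)" for i j
  proof -
    define b :: "('n ratfun, 'n) vec" where "b = (\<chi> i. if i = j then 1 else 0)"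
    have G: "rat_of_poly (G k j) = det (\<chi> i k'. if k' = k then b $ i else A $ i $ k')" for k
      unfolding G_def det_ring_hom[OF ring_hom_rat_of_poly]
      by (rule arg_cong[where f = det]) (auto simp: vec_eq_iff b_def A_def rat_of_poly_hom)
    have "A *v (\<chi> k. rat_of_poly (G k j)) = b"
      using cramer[of A "\<chi> k. rat_of_poly (G k j)" b] dA by (simp add: G)
    then have "(\<Sum>k\<in>UNIV. rat_of_poly (pdiff k (F i) * G k j)) = rat_of_poly (if i = j then 1 else 0)"
      by (auto simp: matrix_vector_mult_def vec_eq_iff A_def M_def b_def rat_of_poly_hom)
    then show ?thesis by (simp only: rat_of_poly_hom(8)[symmetric] rat_of_poly_eq_iff)
  qed
  then show ?thesis by blast
qed

definition jacobian_inverse :: "('n \<Rightarrow> 'n cpoly) \<Rightarrow> 'n \<Rightarrow> 'n \<Rightarrow> 'n::{finite,linorder} cpoly" where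
  "jacobian_inverse F = (SOME G. \<forall>i j. (\<Sum>k\<in>UNIV. pdiff k (F i) * G k j) = (if i = j then 1 else 0))"

lemma jacobian_inverse:
  assumes "keller_map F"
  shows "(\<Sum>k\<in>UNIV. pdiff k (F i) * jacobian_inverse F k j) = (if i = j then 1 else 0)"
  using someI_ex[OF keller_map_cofactors[OF assms]] unfolding jacobian_inverse_def by blast

text \<open>The partial derivative with respect to the \<open>j\<close>-th coordinate of \<open>Y\<^sub>0\<close>, as a derivation of
  \<open>\<complex>(X\<^sub>0)\<close>.\<close>

definition target_deriv :: "('n \<Rightarrow> 'n cpoly) \<Rightarrow> 'n \<Rightarrow> 'n::{finite,linorder} ratfun \<Rightarrow> 'n ratfun" where
  "target_deriv F j = frac_deriv (\<lambda>p. \<Sum>k\<in>UNIV. jacobian_inverse F k j * pdiff k p)"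

lemma derivation_jacobian_inverse: "derivation (\<lambda>p. \<Sum>k\<in>UNIV. jacobian_inverse F k j * pdiff k p)"
  by (auto simp: derivation_def pdiff_add pdiff_mult algebra_simps sum.distrib sum_distrib_left)

lemma derivation_target_deriv: "derivation (target_deriv F j)"
  unfolding target_deriv_def by (rule derivation_frac_deriv[OF derivation_jacobian_inverse])

lemmas target_deriv_simps = derivationD[OF derivation_target_deriv]

lemma target_deriv_rat_of_poly:
  "target_deriv F j (rat_of_poly p) = rat_of_poly (\<Sum>k\<in>UNIV. jacobian_inverse F k j * pdiff k p)"
  unfolding target_deriv_def by (rule frac_deriv_rat_of_poly[OF derivation_jacobian_inverse])

lemma target_deriv_cst [simp]: "target_deriv F j (cst c) = 0"
  by (simp add: cst_def target_deriv_rat_of_poly rat_of_poly_hom)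

lemma target_deriv_coord: "target_deriv F j (coord k) = rat_of_poly (jacobian_inverse F k j)"
proof -
  have "(\<Sum>i\<in>UNIV. jacobian_inverse F i j * pdiff i (cpoly_var k)) = (\<Sum>i\<in>UNIV. if i = k then jacobian_inverse F i j else 0)"
    by (rule sum.cong) auto
  then show ?thesis by (simp add: coord_eq target_deriv_rat_of_poly)
qed

lemma target_deriv_component:
  assumes "keller_map F"
  shows "target_deriv F j (rat_of_poly (F i)) = (if i = j then 1 else 0)"
  using jacobian_inverse[OF assms, of i j]
  by (auto simp: target_deriv_rat_of_poly rat_of_poly_hom mult.commute)

lemma target_deriv_pullback:
  assumes "keller_map F"
  shows "target_deriv F j (pullback F p) = pullback F (pdiff j p)"
proof -
  have "target_deriv F j (pullback F p) = (\<Sum>i\<in>UNIV. pullback F (pdiff i p) * target_deriv F j (rat_of_poly (F i)))"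
    unfolding pullback_def
    by (rule derivation_poly_subst[OF ring_hom_cst derivation_target_deriv]) simp
  also have "\<dots> = (\<Sum>i\<in>UNIV. if i = j then pullback F (pdiff i p) else 0)"
    by (rule sum.cong) (auto simp: target_deriv_component[OF assms])
  finally show ?thesis by simp
qed

text \<open>Since \<open>target_deriv\<close> induces the partial derivatives on pullbacks, the
  kernel of the pullback is closed under them; a nonzero kernel would contain a nonzero constant.
  This is the algebraic form of dominance of f.\<close>

lemma pullback_eq_0_iff:
  assumes "keller_map F"
  shows "pullback F p = 0 \<longleftrightarrow> p = 0"
proof
  assume "pullback F p = 0"
  show "p = 0"
  proof (rule ccontr)
    assume "p \<noteq> 0"
    have "\<exists>c. c \<noteq> 0 \<and> cpoly_const c \<in> {p. pullback F p = 0}"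
    proof (rule nonzero_const_of_pdiff_closed)
      show "pdiff i q \<in> {p. pullback F p = 0}" if "q \<in> {p. pullback F p = 0}" for q i
        using that target_deriv_pullback[OF assms, of i q] by (simp add: target_deriv_simps)
    qed (use \<open>pullback F p = 0\<close> \<open>p \<noteq> 0\<close> in auto)
    then show False by auto
  qed
qed (simp add: ring_homD[OF ring_hom_pullback])

section \<open>The discrete valuation ring of a hypersurface\<close>

lemma zariski_closed_zeros: "zariski_closed {x. peval p x = 0}"
  unfolding zariski_closed_def by (rule exI[of _ "{p}"]) auto

lemma zariski_irreducible_prime:
  assumes "zariski_irreducible V" "p * q \<in> vanishing_ideal V"
  shows "p \<in> vanishing_ideal V \<or> q \<in> vanishing_ideal V"
proof -
  have "V \<subseteq> {x. peval p x = 0} \<union> {x. peval q x = 0}"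
    using assms(2) by (auto simp: vanishing_ideal_def peval_hom)
  then have "V \<subseteq> {x. peval p x = 0} \<or> V \<subseteq> {x. peval q x = 0}"
    using assms(1) zariski_closed_zeros unfolding zariski_irreducible_def by blast
  then show ?thesis by (auto simp: vanishing_ideal_def)
qed

lemma vanishing_ideal_ideal:
  "0 \<in> vanishing_ideal V" "p \<in> vanishing_ideal V \<Longrightarrow> q \<in> vanishing_ideal V \<Longrightarrow> p + q \<in> vanishing_ideal V"
  "p \<in> vanishing_ideal V \<Longrightarrow> q \<in> vanishing_ideal V \<Longrightarrow> p - q \<in> vanishing_ideal V"
  "p \<in> vanishing_ideal V \<Longrightarrow> p * q \<in> vanishing_ideal V" "p \<in> vanishing_ideal V \<Longrightarrow> q * p \<in> vanishing_ideal V"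
  by (auto simp: vanishing_ideal_def peval_hom)

locale keller_component =
  fixes F :: "'n::{finite,linorder} \<Rightarrow> 'n cpoly" and V :: "('n cspace) set"
  assumes keller: "keller_map F" and V_closed: "zariski_closed V"
    and V_irreducible: "zariski_irreducible V" and V_proper: "V \<noteq> UNIV"
begin

abbreviation "I \<equiv> vanishing_ideal V"
abbreviation "\<phi> \<equiv> pullback F"
abbreviation "R \<equiv> ring_of_component F V"
abbreviation "D \<equiv> target_deriv F"

lemmas pullback_hom = ring_homD[OF ring_hom_pullback[of F]]

lemma pullback_inj [simp]: "\<phi> p = \<phi> q \<longleftrightarrow> p = q"
  using pullback_eq_0_iff[OF keller, of "p - q"] by (simp add: pullback_hom)

lemma pullback_nonzero [simp]: "\<phi> p = 0 \<longleftrightarrow> p = 0"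
  by (rule pullback_eq_0_iff[OF keller])

lemma one_notin_I: "1 \<notin> I"
  using V_irreducible by (auto simp: zariski_irreducible_def vanishing_ideal_def peval_hom)

lemma I_mult_iff: "p * q \<in> I \<longleftrightarrow> p \<in> I \<or> q \<in> I"
  by (meson zariski_irreducible_prime[OF V_irreducible] vanishing_ideal_ideal(4,5))

lemma I_prod_iff: "finite S \<Longrightarrow> prod f S \<in> I \<longleftrightarrow> (\<exists>x\<in>S. f x \<in> I)"
  by (induction S rule: finite_induct) (auto simp: one_notin_I I_mult_iff)

lemma const_in_I_iff: "cpoly_const c \<in> I \<longleftrightarrow> c = 0"
  using V_irreducible by (auto simp: zariski_irreducible_def vanishing_ideal_def)

text \<open>Otherwise \<open>I\<close> would be closed under differentiation and contain a nonzero
  constant, although V is nonempty.\<close>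

lemma ex_pdiff_notin_I: "\<exists>p\<in>I. \<exists>j. pdiff j p \<notin> I"
proof (rule ccontr)
  assume "\<not> ?thesis"
  then have closed: "\<And>p i. p \<in> I \<Longrightarrow> pdiff i p \<in> I" by blast
  obtain P where P: "V = {x. \<forall>p\<in>P. peval p x = 0}" using V_closed by (auto simp: zariski_closed_def)
  with V_proper obtain p where "p \<in> P" "p \<noteq> 0" by (auto simp: peval_hom) (metis peval_hom(4))
  moreover from this P have "p \<in> I" by (auto simp: vanishing_ideal_def)
  ultimately obtain c where "c \<noteq> 0" "cpoly_const c \<in> I"
    using nonzero_const_of_pdiff_closed[OF closed] by blast
  then show False by (simp add: const_in_I_iff)
qed

lemma R_I: "q \<notin> I \<Longrightarrow> \<phi> p / \<phi> q \<in> R"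
  by (auto simp: ring_of_component_def)

lemma R_E:
  assumes "h \<in> R"
  obtains p q where "h = \<phi> p / \<phi> q" "q \<notin> I" "q \<noteq> 0"
proof -
  obtain p q where "h = \<phi> p / \<phi> q" "q \<notin> I" using assms by (auto simp: ring_of_component_def)
  moreover from this have "q \<noteq> 0" using vanishing_ideal_ideal(1) by metis
  ultimately show thesis by (rule that)
qed

lemma pullback_in_R: "\<phi> p \<in> R"
  using R_I[OF one_notin_I, of p] by (simp add: pullback_hom)

lemma notin_I_nonzero: "q \<notin> I \<Longrightarrow> q \<noteq> 0"
  using vanishing_ideal_ideal(1) by metis

lemma complex_subalgebra_R: "complex_subalgebra R"
  unfolding complex_subalgebra_def
proof (intro conjI ballI subsetI)
  fix h :: "'n ratfun" assume "h \<in> range cst"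
  then obtain c where "h = cst c" by blast
  then show "h \<in> R" using pullback_in_R[of "cpoly_const c"] by simp
next
  fix a b assume "a \<in> R" "b \<in> R"
  then obtain p q p' q' where *: "a = \<phi> p / \<phi> q" "q \<notin> I" "q \<noteq> 0" "b = \<phi> p' / \<phi> q'" "q' \<notin> I" "q' \<noteq> 0"
    by (elim R_E)
  have "a - b = \<phi> (p * q' - p' * q) / \<phi> (q * q')" "a * b = \<phi> (p * p') / \<phi> (q * q')"
    using *(3,6) unfolding *(1,4) by (simp_all add: pullback_hom diff_frac_eq)
  moreover have "q * q' \<notin> I" using * by (simp add: I_mult_iff)
  ultimately show "a - b \<in> R" "a * b \<in> R" using R_I by simp_all
qed

lemma nonunits_R_iff:
  assumes q: "q \<notin> I"
  shows "\<phi> p / \<phi> q \<in> nonunits R \<longleftrightarrow> p \<in> I"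
proof
  assume *: "\<phi> p / \<phi> q \<in> nonunits R"
  show "p \<in> I"
  proof (rule ccontr)
    assume p: "p \<notin> I"
    then have "\<phi> q / \<phi> p \<in> R" by (rule R_I)
    with * p q show False by (auto simp: nonunits_def dest: notin_I_nonzero)
  qed
next
  assume p: "p \<in> I"
  show "\<phi> p / \<phi> q \<in> nonunits R"
  proof (cases "p = 0")
    case True
    then show ?thesis using R_I[OF q, of 0] by (simp add: nonunits_def pullback_hom)
  next
    case False
    have "\<phi> q / \<phi> p \<notin> R"
    proof
      assume "\<phi> q / \<phi> p \<in> R"
      then obtain c d where cd: "\<phi> q / \<phi> p = \<phi> c / \<phi> d" "d \<notin> I" "d \<noteq> 0" by (rule R_E)
      then have "\<phi> (q * d) = \<phi> (p * c)" using False by (simp add: pullback_hom field_simps)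
      then have "q * d = p * c" by simp
      then have "q * d \<in> I" using p by (simp add: I_mult_iff)
      with q cd show False by (simp add: I_mult_iff)
    qed
    then show ?thesis using R_I[OF q, of p] by (simp add: nonunits_def)
  qed
qed

lemma pullback_nonunits_R_iff: "\<phi> p \<in> nonunits R \<longleftrightarrow> p \<in> I"
  using nonunits_R_iff[OF one_notin_I, of p] by (simp add: pullback_hom)

lemma D_in_R: "h \<in> R \<Longrightarrow> D j h \<in> R"
proof -
  assume "h \<in> R"
  then obtain p q where *: "h = \<phi> p / \<phi> q" "q \<notin> I" "q \<noteq> 0" by (rule R_E)
  have "D j (h * \<phi> q) = D j (\<phi> p)" using * by simp
  then have "D j h * \<phi> q + h * \<phi> (pdiff j q) = \<phi> (pdiff j p)"
    by (simp add: target_deriv_simps target_deriv_pullback[OF keller])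
  then have "D j h * \<phi> q = \<phi> (pdiff j p) - h * \<phi> (pdiff j q)" by (simp add: eq_diff_eq)
  then have "D j h = (\<phi> (pdiff j p) - h * \<phi> (pdiff j q)) * (\<phi> 1 / \<phi> q)"
    using *(3) by (simp add: field_simps pullback_hom)
  then show "D j h \<in> R"
    using \<open>h \<in> R\<close> pullback_in_R R_I[OF *(2)] complex_subalgebraD(4,5)[OF complex_subalgebra_R] by metis
qed

text \<open>A denominator that does not vanish at one point of V lies outside \<open>I\<close>. So
  the numerator \<open>p0\<close> of a local equation at a single point generates the ideal of V in
  the localization at the generic point of V. Some derivative of \<open>p0\<close> is not in
  \<open>I\<close>, which says that V is cut out with multiplicity one.\<close>

lemma local_equation_generator:
  assumes "local_equation V v \<psi>" "v \<in> V"
  shows "\<exists>p0\<in>I. (\<exists>j. pdiff j p0 \<notin> I) \<and> (\<forall>p\<in>I. \<exists>a b. b \<notin> I \<and> p * b = p0 * a)"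
proof -
  have le: "{rat_of_poly p / rat_of_poly q | p q. p \<in> I \<and> peval q v \<noteq> 0} = {\<psi> * s | s. s \<in> ring_at v}"
    using assms(1) by (simp add: local_equation_def)
  have "1 \<in> ring_at v"
    unfolding ring_at_def by (rule CollectI, rule exI[of _ 1], rule exI[of _ 1]) (simp add: peval_hom rat_of_poly_hom)
  then have "\<psi> \<in> {\<psi> * s | s. s \<in> ring_at v}" by force
  then obtain p0 q0 where \<psi>: "\<psi> = rat_of_poly p0 / rat_of_poly q0" "p0 \<in> I" "peval q0 v \<noteq> 0"
    unfolding le[symmetric] by blast
  have nz: "q \<notin> I \<and> q \<noteq> 0" if "peval q v \<noteq> 0" for q
    using that assms(2) by (auto simp: vanishing_ideal_def peval_hom)
  have gen: "\<exists>a b. b \<notin> I \<and> p * b = p0 * a" if "p \<in> I" for p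
  proof -
    have "rat_of_poly p \<in> {rat_of_poly p / rat_of_poly q | p q. p \<in> I \<and> peval q v \<noteq> 0}"
      using that by (intro CollectI exI[of _ p] exI[of _ 1]) (simp add: peval_hom rat_of_poly_hom)
    then obtain a b where ab: "rat_of_poly p = \<psi> * (rat_of_poly a / rat_of_poly b)" "peval b v \<noteq> 0"
      unfolding le ring_at_def by blast
    have "rat_of_poly (p * (q0 * b)) = rat_of_poly (p0 * a)"
      using ab nz[OF ab(2)] nz[OF \<psi>(3)] by (simp add: \<psi>(1) rat_of_poly_hom)
    then have "p * (q0 * b) = p0 * a" by simp
    moreover have "q0 * b \<notin> I" using nz ab \<psi> by (simp add: I_mult_iff)
    ultimately show ?thesis by blast
  qed
  obtain p1 j where p1: "p1 \<in> I" "pdiff j p1 \<notin> I" using ex_pdiff_notin_I by blast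
  obtain a b where ab: "b \<notin> I" "p1 * b = p0 * a" using gen[OF p1(1)] by blast
  \<comment> \<open>Modulo \<open>I\<close> the product rule leaves only the terms in which
    \<open>p1\<close> and \<open>p0\<close> are differentiated. The left one is not in
    \<open>I\<close>, so neither is the derivative of \<open>p0\<close>.\<close>
  have "pdiff j (p1 * b) = pdiff j (p0 * a)" using ab by simp
  then have "pdiff j p1 * b = pdiff j p0 * a + (p0 * pdiff j a - p1 * pdiff j b)"
    by (simp add: pdiff_mult algebra_simps)
  moreover have "p0 * pdiff j a - p1 * pdiff j b \<in> I" using \<psi>(2) p1(1) vanishing_ideal_ideal by metis
  ultimately have "pdiff j p0 \<notin> I"
    using ab(1) p1(2) vanishing_ideal_ideal(2,4) by (metis I_mult_iff)
  with gen \<psi>(2) show ?thesis by blast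
qed

lemma uniformizer_R:
  assumes "p0 \<in> I" "p0 \<noteq> 0" "\<forall>p\<in>I. \<exists>a b. b \<notin> I \<and> p * b = p0 * a"
  shows "uniformizer R (\<phi> p0)"
  unfolding uniformizer_def
proof (intro conjI set_eqI iffI)
  show "\<phi> p0 \<noteq> 0" using assms by simp
next
  fix h assume h: "h \<in> nonunits R"
  then obtain p q where *: "h = \<phi> p / \<phi> q" "q \<notin> I" "q \<noteq> 0" by (auto simp: nonunits_def elim: R_E)
  then have "p \<in> I" using h nonunits_R_iff by simp
  then obtain a b where ab: "b \<notin> I" "p * b = p0 * a" using assms(3) by blast
  have "\<phi> p * \<phi> b = \<phi> p0 * \<phi> a" using ab by (simp add: pullback_hom(3)[symmetric])
  then have "\<phi> p = \<phi> p0 * \<phi> a / \<phi> b" using notin_I_nonzero[OF ab(1)] by (simp add: field_simps)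
  then have "h = \<phi> p0 * (\<phi> a / \<phi> (b * q))"
    using * by (simp add: pullback_hom)
  moreover have "b * q \<notin> I" using ab * by (simp add: I_mult_iff)
  ultimately show "h \<in> {\<phi> p0 * s |s. s \<in> R}" using R_I by blast
next
  fix h assume "h \<in> {\<phi> p0 * s |s. s \<in> R}"
  then obtain s where s: "h = \<phi> p0 * s" "s \<in> R" by blast
  obtain a q where *: "s = \<phi> a / \<phi> q" "q \<notin> I" using s(2) by (rule R_E)
  have "h = \<phi> (p0 * a) / \<phi> q" using s * by (simp add: pullback_hom)
  then show "h \<in> nonunits R" using * assms nonunits_R_iff[OF *(2)] by (simp add: I_mult_iff)
qed

end

section \<open>Local subrings and discrete valuation rings\<close>

lemma unit_iff: "h \<in> A - nonunits A \<longleftrightarrow> h \<in> A \<and> h \<noteq> 0 \<and> inverse h \<in> A"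
  by (auto simp: nonunits_def)

locale local_subalgebra =
  fixes A :: "'n::{finite,linorder} ratfun set"
  assumes subalgebra: "complex_subalgebra A"
    and nonunits_add: "a \<in> nonunits A \<Longrightarrow> b \<in> nonunits A \<Longrightarrow> a + b \<in> nonunits A"
begin

lemmas closed = complex_subalgebraD[OF subalgebra]

lemma nonunits_closed:
  "0 \<in> nonunits A" "1 \<notin> nonunits A" "a \<in> A \<Longrightarrow> b \<in> nonunits A \<Longrightarrow> a * b \<in> nonunits A"
  "a \<in> A \<Longrightarrow> b \<in> nonunits A \<Longrightarrow> b * a \<in> nonunits A"
  "b \<in> nonunits A \<Longrightarrow> - b \<in> nonunits A" "b \<in> nonunits A \<Longrightarrow> c \<in> nonunits A \<Longrightarrow> b - c \<in> nonunits A"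
  "(\<And>x. x \<in> S \<Longrightarrow> f x \<in> nonunits A) \<Longrightarrow> sum f S \<in> nonunits A" "b \<in> nonunits A \<Longrightarrow> b \<in> A"
proof -
  show 0: "0 \<in> nonunits A" "1 \<notin> nonunits A" using closed by (auto simp: nonunits_def)
  show 1: "a * b \<in> nonunits A" if "a \<in> A" "b \<in> nonunits A" for a b
  proof (rule ccontr)
    assume "a * b \<notin> nonunits A"
    then have *: "a * b \<noteq> 0" "inverse (a * b) \<in> A" using that closed by (auto simp: nonunits_def)
    have "inverse b = a * inverse (a * b)" using *(1) by (simp add: field_simps)
    then have "inverse b \<in> A" using closed(5)[OF that(1) *(2)] by metis
    with that * show False by (auto simp: nonunits_def)
  qed
  then show "a \<in> A \<Longrightarrow> b \<in> nonunits A \<Longrightarrow> b * a \<in> nonunits A" by (simp add: mult.commute)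
  show 2: "- b \<in> nonunits A" if "b \<in> nonunits A" for b
    using 1[of "-1" b] that closed by simp
  show "b \<in> nonunits A \<Longrightarrow> c \<in> nonunits A \<Longrightarrow> b - c \<in> nonunits A"
    using nonunits_add[of b "- c"] 2 by simp
  show "(\<And>x. x \<in> S \<Longrightarrow> f x \<in> nonunits A) \<Longrightarrow> sum f S \<in> nonunits A"
    by (induction S rule: infinite_finite_induct) (auto simp: 0 nonunits_add)
  show "b \<in> nonunits A \<Longrightarrow> b \<in> A" by (auto simp: nonunits_def)
qed

lemma unit_mult: "a \<in> A - nonunits A \<Longrightarrow> b \<in> A - nonunits A \<Longrightarrow> a * b \<in> A - nonunits A"
  unfolding unit_iff by (auto simp: closed)

lemma unit_inverse: "a \<in> A - nonunits A \<Longrightarrow> inverse a \<in> A - nonunits A"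
  unfolding unit_iff by auto

lemma unit_power: "a \<in> A - nonunits A \<Longrightarrow> a ^ n \<in> A - nonunits A"
  unfolding unit_iff by (metis closed(8) power_inverse power_not_zero)

lemma unit_add_nonunit: "a \<in> A - nonunits A \<Longrightarrow> b \<in> nonunits A \<Longrightarrow> a + b \<in> A - nonunits A"
  using nonunits_closed(6)[of "a + b" b] nonunits_closed(8)[of b] closed(7) by auto

lemma cst_unit: "c \<noteq> 0 \<Longrightarrow> cst c \<in> A - nonunits A"
  unfolding unit_iff by (auto simp: closed cst_inverse[symmetric])

lemma cst_nonunit_iff: "cst c \<in> nonunits A \<longleftrightarrow> c = 0"
  using cst_unit[of c] nonunits_closed(1) by (auto simp: cst_hom)

lemma of_nat_unit: "n \<noteq> 0 \<Longrightarrow> of_nat n \<in> A - nonunits A"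
  using cst_unit[of "of_nat n"] by (simp add: cst_hom)

lemma prime_nonunits: "prime_ideal_of A (nonunits A)"
  unfolding prime_ideal_of_def
proof (intro conjI ballI impI)
  show "a \<in> nonunits A \<or> b \<in> nonunits A" if "a \<in> A" "b \<in> A" "a * b \<in> nonunits A" for a b
    using unit_mult[of a b] that by blast
qed (use nonunits_closed nonunits_add in auto)

lemma nonunits_mult_iff:
  "a \<in> A \<Longrightarrow> b \<in> A \<Longrightarrow> a * b \<in> nonunits A \<longleftrightarrow> a \<in> nonunits A \<or> b \<in> nonunits A"
  using nonunits_closed(3,4) unit_mult by blast

end

lemma localization_props:
  fixes A :: "'n::{finite,linorder} ratfun set"
  assumes A: "complex_subalgebra A" and P: "prime_ideal_of A P"
  shows "local_subalgebra (localization A P)" "A \<subseteq> localization A P"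
    "nonunits (localization A P) = {a / s | a s. a \<in> P \<and> s \<in> A - P}"
    "nonunits (localization A P) \<inter> A = P"
proof -
  let ?L = "localization A P"
  note cl = complex_subalgebraD[OF A]
  have one: "1 \<in> A - P" using P cl by (auto simp: prime_ideal_of_def)
  have mult: "s * t \<in> A - P" if "s \<in> A - P" "t \<in> A - P" for s t
    using that P cl(5) unfolding prime_ideal_of_def by blast
  have nz: "s \<noteq> 0" if "s \<in> A - P" for s using that P by (auto simp: prime_ideal_of_def)
  have LI: "a / s \<in> ?L" if "a \<in> A" "s \<in> A - P" for a s using that by (auto simp: localization_def)
  show sub: "A \<subseteq> ?L" using LI[OF _ one] by auto
  have subalg: "complex_subalgebra ?L"
    unfolding complex_subalgebra_def
  proof (intro conjI ballI)
    show "range cst \<subseteq> ?L" using sub cl(1) by blast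
    fix x y assume "x \<in> ?L" "y \<in> ?L"
    then obtain a s b t where *: "x = a / s" "a \<in> A" "s \<in> A - P" "y = b / t" "b \<in> A" "t \<in> A - P"
      unfolding localization_def by blast
    have "x - y = (a * t - b * s) / (s * t)" "x * y = (a * b) / (s * t)"
      using nz[OF *(3)] nz[OF *(6)] unfolding *(1,4) by (simp_all add: diff_frac_eq)
    moreover have "a * t - b * s \<in> A" "a * b \<in> A" using * cl by auto
    ultimately show "x - y \<in> ?L" "x * y \<in> ?L" using LI mult * by metis+
  qed
  show nu: "nonunits ?L = {a / s | a s. a \<in> P \<and> s \<in> A - P}"
  proof (intro set_eqI iffI)
    fix h assume h: "h \<in> nonunits ?L"
    then obtain a s where *: "h = a / s" "a \<in> A" "s \<in> A - P" unfolding nonunits_def localization_def by blast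
    have "a \<in> P"
    proof (rule ccontr)
      assume "a \<notin> P"
      then have "s / a \<in> ?L" using * LI by blast
      moreover have "h \<noteq> 0" using nz[of a] nz[of s] * \<open>a \<notin> P\<close> by auto
      ultimately show False using h * by (simp add: nonunits_def)
    qed
    then show "h \<in> {a / s | a s. a \<in> P \<and> s \<in> A - P}" using * by blast
  next
    fix h assume "h \<in> {a / s | a s. a \<in> P \<and> s \<in> A - P}"
    then obtain a s where *: "h = a / s" "a \<in> P" "s \<in> A - P" by blast
    have aA: "a \<in> A" using * P by (auto simp: prime_ideal_of_def)
    have "inverse h \<notin> ?L" if "h \<noteq> 0"
    proof
      assume "inverse h \<in> ?L"
      then obtain b t where b: "inverse h = b / t" "b \<in> A" "t \<in> A - P" unfolding localization_def by blast
      have "a \<noteq> 0" using that * by auto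
      then have "s * t = b * a" using b(1) nz[OF b(3)] nz[OF *(3)] unfolding *(1) by (simp add: field_simps)
      moreover have "b * a \<in> P" using b * P by (auto simp: prime_ideal_of_def)
      ultimately show False using mult[OF *(3) b(3)] by auto
    qed
    then show "h \<in> nonunits ?L" using LI[OF aA *(3)] * by (auto simp: nonunits_def)
  qed
  show "local_subalgebra ?L"
  proof
    fix x y assume "x \<in> nonunits ?L" "y \<in> nonunits ?L"
    then obtain a s b t where *: "x = a / s" "a \<in> P" "s \<in> A - P" "y = b / t" "b \<in> P" "t \<in> A - P"
      unfolding nu by blast
    have "x + y = (t * a + s * b) / (s * t)"
      using nz[OF *(3)] nz[OF *(6)] unfolding *(1,4) by (simp add: add_frac_eq algebra_simps)
    moreover have "t * a \<in> P" "s * b \<in> P" using * P by (simp_all add: prime_ideal_of_def)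
    then have "t * a + s * b \<in> P" using P by (simp add: prime_ideal_of_def)
    ultimately show "x + y \<in> nonunits ?L" using mult * unfolding nu by blast
  qed (rule subalg)
  show "nonunits ?L \<inter> A = P"
  proof (intro set_eqI iffI)
    fix h assume "h \<in> nonunits ?L \<inter> A"
    then obtain a s where *: "h = a / s" "a \<in> P" "s \<in> A - P" "h \<in> A" unfolding nu by blast
    then have "h * s \<in> P" using nz[OF *(3)] by simp
    then show "h \<in> P" using * P unfolding prime_ideal_of_def by blast
  next
    fix h assume h: "h \<in> P"
    then have "h / 1 \<in> nonunits ?L" unfolding nu using one by blast
    then show "h \<in> nonunits ?L \<inter> A" using h P by (auto simp: prime_ideal_of_def)
  qed
qed

lemma variety_model_point:
  fixes X :: "'n::{finite,linorder} ratfun set set"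
  assumes "variety_model X" "S \<in> X"
  shows "local_subalgebra S" "\<exists>a\<in>S. \<exists>b\<in>S. h = a / b"
    "\<exists>G P. finite G \<and> prime_ideal_of (generated_algebra G) P \<and> S = localization (generated_algebra G) P"
proof -
  obtain \<A> where \<A>: "X = (\<Union>A\<in>\<A>. affine_model A)"
    "\<forall>A\<in>\<A>. (\<exists>G. finite G \<and> A = generated_algebra G) \<and> (\<forall>h. \<exists>a\<in>A. \<exists>b\<in>A. h = a / b)"
    using assms(1)[unfolded variety_model_def] by (elim exE conjE) (rule that, assumption+)
  obtain A P where A: "A \<in> \<A>" "prime_ideal_of A P" "S = localization A P"
    using assms(2) unfolding \<A>(1) affine_model_def by blast
  obtain G where G: "finite G" "A = generated_algebra G" using \<A>(2) A(1) by blast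
  have sa: "complex_subalgebra A" using complex_subalgebra_generated_algebra G by blast
  note * = localization_props[OF sa A(2), folded A(3)]
  show "local_subalgebra S" by (rule *)
  show "\<exists>a\<in>S. \<exists>b\<in>S. h = a / b" using \<A>(2) A(1) *(2) by (meson subsetD)
  show "\<exists>G P. finite G \<and> prime_ideal_of (generated_algebra G) P \<and> S = localization (generated_algebra G) P"
    using A G by blast
qed

lemma uniformizers_associated:
  fixes A :: "'n::{finite,linorder} ratfun set"
  assumes A: "complex_subalgebra A" and \<rho>: "uniformizer A \<rho>" and \<sigma>: "uniformizer A \<sigma>"
  shows "\<exists>w\<in>A - nonunits A. \<rho> = \<sigma> * w"
proof -
  note cl = complex_subalgebraD[OF A]
  have \<rho>': "\<rho> \<noteq> 0" "nonunits A = {\<rho> * s | s. s \<in> A}" using \<rho> by (auto simp: uniformizer_def)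
  have \<sigma>': "\<sigma> \<noteq> 0" "nonunits A = {\<sigma> * s | s. s \<in> A}" using \<sigma> by (auto simp: uniformizer_def)
  have "\<rho> * 1 \<in> nonunits A" unfolding \<rho>'(2) using cl(3) by blast
  then obtain w where w: "\<rho> = \<sigma> * w" "w \<in> A" unfolding \<sigma>'(2) by auto
  have "\<sigma> * 1 \<in> nonunits A" unfolding \<sigma>'(2) using cl(3) by blast
  then obtain t where t: "\<sigma> = \<rho> * t" "t \<in> A" unfolding \<rho>'(2) by auto
  have "\<sigma> * (w * t) = \<rho> * t" unfolding w(1) by simp
  then have "w * t = 1" using \<sigma>'(1) t(1) by simp
  then have "inverse w = t" "w \<noteq> 0" by (auto intro: inverse_unique)
  then have "w \<in> A - nonunits A" using w(2) t(2) unfolding unit_iff by simp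
  with w(1) show ?thesis by (rule bexI)
qed

text \<open>The maximal ideal is principal and the dimension is 1. Factorization into a power of
  \<pi> and a unit is derived from these two facts, with \<open>no_infinitely_divisible\<close> in
  the place of Krull's intersection theorem.\<close>

locale dvr = local_subalgebra \<Gamma> for \<Gamma> :: "'n::{finite,linorder} ratfun set" +
  fixes \<pi> :: "'n ratfun"
  assumes unif: "uniformizer \<Gamma> \<pi>" and dim: "krull_dim \<Gamma> = 1"
    and fractions: "\<exists>a\<in>\<Gamma>. \<exists>b\<in>\<Gamma>. h = a / b"
begin

abbreviation "\<mm> \<equiv> nonunits \<Gamma>"

lemma pi_nonzero: "\<pi> \<noteq> 0" and mm_eq: "\<mm> = {\<pi> * s | s. s \<in> \<Gamma>}"
  using unif by (auto simp: uniformizer_def)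

lemma pi_nonunit: "\<pi> \<in> \<mm>"
proof -
  have "\<pi> * 1 \<in> \<mm>" unfolding mm_eq using closed(3) by blast
  then show ?thesis by simp
qed

lemma pi_in: "\<pi> \<in> \<Gamma>" "\<pi> ^ k \<in> \<Gamma>"
  using pi_nonunit nonunits_closed(8) closed(8) by auto

lemma factor_or_divisible:
  assumes "h \<in> \<Gamma>" "\<not> (\<forall>n. \<exists>s\<in>\<Gamma>. h = \<pi> ^ n * s)"
  shows "\<exists>k w. w \<in> \<Gamma> - \<mm> \<and> h = \<pi> ^ k * w"
proof -
  define n where "n = (LEAST n. \<not> (\<exists>s\<in>\<Gamma>. h = \<pi> ^ n * s))"
  have n: "\<not> (\<exists>s\<in>\<Gamma>. h = \<pi> ^ n * s)" unfolding n_def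
    using LeastI_ex[of "\<lambda>n. \<not> (\<exists>s\<in>\<Gamma>. h = \<pi> ^ n * s)"] assms(2) by blast
  then have "n \<noteq> 0" using assms(1) by (intro notI) simp
  then obtain k where k: "n = Suc k" using not0_implies_Suc by blast
  have "\<exists>s\<in>\<Gamma>. h = \<pi> ^ k * s"
    using not_less_Least[of k "\<lambda>n. \<not> (\<exists>s\<in>\<Gamma>. h = \<pi> ^ n * s)"] k unfolding n_def by simp
  then obtain s where s: "s \<in> \<Gamma>" "h = \<pi> ^ k * s" by blast
  have "s \<notin> \<mm>"
  proof
    assume "s \<in> \<mm>"
    then obtain t where "s = \<pi> * t" "t \<in> \<Gamma>" unfolding mm_eq by blast
    then have "h = \<pi> ^ n * t" using s k by simp
    with n \<open>t \<in> \<Gamma>\<close> show False by blast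
  qed
  with s show ?thesis by blast
qed

text \<open>The elements divisible by all powers of \<open>\<pi>\<close> form a prime ideal; were it nonzero, it would lie
  strictly between 0 and the maximal ideal, against dimension 1.\<close>

lemma no_infinitely_divisible:
  assumes h: "h \<in> \<Gamma>" "\<forall>n. \<exists>s\<in>\<Gamma>. h = \<pi> ^ n * s"
  shows "h = 0"
proof (rule ccontr)
  assume "h \<noteq> 0"
  define J where "J = {h \<in> \<Gamma>. \<forall>n. \<exists>s\<in>\<Gamma>. h = \<pi> ^ n * s}"
  have not_J: "\<pi> ^ k * w \<notin> J" if "w \<in> \<Gamma> - \<mm>" for k w
  proof
    assume "\<pi> ^ k * w \<in> J"
    then obtain s where s: "s \<in> \<Gamma>" "\<pi> ^ k * w = \<pi> ^ Suc k * s" unfolding J_def by blast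
    then have "w = \<pi> * s" using pi_nonzero by simp
    then have "w \<in> \<mm>" using s pi_nonunit nonunits_closed(4) by blast
    with that show False by simp
  qed
  have primeJ: "prime_ideal_of \<Gamma> J"
    unfolding prime_ideal_of_def
  proof (intro conjI ballI impI)
    show "J \<subseteq> \<Gamma>" by (auto simp: J_def)
    show "0 \<in> J" unfolding J_def using closed(2) by force
    show "1 \<notin> J" using not_J[of 1 0] closed(3) nonunits_closed(2) by simp
    show "a + b \<in> J" if "a \<in> J" "b \<in> J" for a b
      unfolding J_def
    proof (intro CollectI conjI allI)
      show "a + b \<in> \<Gamma>" using that closed(7) by (auto simp: J_def)
      fix n
      have "\<exists>s\<in>\<Gamma>. a = \<pi> ^ n * s" "\<exists>t\<in>\<Gamma>. b = \<pi> ^ n * t" using that by (simp_all add: J_def)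
      then obtain s t where "s \<in> \<Gamma>" "t \<in> \<Gamma>" "a = \<pi> ^ n * s" "b = \<pi> ^ n * t" by blast
      then show "\<exists>s\<in>\<Gamma>. a + b = \<pi> ^ n * s" using closed(7) by (intro bexI[of _ "s + t"]) (auto simp: distrib_left)
    qed
    show "a * b \<in> J" if "a \<in> \<Gamma>" "b \<in> J" for a b
      unfolding J_def
    proof (intro CollectI conjI allI)
      show "a * b \<in> \<Gamma>" using that closed(5) by (auto simp: J_def)
      fix n
      have "\<exists>t\<in>\<Gamma>. b = \<pi> ^ n * t" using that by (simp add: J_def)
      then obtain t where "t \<in> \<Gamma>" "b = \<pi> ^ n * t" by blast
      then show "\<exists>s\<in>\<Gamma>. a * b = \<pi> ^ n * s" using closed(5) that by (intro bexI[of _ "a * t"]) auto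
    qed
    show "a \<in> J \<or> b \<in> J" if "a \<in> \<Gamma>" "b \<in> \<Gamma>" "a * b \<in> J" for a b
    proof (rule ccontr)
      assume "\<not> (a \<in> J \<or> b \<in> J)"
      then have "\<exists>i v. v \<in> \<Gamma> - \<mm> \<and> a = \<pi> ^ i * v" "\<exists>j w. w \<in> \<Gamma> - \<mm> \<and> b = \<pi> ^ j * w"
        using that factor_or_divisible unfolding J_def mem_Collect_eq by simp_all
      then obtain i v j w where "v \<in> \<Gamma> - \<mm>" "a = \<pi> ^ i * v" "w \<in> \<Gamma> - \<mm>" "b = \<pi> ^ j * w"
        by blast
      then have "a * b = \<pi> ^ (i + j) * (v * w)" "v * w \<in> \<Gamma> - \<mm>"
        using unit_mult by (auto simp: power_add)
      then show False using not_J that(3) by metis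
    qed
  qed
  define P where "P i = (if i = 0 then {0} else if i = 1 then J else \<mm>)" for i :: nat
  have prime0: "prime_ideal_of \<Gamma> {0}" using closed by (auto simp: prime_ideal_of_def)
  have "\<pi> \<notin> J" using not_J[of 1 1] closed(3) nonunits_closed(2) by simp
  moreover have "J \<subseteq> \<mm>"
  proof
    fix x assume "x \<in> J"
    then have "\<exists>s\<in>\<Gamma>. x = \<pi> ^ 1 * s" unfolding J_def by blast
    then show "x \<in> \<mm>" unfolding mm_eq by auto
  qed
  ultimately have "J \<subset> \<mm>" using pi_nonunit by blast
  moreover have "{0} \<subset> J" using \<open>h \<noteq> 0\<close> h primeJ by (auto simp: J_def prime_ideal_of_def)
  ultimately have "(\<forall>i\<le>2. prime_ideal_of \<Gamma> (P i)) \<and> (\<forall>i<2. P i \<subset> P (Suc i))"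
    using prime0 primeJ prime_nonunits by (auto simp: P_def less_2_cases_iff)
  then have "enat 2 \<le> krull_dim \<Gamma>" unfolding krull_dim_def by (intro Sup_upper) blast
  then show False by (simp add: dim one_enat_def)
qed

lemma factorization:
  assumes "h \<in> \<Gamma>" "h \<noteq> 0"
  obtains k w where "w \<in> \<Gamma> - \<mm>" "h = \<pi> ^ k * w"
  using no_infinitely_divisible[OF assms(1)] factor_or_divisible[OF assms(1)] assms(2) by blast

lemma power_pi_nonunit: "s \<in> \<Gamma> \<Longrightarrow> 0 < k \<Longrightarrow> \<pi> ^ k * s \<in> \<mm>"
proof -
  assume *: "s \<in> \<Gamma>" "0 < k"
  then obtain j where "k = Suc j" using gr0_implies_Suc by blast
  then have "\<pi> ^ k * s = \<pi> * (\<pi> ^ j * s)" by simp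
  then show ?thesis using nonunits_closed(4)[OF closed(5)[OF pi_in(2)[of j] *(1)] pi_nonunit] by metis
qed

lemma power_le_if_dvd:
  assumes "w \<in> \<Gamma> - \<mm>" "s \<in> \<Gamma>" "\<pi> ^ k * w = \<pi> ^ N * s"
  shows "N \<le> k"
proof (rule ccontr)
  assume "\<not> N \<le> k"
  then have "\<pi> ^ N = \<pi> ^ k * \<pi> ^ (N - k)" "0 < N - k" by (auto simp: power_add[symmetric])
  then have "w = \<pi> ^ (N - k) * s" using assms(3) pi_nonzero by simp
  then show False using power_pi_nonunit[OF assms(2) \<open>0 < N - k\<close>] assms(1) by simp
qed

lemma order_unique:
  assumes "w \<in> \<Gamma> - \<mm>" "w' \<in> \<Gamma> - \<mm>" "\<pi> ^ k * w = \<pi> ^ k' * w'"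
  shows "k = k'"
  using power_le_if_dvd[OF assms(1) _ assms(3)] power_le_if_dvd[OF assms(2) _ assms(3)[symmetric]] assms
  by force

lemma uniformizer_unique: "uniformizer \<Gamma> \<rho> \<Longrightarrow> \<exists>w\<in>\<Gamma> - \<mm>. \<rho> = \<pi> * w"
  using uniformizers_associated[OF subalgebra _ unif] .

lemma has_order_iff: "has_order \<Gamma> h k \<longleftrightarrow> (\<exists>w\<in>\<Gamma> - \<mm>. h = \<pi> ^ k * w)"
proof
  assume "has_order \<Gamma> h k"
  then obtain \<rho> v where *: "uniformizer \<Gamma> \<rho>" "v \<in> \<Gamma> - \<mm>" "h = \<rho> ^ k * v" unfolding has_order_def by blast
  obtain w where w: "w \<in> \<Gamma> - \<mm>" "\<rho> = \<pi> * w" using uniformizer_unique[OF *(1)] by blast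
  then have "h = \<pi> ^ k * (w ^ k * v)" using * by (simp add: power_mult_distrib)
  moreover have "w ^ k * v \<in> \<Gamma> - \<mm>" using unit_mult[OF unit_power[OF w(1)] *(2)] .
  ultimately show "\<exists>w\<in>\<Gamma> - \<mm>. h = \<pi> ^ k * w" by blast
qed (use unif in \<open>auto simp: has_order_def\<close>)

lemma pole_order:
  "\<exists>N. \<pi> ^ N * h \<in> \<Gamma>"
proof -
  obtain a b where ab: "a \<in> \<Gamma>" "b \<in> \<Gamma>" "h = a / b" using fractions by blast
  show ?thesis
  proof (cases "b = 0")
    case True
    then show ?thesis using ab closed by simp
  next
    case False
    then obtain k w where w: "w \<in> \<Gamma> - \<mm>" "b = \<pi> ^ k * w" using factorization ab by blast
    then have "\<pi> ^ k * h = a * inverse w" using ab False by (simp add: field_simps)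
    moreover have "a * inverse w \<in> \<Gamma>" using ab w closed(5) unfolding unit_iff by blast
    ultimately show ?thesis by metis
  qed
qed

lemma pole_order_mono:
  assumes "\<pi> ^ N * h \<in> \<Gamma>" "N \<le> M"
  shows "\<pi> ^ M * h \<in> \<Gamma>"
proof -
  have "\<pi> ^ M * h = \<pi> ^ (M - N) * (\<pi> ^ N * h)"
    using assms(2) by (simp add: power_add[symmetric] mult.assoc[symmetric])
  then show ?thesis using closed(5)[OF pi_in(2) assms(1)] by metis
qed

lemma pole_order_finite:
  assumes "finite H"
  shows "\<exists>N. \<forall>h\<in>H. \<pi> ^ N * h \<in> \<Gamma>"
proof -
  obtain N where N: "\<And>h. \<pi> ^ N h * h \<in> \<Gamma>" using pole_order by metis
  have "\<pi> ^ Max (N ` H) * h \<in> \<Gamma>" if "h \<in> H" for h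
    using that assms by (intro pole_order_mono[OF N]) auto
  then show ?thesis by blast
qed

lemma mem_or_inverse_mem: "h \<in> \<Gamma> \<or> inverse h \<in> \<Gamma>"
proof (cases "h = 0")
  case False
  obtain N where N: "\<pi> ^ N * h \<in> \<Gamma>" using pole_order by blast
  then obtain k w where w: "w \<in> \<Gamma> - \<mm>" "\<pi> ^ N * h = \<pi> ^ k * w"
    using factorization False pi_nonzero by (metis mult_eq_0_iff power_not_zero)
  show ?thesis
  proof (cases "N \<le> k")
    case True
    then have "\<pi> ^ N * h = \<pi> ^ N * (\<pi> ^ (k - N) * w)"
      using w by (simp add: power_add[symmetric] mult.assoc[symmetric])
    then have "h = \<pi> ^ (k - N) * w" using pi_nonzero by simp
    then show ?thesis using w closed(5) pi_in(2) by blast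
  next
    case False
    then have "\<pi> ^ k * (\<pi> ^ (N - k) * h) = \<pi> ^ k * w"
      using w by (simp add: power_add[symmetric] mult.assoc[symmetric])
    then have e: "\<pi> ^ (N - k) * h = w" using pi_nonzero by simp
    then have "inverse h = \<pi> ^ (N - k) * inverse w" using \<open>h \<noteq> 0\<close> pi_nonzero by (auto simp: field_simps)
    then show ?thesis using w closed(5) pi_in(2) unfolding unit_iff by metis
  qed
qed (use closed in simp)

lemma valuation_ring: "valuation_ring \<Gamma>"
  unfolding valuation_ring_def using subalgebra mem_or_inverse_mem by blast

text \<open>For fixed N the elements h with \<pi>^N D h in \<Gamma> form a subalgebra of \<Gamma>,
  so it is enough to bound the poles on the finitely many generators. Dividing by units of \<Gamma>
  does not increase a pole.\<close>

lemma derivation_bounded: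
  assumes D: "derivation D" "\<And>c. D (cst c) = 0"
    and \<Gamma>: "finite G" "prime_ideal_of (generated_algebra G) P" "\<Gamma> = localization (generated_algebra G) P"
  shows "\<exists>N. \<forall>h\<in>\<Gamma>. \<pi> ^ N * D h \<in> \<Gamma>"
proof -
  note D' = derivationD[OF D(1)]
  let ?A = "generated_algebra G"
  note lp = localization_props[OF complex_subalgebra_generated_algebra \<Gamma>(2), folded \<Gamma>(3)]
  obtain N where N: "\<forall>h\<in>D ` G. \<pi> ^ N * h \<in> \<Gamma>" using pole_order_finite[of "D ` G"] \<Gamma>(1) by blast
  let ?B = "{h \<in> \<Gamma>. \<pi> ^ N * D h \<in> \<Gamma>}"
  have "?A \<subseteq> ?B"
  proof (rule generated_algebra_least)
    show "complex_subalgebra ?B"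
      unfolding complex_subalgebra_def
    proof (intro conjI ballI)
      show "range cst \<subseteq> ?B" using closed by (auto simp: D(2))
      fix a b assume "a \<in> ?B" "b \<in> ?B"
      then have *: "a \<in> \<Gamma>" "b \<in> \<Gamma>" "\<pi> ^ N * D a \<in> \<Gamma>" "\<pi> ^ N * D b \<in> \<Gamma>" by auto
      have "\<pi> ^ N * D (a - b) = \<pi> ^ N * D a - \<pi> ^ N * D b"
        "\<pi> ^ N * D (a * b) = (\<pi> ^ N * D a) * b + a * (\<pi> ^ N * D b)" by (auto simp: D' algebra_simps)
      then show "a - b \<in> ?B" "a * b \<in> ?B" using * closed(4,5,7) by auto
    qed
    show "G \<subseteq> ?B" using N lp(2) generated_algebra_superset[of G] by blast
  qed
  have "\<pi> ^ N * D h \<in> \<Gamma>" if hin: "h \<in> \<Gamma>" for h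
  proof -
    obtain a s where h: "h = a / s" "a \<in> ?A" "s \<in> ?A - P" 
      using hin[unfolded \<Gamma>(3) localization_def] by blast
    have s: "s \<in> \<Gamma> - \<mm>" using h(3) lp(2,4) by blast
    then have s0: "s \<noteq> 0" unfolding unit_iff by blast
    then have "D (h * s) = D a" using h by simp
    then have "D h * s = D a - h * D s" by (simp add: D' eq_diff_eq)
    then have Dh: "D h = (D a - h * D s) * inverse s" using s0 by (simp add: field_simps)
    have "\<pi> ^ N * D h = (\<pi> ^ N * D a - h * (\<pi> ^ N * D s)) * inverse s"
      by (subst Dh) (simp add: algebra_simps)
    moreover have "\<pi> ^ N * D a \<in> \<Gamma>" "\<pi> ^ N * D s \<in> \<Gamma>" using h \<open>?A \<subseteq> ?B\<close> by blast+
    moreover have "inverse s \<in> \<Gamma>" using s unfolding unit_iff by blast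
    ultimately show ?thesis using closed(4,5) hin by metis
  qed
  then show ?thesis by blast
qed

end

text \<open>Gaussian elimination over the residue field of \<open>R\<close>, one column
  \<open>b\<close> at a time: more vectors than columns are dependent modulo the maximal ideal. The
  coefficients have to stay in \<open>R\<close>.\<close>

lemma (in local_subalgebra) linear_dependence_mod_nonunits:
  assumes R: "complex_subalgebra R" "dominates A R"
    and "finite B" "finite S" "card B < card S" "\<And>i b. i \<in> S \<Longrightarrow> b \<in> B \<Longrightarrow> v i b \<in> R"
  shows "\<exists>r. (\<forall>i\<in>S. r i \<in> R) \<and> (\<exists>i\<in>S. r i \<notin> nonunits A) \<and> (\<forall>b\<in>B. (\<Sum>i\<in>S. r i * v i b) \<in> nonunits A)"
  using assms(3-)
proof (induction B arbitrary: S v rule: finite_induct)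
  case empty
  then obtain i where "i \<in> S" by fastforce
  then show ?case using complex_subalgebraD(3)[OF R(1)] nonunits_closed(2) by (intro exI[of _ "\<lambda>_. 1"]) auto
next
  case (insert b B)
  have RA: "R \<subseteq> A" using R(2) by (simp add: dominates_def)
  note cl = complex_subalgebraD[OF R(1)]
  show ?case
  proof (cases "\<forall>i\<in>S. v i b \<in> nonunits A")
    case True
    have "\<exists>r. (\<forall>i\<in>S. r i \<in> R) \<and> (\<exists>i\<in>S. r i \<notin> nonunits A) \<and> (\<forall>b\<in>B. (\<Sum>i\<in>S. r i * v i b) \<in> nonunits A)"
      using insert.prems insert.hyps by (intro insert.IH) auto
    then obtain r where r: "\<forall>i\<in>S. r i \<in> R" "\<exists>i\<in>S. r i \<notin> nonunits A" "\<forall>b\<in>B. (\<Sum>i\<in>S. r i * v i b) \<in> nonunits A"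
      by blast
    have "(\<Sum>i\<in>S. r i * v i b) \<in> nonunits A"
      using True r(1) RA by (intro nonunits_closed(7) nonunits_closed(3)) auto
    with r show ?thesis by blast
  next
    case False
    then obtain i0 where i0: "i0 \<in> S" "v i0 b \<notin> nonunits A" by blast
    have vR: "v i0 b \<in> R" using insert.prems i0 by simp
    \<comment> \<open>Domination turns a pivot that is invertible in \<open>A\<close> into a unit of
      \<open>R\<close>, so the elimination divides inside \<open>R\<close>.\<close>
    then have "v i0 b \<in> R - nonunits R" using i0 R(2) by (auto simp: dominates_def)
    then have inv: "v i0 b \<noteq> 0" "inverse (v i0 b) \<in> R" unfolding unit_iff by auto
    define v' where "v' i x = v i x - (v i b * inverse (v i0 b)) * v i0 x" for i x
    have "\<exists>r. (\<forall>i\<in>S - {i0}. r i \<in> R) \<and> (\<exists>i\<in>S - {i0}. r i \<notin> nonunits A) \<and>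
        (\<forall>b\<in>B. (\<Sum>i\<in>S - {i0}. r i * v' i b) \<in> nonunits A)"
    proof (rule insert.IH)
      show "finite (S - {i0})" "card B < card (S - {i0})"
        using insert.prems insert.hyps i0(1) by auto
      show "v' i x \<in> R" if "i \<in> S - {i0}" "x \<in> B" for i x
        unfolding v'_def using that insert.prems i0 inv by (intro cl(4) cl(5)) auto
    qed
    then obtain r where r: "\<forall>i\<in>S - {i0}. r i \<in> R" "\<exists>i\<in>S - {i0}. r i \<notin> nonunits A"
      "\<forall>b\<in>B. (\<Sum>i\<in>S - {i0}. r i * v' i b) \<in> nonunits A" by blast
    \<comment> \<open>The coefficient of the pivot vector that makes column \<open>b\<close> vanish
      identically.\<close>
    define r0 where "r0 = - (\<Sum>i\<in>S - {i0}. r i * (v i b * inverse (v i0 b)))"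
    define r' where "r' = r(i0 := r0)"
    have "r0 \<in> R" unfolding r0_def using r(1) insert.prems inv
      by (intro cl(6) cl(9) cl(5)) auto
    have sum: "(\<Sum>i\<in>S. r' i * v i x) = (\<Sum>i\<in>S - {i0}. r i * v' i x)" for x
    proof -
      have "(\<Sum>i\<in>S. r' i * v i x) = r0 * v i0 x + (\<Sum>i\<in>S - {i0}. r i * v i x)"
        using i0(1) insert.prems by (simp add: r'_def sum.remove[of S i0])
      also have "\<dots> = (\<Sum>i\<in>S - {i0}. r i * v' i x)"
        by (simp add: r0_def v'_def sum_distrib_right sum_subtractf right_diff_distrib mult.assoc)
      finally show ?thesis .
    qed
    have "(\<Sum>i\<in>S - {i0}. r i * v' i b) = 0"
      using inv by (intro sum.neutral) (simp add: v'_def)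
    then have "\<forall>x\<in>insert b B. (\<Sum>i\<in>S. r' i * v i x) \<in> nonunits A"
      using r(3) nonunits_closed(1) by (simp add: sum)
    moreover have "\<forall>i\<in>S. r' i \<in> R" using r(1) \<open>r0 \<in> R\<close> by (auto simp: r'_def)
    moreover have "\<exists>i\<in>S. r' i \<notin> nonunits A" using r(2) by (auto simp: r'_def)
    ultimately show ?thesis by blast
  qed
qed

text \<open>The powers of \<open>s\<close> up to the exponent \<open>card B\<close> are one more
  than the spanning elements, hence dependent modulo the maximal ideal.\<close>

lemma (in local_subalgebra) residue_algebraic:
  assumes R: "complex_subalgebra R" "dominates A R"
    and B: "finite B" "B \<subseteq> A" "\<forall>h\<in>A. \<exists>r. (\<forall>b\<in>B. r b \<in> R) \<and> h - (\<Sum>b\<in>B. r b * b) \<in> nonunits A"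
    and s: "s \<in> A"
  shows "\<exists>n c. (\<forall>i\<le>n. c i \<in> R) \<and> (\<exists>i\<le>n. c i \<notin> nonunits A) \<and> (\<Sum>i\<le>n. c i * s ^ i) \<in> nonunits A"
proof -
  have "\<forall>i. \<exists>r. (\<forall>b\<in>B. r b \<in> R) \<and> s ^ i - (\<Sum>b\<in>B. r b * b) \<in> nonunits A"
    using B(3) s closed(8) by blast
  from choice[OF this] obtain v where
    v: "\<And>i b. b \<in> B \<Longrightarrow> v i b \<in> R" "\<And>i. s ^ i - (\<Sum>b\<in>B. v i b * b) \<in> nonunits A"
    by blast
  define n where "n = card B"
  obtain c where c: "\<forall>i\<in>{..n}. c i \<in> R" "\<exists>i\<in>{..n}. c i \<notin> nonunits A" "\<forall>b\<in>B. (\<Sum>i\<in>{..n}. c i * v i b) \<in> nonunits A"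
    using linear_dependence_mod_nonunits[OF R B(1), of "{..n}" v] v(1) by (auto simp: n_def)
  have RA: "R \<subseteq> A" using R(2) by (simp add: dominates_def)
  have "(\<Sum>i\<le>n. c i * s ^ i) =
      (\<Sum>i\<le>n. c i * (s ^ i - (\<Sum>b\<in>B. v i b * b))) + (\<Sum>i\<le>n. \<Sum>b\<in>B. c i * v i b * b)"
    by (simp add: right_diff_distrib sum_subtractf sum_distrib_left mult.assoc)
  also have "(\<Sum>i\<le>n. \<Sum>b\<in>B. c i * v i b * b) = (\<Sum>b\<in>B. (\<Sum>i\<le>n. c i * v i b) * b)"
    by (subst sum.swap) (simp add: sum_distrib_right)
  also have "(\<Sum>i\<le>n. c i * (s ^ i - (\<Sum>b\<in>B. v i b * b))) + (\<Sum>b\<in>B. (\<Sum>i\<le>n. c i * v i b) * b) \<in> nonunits A"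
  proof (rule nonunits_add)
    show "(\<Sum>i\<le>n. c i * (s ^ i - (\<Sum>b\<in>B. v i b * b))) \<in> nonunits A"
      using c(1) v(2) RA by (intro nonunits_closed(7) nonunits_closed(3)) auto
    show "(\<Sum>b\<in>B. (\<Sum>i\<le>n. c i * v i b) * b) \<in> nonunits A"
      using c(3) B(2) by (intro nonunits_closed(7)[of B] nonunits_closed(4)) auto
  qed
  finally show ?thesis using c by auto
qed

section \<open>Poles of derivations along a discrete valuation ring\<close>

context dvr
begin

text \<open>In characteristic 0 the residue extension is separable, so a derivation of the residue field
  that vanishes on the image of \<open>R\<close> vanishes.\<close>

lemma derivation_residue_zero:
  assumes D: "derivation D" "\<forall>h\<in>\<Gamma>. D h \<in> \<Gamma>" "\<forall>h\<in>R. D h \<in> \<mm>" "D \<pi> \<in> \<mm>" and R: "complex_subalgebra R" "R \<subseteq> \<Gamma>"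
    and alg: "\<exists>n c. (\<forall>i\<le>n. c i \<in> R) \<and> (\<exists>i\<le>n. c i \<notin> \<mm>) \<and> (\<Sum>i\<le>n. c i * s ^ i) \<in> \<mm>"
    and s: "s \<in> \<Gamma>"
  shows "D s \<in> \<mm>"
proof -
  note D' = derivationD[OF D(1)]
  \<comment> \<open>\<open>Q n\<close>: modulo the maximal ideal, \<open>s\<close> satisfies an
    equation of degree exactly \<open>n\<close> over \<open>R\<close> with invertible leading
    coefficient. The least such \<open>n\<close> acts as the degree of a minimal polynomial.\<close>
  define Q where "Q n \<longleftrightarrow> (\<exists>c. (\<forall>i\<le>n. c i \<in> R) \<and> c n \<notin> \<mm> \<and> (\<Sum>i\<le>n. c i * s ^ i) \<in> \<mm>)" for n
  have D\<mm>: "D h \<in> \<mm>" if h: "h \<in> \<mm>" for h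
  proof -
    obtain t where t: "h = \<pi> * t" "t \<in> \<Gamma>" using h unfolding mm_eq by blast
    have "D h = D \<pi> * t + \<pi> * D t" by (simp add: t D')
    then show ?thesis using D t pi_nonunit nonunits_add nonunits_closed(4) by metis
  qed
  have lead: "\<exists>j\<le>n. c j \<notin> \<mm> \<and> (\<Sum>i\<le>j. c i * s ^ i) \<in> \<mm>"
    if c: "\<forall>i\<le>n. c i \<in> \<Gamma>" "\<exists>i\<le>n. c i \<notin> \<mm>" "(\<Sum>i\<le>n. c i * s ^ i) \<in> \<mm>" for n and c
  proof -
    have fin: "finite {i. i \<le> n \<and> c i \<notin> \<mm>}" by simp
    define j where "j = Max {i. i \<le> n \<and> c i \<notin> \<mm>}"
    have j: "j \<le> n" "c j \<notin> \<mm>" using Max_in[OF fin] c(2) unfolding j_def by auto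
    have j': "c i \<in> \<mm>" if "j < i" "i \<le> n" for i
    proof (rule ccontr)
      assume "c i \<notin> \<mm>"
      then have "i \<in> {i. i \<le> n \<and> c i \<notin> \<mm>}" using that by simp
      then have "i \<le> j" unfolding j_def by (rule Max_ge[OF fin])
      with that show False by simp
    qed
    have split: "{..n} = {..j} \<union> {j<..n}" using j(1) by auto
    have "(\<Sum>i\<le>n. c i * s ^ i) = (\<Sum>i\<le>j. c i * s ^ i) + (\<Sum>i\<in>{j<..n}. c i * s ^ i)"
      unfolding split by (rule sum.union_disjoint) auto
    moreover have "(\<Sum>i\<in>{j<..n}. c i * s ^ i) \<in> \<mm>"
      using j' s closed(8) by (intro nonunits_closed(7) nonunits_closed(4)) auto
    ultimately have "(\<Sum>i\<le>j. c i * s ^ i) \<in> \<mm>" using c(3) nonunits_closed(6) by fastforce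
    with j show ?thesis by blast
  qed
  have "\<exists>n. Q n"
  proof -
    obtain n c where c: "\<forall>i\<le>n. c i \<in> R" "\<exists>i\<le>n. c i \<notin> \<mm>" "(\<Sum>i\<le>n. c i * s ^ i) \<in> \<mm>" using alg by blast
    have "\<forall>i\<le>n. c i \<in> \<Gamma>" using c(1) R(2) by blast
    from lead[OF this c(2,3)] obtain j where "j \<le> n" "c j \<notin> \<mm>" "(\<Sum>i\<le>j. c i * s ^ i) \<in> \<mm>" by blast
    then have "Q j" unfolding Q_def using c(1) by (intro exI[of _ c]) auto
    then show ?thesis by blast
  qed
  define n where "n = (LEAST n. Q n)"
  have "Q n" unfolding n_def using \<open>\<exists>n. Q n\<close> by (rule LeastI_ex)
  then obtain c where c: "\<forall>i\<le>n. c i \<in> R" "c n \<notin> \<mm>" "(\<Sum>i\<le>n. c i * s ^ i) \<in> \<mm>" unfolding Q_def by blast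
  have "n \<noteq> 0"
  proof
    assume "n = 0"
    with c show False by simp
  qed
  then obtain k where k: "n = Suc k" using not0_implies_Suc by blast
  \<comment> \<open>The formal derivative of the minimal equation, evaluated at \<open>s\<close>. It
    is a unit: otherwise it would be an equation of degree \<open>k\<close>, its leading coefficient
    being a unit in characteristic 0. Applying \<open>D\<close> to the minimal equation then leaves
    \<open>E * D s\<close> in the maximal ideal.\<close>
  define E where "E = (\<Sum>i\<le>k. (of_nat (Suc i) * c (Suc i)) * s ^ i)"
  have cG: "c i \<in> \<Gamma>" if "i \<le> n" for i using c(1) R(2) that by blast
  have "E \<in> \<Gamma>" unfolding E_def using cG closed s k by (intro closed(9) closed(5)) auto
  have "E \<notin> \<mm>"
  proof
    assume E: "E \<in> \<mm>"
    have top: "of_nat (Suc k) * c (Suc k) \<notin> \<mm>"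
      using c(2) cG[of n] k nonunits_mult_iff of_nat_unit[of "Suc k"] by blast
    have "Q k"
      unfolding Q_def
      using top E c(1) k complex_subalgebraD(5,11)[OF R(1)] unfolding E_def
      by (intro exI[of _ "\<lambda>i. of_nat (Suc i) * c (Suc i)"]) (auto simp del: of_nat_Suc)
    then show False using not_less_Least[of k Q] k unfolding n_def by simp
  qed
  have "(\<Sum>i\<le>n. c i * (of_nat i * s ^ (i - 1) * D s)) = E * D s"
    unfolding k E_def by (subst sum.atMost_Suc_shift) (simp add: sum_distrib_left mult_ac del: of_nat_Suc)
  then have "D (\<Sum>i\<le>n. c i * s ^ i) = (\<Sum>i\<le>n. D (c i) * s ^ i) + E * D s"
    by (simp add: D' sum.distrib)
  then have "E * D s = D (\<Sum>i\<le>n. c i * s ^ i) - (\<Sum>i\<le>n. D (c i) * s ^ i)" by simp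
  moreover have "(\<Sum>i\<le>n. D (c i) * s ^ i) \<in> \<mm>"
    using D(3) c(1) s closed(8) by (intro nonunits_closed(7) nonunits_closed(4)) auto
  ultimately have "E * D s \<in> \<mm>" using D\<mm>[OF c(3)] nonunits_closed(6) by simp
  then show ?thesis using nonunits_mult_iff \<open>E \<in> \<Gamma>\<close> \<open>E \<notin> \<mm>\<close> D(2) s by blast
qed

text \<open>If \<open>D\<close> had a pole of order \<open>N \<ge> k\<close> along \<open>\<Gamma>\<close>, then \<open>\<pi>\<^sup>N D\<close> would preserve \<open>\<Gamma>\<close> and kill the
  residue field, so it would not map \<open>\<pi>\<close> into the maximal ideal; but then \<open>\<pi>\<^sup>N D p\<close> has order exactly
  \<open>k - 1\<close>.\<close>

lemma derivation_pole_order: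
  assumes D: "derivation D" "\<exists>N. \<forall>h\<in>\<Gamma>. \<pi> ^ N * D h \<in> \<Gamma>" "\<forall>h\<in>R. D h \<in> R"
    and R: "complex_subalgebra R" "dominates \<Gamma> R"
    and alg: "\<forall>s\<in>\<Gamma>. \<exists>n c. (\<forall>i\<le>n. c i \<in> R) \<and> (\<exists>i\<le>n. c i \<notin> \<mm>) \<and> (\<Sum>i\<le>n. c i * s ^ i) \<in> \<mm>"
    and p: "p \<in> R" "p = \<pi> ^ k * w" "w \<in> \<Gamma> - \<mm>" "1 \<le> k"
    and h: "h \<in> \<Gamma>"
  shows "\<pi> ^ (k - 1) * D h \<in> \<Gamma>"
proof -
  have R\<Gamma>: "R \<subseteq> \<Gamma>" using R(2) by (simp add: dominates_def)
  define N where "N = (LEAST N. \<forall>h\<in>\<Gamma>. \<pi> ^ N * D h \<in> \<Gamma>)"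
  have N: "\<forall>h\<in>\<Gamma>. \<pi> ^ N * D h \<in> \<Gamma>" unfolding N_def using D(2) by (rule LeastI_ex)
  have "N \<le> k - 1"
  proof (cases "N = 0")
    case False
    then obtain M where M: "N = Suc M" using not0_implies_Suc by blast
    define D' where "D' h = \<pi> ^ N * D h" for h
    have der: "derivation D'"
      using derivationD(1,2)[OF D(1)] unfolding derivation_def D'_def by (simp add: algebra_simps)
    have "D' \<pi> \<notin> \<mm>"
    proof
      assume *: "D' \<pi> \<in> \<mm>"
      have DR: "\<forall>h\<in>R. D' h \<in> \<mm>" using D(3) R\<Gamma> False by (auto simp: D'_def intro!: power_pi_nonunit)
      have "\<forall>h\<in>\<Gamma>. \<pi> ^ M * D h \<in> \<Gamma>"
      proof
        fix h assume h: "h \<in> \<Gamma>"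
        then have "D' h \<in> \<mm>"
          using derivation_residue_zero[OF der _ DR * R(1) R\<Gamma>, of h] N alg unfolding D'_def by blast
        then obtain t where "\<pi> ^ N * D h = \<pi> * t" "t \<in> \<Gamma>" unfolding D'_def mm_eq by blast
        then show "\<pi> ^ M * D h \<in> \<Gamma>" using M pi_nonzero by simp
      qed
      then show False using not_less_Least[of M "\<lambda>N. \<forall>h\<in>\<Gamma>. \<pi> ^ N * D h \<in> \<Gamma>"] M unfolding N_def by simp
    qed
    then have unit: "D' \<pi> \<in> \<Gamma> - \<mm>" using N pi_in(1) by (simp add: D'_def)
    obtain j where j: "k = Suc j" using p(4) by (cases k) auto
    have "\<pi> ^ N * D p = D' p" by (simp add: D'_def)
    also have "\<dots> = \<pi> ^ j * (of_nat k * w * D' \<pi> + \<pi> * D' w)"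
      unfolding p(2) j by (simp only: derivationD(2,7)[OF der] diff_Suc_1) (simp add: algebra_simps)
    finally have e: "\<pi> ^ j * (of_nat k * w * D' \<pi> + \<pi> * D' w) = \<pi> ^ N * D p" ..
    \<comment> \<open>The first summand is a product of units and the second lies in the maximal
      ideal. So the left side of \<open>e\<close> has order exactly \<open>j = k - 1\<close>; since
      \<open>D p\<close> lies in \<open>R\<close> and has no pole, \<open>N \<le> j\<close>
      follows.\<close>
    have "of_nat k * w * D' \<pi> + \<pi> * D' w \<in> \<Gamma> - \<mm>"
      using unit p of_nat_unit[of k] N pi_nonunit
      by (intro unit_add_nonunit unit_mult nonunits_closed(4)) (auto simp: D'_def)
    then have "N \<le> j" using power_le_if_dvd[OF _ _ e] D(3) p(1) R\<Gamma> by blast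
    then show ?thesis using j by simp
  qed simp
  then show ?thesis using pole_order_mono N h by blast
qed

end

section \<open>Values at closed points\<close>

locale closed_point = local_subalgebra e for e :: "'n::{finite,linorder} ratfun set" +
  assumes residue: "h \<in> e \<Longrightarrow> \<exists>c. h - cst c \<in> nonunits e"
begin

lemma value_at_eqI: "h - cst c \<in> nonunits e \<Longrightarrow> value_at e h = c"
  unfolding value_at_def
proof (rule the_equality)
  fix d assume *: "h - cst c \<in> nonunits e" "h - cst d \<in> nonunits e"
  have "cst (d - c) \<in> nonunits e" using nonunits_closed(6)[OF *] by (simp add: cst_hom)
  then show "d = c" by (simp add: cst_nonunit_iff)
qed

lemma value_at_diff: "h \<in> e \<Longrightarrow> h - cst (value_at e h) \<in> nonunits e"
  using residue value_at_eqI by metis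

lemma value_at_cst [simp]: "value_at e (cst c) = c"
  by (rule value_at_eqI) (simp add: nonunits_closed)

lemma value_at_add: "g \<in> e \<Longrightarrow> h \<in> e \<Longrightarrow> value_at e (g + h) = value_at e g + value_at e h"
  using nonunits_add[OF value_at_diff value_at_diff, of g h]
  by (intro value_at_eqI) (simp add: cst_hom algebra_simps)

lemma value_at_mult:
  assumes "g \<in> e" "h \<in> e"
  shows "value_at e (g * h) = value_at e g * value_at e h"
proof (rule value_at_eqI)
  have "g * h - cst (value_at e g * value_at e h)
     = g * (h - cst (value_at e h)) + cst (value_at e h) * (g - cst (value_at e g))"
    by (simp add: cst_hom algebra_simps)
  also have "\<dots> \<in> nonunits e"
    using assms closed(1) value_at_diff by (intro nonunits_add nonunits_closed(3)) auto
  finally show "g * h - cst (value_at e g * value_at e h) \<in> nonunits e" .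
qed

lemma value_at_minus: "g \<in> e \<Longrightarrow> h \<in> e \<Longrightarrow> value_at e (g - h) = value_at e g - value_at e h"
  using value_at_add[of "g - h" h] closed(4) by simp

lemma value_at_power: "g \<in> e \<Longrightarrow> value_at e (g ^ k) = value_at e g ^ k"
  using value_at_cst[of 1] by (induction k) (auto simp: value_at_mult closed cst_hom)

lemma value_at_sum: "(\<And>x. x \<in> S \<Longrightarrow> g x \<in> e) \<Longrightarrow> value_at e (sum g S) = (\<Sum>x\<in>S. value_at e (g x))"
  using value_at_cst[of 0] by (induction S rule: infinite_finite_induct) (auto simp: value_at_add closed cst_hom)

lemma value_at_of_nat: "value_at e (of_nat k) = of_nat k"
  using value_at_cst[of "of_nat k"] by (simp add: cst_hom)

lemma value_at_eq_0_iff: "h \<in> e \<Longrightarrow> value_at e h = 0 \<longleftrightarrow> h \<in> nonunits e"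
  using value_at_diff[of h] value_at_eqI[of h 0] by (auto simp: cst_hom)

lemma inverse_mem: "h \<in> e \<Longrightarrow> value_at e h \<noteq> 0 \<Longrightarrow> inverse h \<in> e"
  using value_at_eq_0_iff[of h] by (auto simp: nonunits_def)

lemma value_at_inverse: "h \<in> e \<Longrightarrow> inverse h \<in> e \<Longrightarrow> h \<noteq> 0 \<Longrightarrow> value_at e h * value_at e (inverse h) = 1"
  using value_at_mult[of h "inverse h"] value_at_cst[of 1] by (simp add: cst_hom)

lemma poly_subst_value:
  assumes "\<And>i. a i \<in> e"
  shows "poly_subst cst a p \<in> e" "value_at e (poly_subst cst a p) = peval p (\<chi> i. value_at e (a i))"
proof -
  note ps = ring_homD[OF ring_hom_poly_subst[OF ring_hom_cst]]
  have "poly_subst cst a p \<in> e \<and> value_at e (poly_subst cst a p) = peval p (\<chi> i. value_at e (a i))"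
  proof (induction p rule: cpoly_induct)
    case (const c)
    then show ?case by (simp add: poly_subst_const[OF ring_hom_cst] closed)
  next
    case (var i)
    then show ?case by (simp add: poly_subst_var[OF ring_hom_cst] assms)
  qed (simp_all add: ps closed value_at_add value_at_mult peval_hom)
  then show "poly_subst cst a p \<in> e" "value_at e (poly_subst cst a p) = peval p (\<chi> i. value_at e (a i))"
    by auto
qed

lemma pullback_value:
  assumes "\<And>i. rat_of_poly (F i) \<in> e"
  shows "pullback F p \<in> e" "value_at e (pullback F p) = peval p (\<chi> i. value_at e (rat_of_poly (F i)))"
  unfolding pullback_def by (rule poly_subst_value[OF assms])+

end

lemma rat_of_poly_subst: "rat_of_poly p = poly_subst cst coord p"
proof (rule ring_hom_cpoly_eqI[OF ring_hom_rat_of_poly ring_hom_poly_subst[OF ring_hom_cst]])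
  show "rat_of_poly (cpoly_const c) = poly_subst cst coord (cpoly_const c)" for c
    by (simp add: poly_subst_const[OF ring_hom_cst] cst_def)
  show "rat_of_poly (cpoly_var i) = poly_subst cst coord (cpoly_var i)" for i
    unfolding poly_subst_var[OF ring_hom_cst] by (simp add: coord_def)
qed

lemma (in closed_point) rat_of_poly_value:
  assumes "range coord \<subseteq> e"
  shows "rat_of_poly p \<in> e" "value_at e (rat_of_poly p) = peval p (\<chi> i. value_at e (coord i))"
  using poly_subst_value[of coord p] assms unfolding rat_of_poly_subst[of p] by auto

lemma closed_point_of_model: "variety_model X \<Longrightarrow> e \<in> closed_points X \<Longrightarrow> closed_point e"
  using variety_model_point(1)[of X e]
  by (auto simp: closed_point_def closed_point_axioms_def closed_points_def)

section \<open>Divisors lying over a hypersurface\<close>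

text \<open>\<open>\<phi> p0\<close> is the function written p in the overview: \<open>p0\<close>
  generates the ideal of V at its generic point. The index \<open>j0\<close> records a partial
  derivative of \<open>p0\<close> that is not identically zero on V.\<close>

locale keller_divisor = keller_component F V + dvr \<Gamma> \<pi>
  for F :: "'n::{finite,linorder} \<Rightarrow> 'n cpoly" and V :: "('n cspace) set" and \<Gamma> :: "'n ratfun set" and \<pi> :: "'n ratfun" +
  fixes X :: "'n ratfun set set" and i1 :: 'n and m :: nat and p0 :: "'n cpoly" and j0 :: 'n
  assumes X_variety: "variety_model X" and \<Gamma>_in: "\<Gamma> \<in> X"
    and onto: "maps_generically_finite_etale_onto F \<Gamma> V"
    and m: "1 \<le> m" and x1_order: "has_order \<Gamma> (inverse (coord i1)) m"
    and p0: "p0 \<in> vanishing_ideal V" "pdiff j0 p0 \<notin> vanishing_ideal V"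
    and p0_generates: "\<forall>p\<in>vanishing_ideal V. \<exists>a b. b \<notin> vanishing_ideal V \<and> p * b = p0 * a"
begin

lemma p0_nonzero: "p0 \<noteq> 0"
  using p0(2) vanishing_ideal_ideal(1)[of V] by (auto simp: pdiff_def)

lemma dominates_R: "dominates \<Gamma> R"
  using onto by (simp add: maps_generically_finite_etale_onto_def)

lemma R_subset: "R \<subseteq> \<Gamma>"
  using dominates_R by (simp add: dominates_def)

lemma pullback_in: "\<phi> p \<in> \<Gamma>"
  using R_subset pullback_in_R by blast

lemma pullback_nonunit_iff: "\<phi> p \<in> \<mm> \<longleftrightarrow> p \<in> I"
proof
  assume "p \<in> I"
  then show "\<phi> p \<in> \<mm>" using dominates_R pullback_nonunits_R_iff by (auto simp: dominates_def)
next
  assume *: "\<phi> p \<in> \<mm>"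
  show "p \<in> I"
  proof (rule ccontr)
    assume "p \<notin> I"
    then have "inverse (\<phi> p) \<in> R" "p \<noteq> 0"
      using R_I[of p 1] notin_I_nonzero by (auto simp: pullback_hom inverse_eq_divide)
    then show False using * R_subset by (auto simp: nonunits_def)
  qed
qed

lemma residue_algebraic_R:
  "s \<in> \<Gamma> \<Longrightarrow> \<exists>n c. (\<forall>i\<le>n. c i \<in> R) \<and> (\<exists>i\<le>n. c i \<notin> \<mm>) \<and> (\<Sum>i\<le>n. c i * s ^ i) \<in> \<mm>"
  using residue_algebraic[OF complex_subalgebra_R dominates_R] onto
  unfolding maps_generically_finite_etale_onto_def by blast

definition "k = ramification_index R \<Gamma>"

text \<open>Two uniformizers of \<open>R\<close> differ by a unit of \<open>R\<close>, which is also
  a unit of \<Gamma>. Hence the definite description in \<open>ramification_index\<close> has a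
  unique candidate, the order of \<open>\<phi> p0\<close>. It is positive because \<open>p0\<close>
  vanishes on V.\<close>

lemma ramification:
  obtains w where "w \<in> \<Gamma> - \<mm>" "\<phi> p0 = \<pi> ^ k * w" "1 \<le> k"
proof -
  note unifR = uniformizer_R[OF p0(1) p0_nonzero p0_generates]
  obtain k' w where w: "w \<in> \<Gamma> - \<mm>" "\<phi> p0 = \<pi> ^ k' * w"
    by (rule factorization[OF pullback_in, of p0]) (use p0_nonzero in auto)
  have "k = k'"
    unfolding k_def ramification_index_def
  proof (rule the_equality)
    show "\<exists>\<rho>. uniformizer R \<rho> \<and> has_order \<Gamma> \<rho> k'" using unifR w has_order_iff by blast
  next
    fix j assume "\<exists>\<rho>. uniformizer R \<rho> \<and> has_order \<Gamma> \<rho> j"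
    then obtain \<rho> v where \<rho>: "uniformizer R \<rho>" "v \<in> \<Gamma> - \<mm>" "\<rho> = \<pi> ^ j * v" using has_order_iff by blast
    obtain t where t: "t \<in> R - nonunits R" "\<rho> = \<phi> p0 * t"
      using uniformizers_associated[OF complex_subalgebra_R \<rho>(1) unifR] by blast
    have "t \<in> \<Gamma> - \<mm>" using t(1) R_subset unfolding unit_iff by blast
    moreover have "\<pi> ^ j * v = \<pi> ^ k' * (w * t)" using t(2) \<rho>(3) w(2) by simp
    ultimately show "j = k'" using order_unique \<rho>(2) unit_mult w(1) by blast
  qed
  moreover have "k' \<noteq> 0"
  proof
    assume "k' = 0"
    then show False using w pullback_nonunit_iff[of p0] p0(1) by simp
  qed
  ultimately show thesis using that w by simp
qed

lemma derivation_order: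
  assumes "h \<in> \<Gamma>"
  shows "\<pi> ^ (k - 1) * D j h \<in> \<Gamma>"
proof -
  obtain w where w: "w \<in> \<Gamma> - \<mm>" "\<phi> p0 = \<pi> ^ k * w" "1 \<le> k" by (rule ramification)
  obtain G P where "finite G" "prime_ideal_of (generated_algebra G) P" "\<Gamma> = localization (generated_algebra G) P"
    using variety_model_point(3)[OF X_variety \<Gamma>_in] by blast
  from derivation_bounded[OF derivation_target_deriv target_deriv_cst this]
  have "\<exists>N. \<forall>h\<in>\<Gamma>. \<pi> ^ N * D j h \<in> \<Gamma>" .
  then show ?thesis
    using derivation_pole_order[OF derivation_target_deriv _ _ complex_subalgebra_R dominates_R _ pullback_in_R w(2,1,3) assms]
      D_in_R residue_algebraic_R by blast
qed

section \<open>Closed points of \<Gamma> over generic points of V\<close>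

lemma point_in_X: "point_over F X \<Gamma> v e \<Longrightarrow> e \<in> X"
  by (simp add: point_over_def closed_points_def)

lemma point_closed: "point_over F X \<Gamma> v e \<Longrightarrow> closed_point e"
  using closed_point_of_model[OF X_variety] by (simp add: point_over_def)

lemma point_pullback:
  assumes "point_over F X \<Gamma> v e"
  shows "\<phi> p \<in> e" "value_at e (\<phi> p) = peval p v"
proof -
  interpret closed_point e by (rule point_closed[OF assms])
  have *: "\<And>i. rat_of_poly (F i) \<in> e" "(\<chi> i. value_at e (rat_of_poly (F i))) = v"
    using assms by (auto simp: point_over_def vec_eq_iff)
  show "\<phi> p \<in> e" "value_at e (\<phi> p) = peval p v" using pullback_value[of F p, OF *(1)] unfolding *(2) by auto
qed

lemma point_nonunit:
  assumes "point_over F X \<Gamma> v e" "h \<in> e" "h \<in> \<mm>"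
  shows "h \<in> nonunits e" "value_at e h = 0"
proof -
  interpret closed_point e by (rule point_closed[OF assms(1)])
  have "e \<subseteq> \<Gamma>" using assms(1) by (simp add: point_over_def)
  with assms show "h \<in> nonunits e" unfolding nonunits_def by blast
  then show "value_at e h = 0" using value_at_eq_0_iff assms(2) by blast
qed

text \<open>Clearing denominators and dividing by a power of the unit \<open>s\<close>, the algebraic dependence of \<open>s\<close>
  over the residue field of \<open>V\<close> gets polynomial coefficients and a constant term outside \<open>I\<close>. A
  point over which that term does not vanish is not a zero of \<open>s\<close>.\<close>

lemma unit_generically_invertible:
  assumes s: "s \<in> \<Gamma> - \<mm>"
  shows "\<exists>c. c \<notin> I \<and> (\<forall>e v. point_over F X \<Gamma> v e \<and> s \<in> e \<and> peval c v \<noteq> 0 \<longrightarrow> inverse s \<in> e)"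
proof -
  obtain n c where c: "\<forall>i\<le>n. c i \<in> R" "\<exists>i\<le>n. c i \<notin> \<mm>" "(\<Sum>i\<le>n. c i * s ^ i) \<in> \<mm>"
    using residue_algebraic_R s by blast
  have "\<exists>p q. c i = \<phi> p / \<phi> q \<and> q \<notin> I" if "i \<le> n" for i using c(1) that unfolding ring_of_component_def by auto
  then obtain p q where pq: "\<And>i. i \<le> n \<Longrightarrow> c i = \<phi> (p i) / \<phi> (q i) \<and> q i \<notin> I" by metis
  define b where "b i = p i * (\<Prod>j\<in>{..n} - {i}. q j)" for i
  define Q where "Q = (\<Prod>j\<le>n. q j)"
  have Q: "Q \<notin> I" unfolding Q_def using pq by (subst I_prod_iff) auto
  have b: "\<phi> (b i) = \<phi> Q * c i" if "i \<le> n" for i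
  proof -
    have "Q = q i * (\<Prod>j\<in>{..n} - {i}. q j)" unfolding Q_def using that by (subst prod.remove[of _ i]) auto
    then show ?thesis using pq[OF that] notin_I_nonzero[of "q i"] by (simp add: b_def pullback_hom)
  qed
  have bsum: "(\<Sum>i\<le>n. \<phi> (b i) * s ^ i) \<in> \<mm>"
  proof -
    have "(\<Sum>i\<le>n. \<phi> (b i) * s ^ i) = \<phi> Q * (\<Sum>i\<le>n. c i * s ^ i)"
      unfolding sum_distrib_left by (rule sum.cong) (auto simp: b)
    then show ?thesis using c(3) pullback_in nonunits_closed(3) by metis
  qed
  define j where "j = (LEAST i. i \<le> n \<and> b i \<notin> I)"
  have "\<exists>i. i \<le> n \<and> b i \<notin> I"
  proof -
    obtain i where i: "i \<le> n" "c i \<notin> \<mm>" using c(2) by blast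
    have "\<phi> (b i) \<notin> \<mm>"
      unfolding b[OF i(1)] using i c(1) R_subset Q pullback_in by (subst nonunits_mult_iff) (auto simp: pullback_nonunit_iff)
    then show ?thesis using i(1) pullback_nonunit_iff by blast
  qed
  then have j: "j \<le> n" "b j \<notin> I" unfolding j_def by (metis (mono_tags, lifting) LeastI)+
  have jmin: "b i \<in> I" if "i < j" for i
    using not_less_Least[of i "\<lambda>i. i \<le> n \<and> b i \<notin> I"] that j(1) unfolding j_def by auto
  define E where "E = (\<Sum>i\<le>n - j. \<phi> (b (i + j)) * s ^ i)"
  have "E \<in> \<mm>"
  proof -
    have split: "{..n} = {..<j} \<union> {j..n}" using j(1) by auto
    have "(\<Sum>i\<le>n. \<phi> (b i) * s ^ i) = (\<Sum>i<j. \<phi> (b i) * s ^ i) + (\<Sum>i\<in>{j..n}. \<phi> (b i) * s ^ i)"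
      unfolding split by (rule sum.union_disjoint) auto
    moreover have "(\<Sum>i\<in>{j..n}. \<phi> (b i) * s ^ i) = s ^ j * E"
    proof -
      have "(\<Sum>i\<in>{j..n}. \<phi> (b i) * s ^ i) = (\<Sum>i\<in>{0 + j..n - j + j}. \<phi> (b i) * s ^ i)" using j(1) by simp
      also have "\<dots> = (\<Sum>i\<in>{0..n - j}. \<phi> (b (i + j)) * s ^ (i + j))" by (rule sum.shift_bounds_cl_nat_ivl)
      finally show ?thesis by (simp add: E_def sum_distrib_left power_add algebra_simps atLeast0AtMost)
    qed
    moreover have "(\<Sum>i<j. \<phi> (b i) * s ^ i) \<in> \<mm>"
      using jmin s closed(8) by (intro nonunits_closed(7) nonunits_closed(4)) (auto simp: pullback_nonunit_iff)
    ultimately have "s ^ j * E \<in> \<mm>" using bsum nonunits_closed(6) by fastforce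
    moreover have "E \<in> \<Gamma>" unfolding E_def using s pullback_in by (intro closed(9) closed(5) closed(8)) auto
    ultimately show ?thesis using nonunits_mult_iff unit_power[OF s, of j] by blast
  qed
  have "inverse s \<in> e" if *: "point_over F X \<Gamma> v e" "s \<in> e" "peval (b j) v \<noteq> 0" for e v
  proof (rule ccontr)
    interpret e: closed_point e by (rule point_closed[OF *(1)])
    assume "inverse s \<notin> e"
    then have sv: "value_at e s = 0" using e.inverse_mem *(2) by blast
    have "E \<in> e" unfolding E_def using *(2) point_pullback(1)[OF *(1)] by (intro e.closed(9) e.closed(5) e.closed(8)) auto
    then have "value_at e E = 0" using point_nonunit[OF *(1)] \<open>E \<in> \<mm>\<close> by blast
    moreover have "value_at e E = (\<Sum>i\<le>n - j. value_at e (\<phi> (b (i + j))) * value_at e s ^ i)"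
      unfolding E_def using *(2) point_pullback(1)[OF *(1)]
      by (subst e.value_at_sum) (auto simp: e.value_at_mult e.value_at_power e.closed)
    moreover have "\<dots> = (\<Sum>i\<le>n - j. if i = 0 then peval (b j) v else 0)"
      by (rule sum.cong) (auto simp: sv point_pullback(2)[OF *(1)])
    ultimately show False using *(3) by simp
  qed
  with j(2) show ?thesis by blast
qed

text \<open>\<Gamma> is itself a valuation ring, and it dominates the localization of the chart
  \<open>A\<close> at the contraction of its maximal ideal. That localization is a point of X, so
  separatedness identifies it with \<Gamma>. Every element of \<Gamma> is thus a fraction of
  functions on a chart containing \<open>e\<close>.\<close>

lemma chart_at_point:
  assumes "affine_model A \<subseteq> X" "complex_subalgebra A" "e \<in> affine_model A" "e \<subseteq> \<Gamma>"
  shows "\<Gamma> = localization A (\<mm> \<inter> A)" "prime_ideal_of A (\<mm> \<inter> A)" "A \<subseteq> e"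
proof -
  obtain M where M: "prime_ideal_of A M" "e = localization A M" using assms(3) by (auto simp: affine_model_def)
  show Ae: "A \<subseteq> e" using localization_props(2)[OF assms(2) M(1)] M(2) by simp
  then have A\<Gamma>: "A \<subseteq> \<Gamma>" using assms(4) by blast
  show P: "prime_ideal_of A (\<mm> \<inter> A)"
    using prime_nonunits A\<Gamma> complex_subalgebraD(2,5,7)[OF assms(2)]
    unfolding prime_ideal_of_def by (auto simp: subset_iff)
  note lp = localization_props[OF assms(2) P]
  let ?L = "localization A (\<mm> \<inter> A)"
  have "dominates \<Gamma> ?L"
    unfolding dominates_def
  proof (intro conjI subsetI)
    fix h assume "h \<in> ?L"
    then obtain a s where *: "h = a / s" "a \<in> A" "s \<in> A" "s \<notin> \<mm>" unfolding localization_def by blast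
    then have "inverse s \<in> \<Gamma>" using A\<Gamma> unit_iff by blast
    then show "h \<in> \<Gamma>" using * A\<Gamma> closed(5) unfolding divide_inverse by blast
  next
    fix h assume "h \<in> nonunits ?L"
    then obtain a s where *: "h = a / s" "a \<in> \<mm>" "s \<in> A" "s \<notin> \<mm>" unfolding lp(3) by blast
    then have "inverse s \<in> \<Gamma>" using A\<Gamma> unit_iff by blast
    then show "h \<in> \<mm>" using * nonunits_closed(4) unfolding divide_inverse by blast
  qed
  then have W: "\<exists>W. valuation_ring W \<and> dominates W \<Gamma> \<and> dominates W ?L"
    using valuation_ring by (intro exI[of _ \<Gamma>]) (simp add: dominates_def)
  have L: "?L \<in> X" using assms(1) P by (auto simp: affine_model_def)
  have sep: "\<forall>R\<in>X. \<forall>S\<in>X. (\<exists>W. valuation_ring W \<and> dominates W R \<and> dominates W S) \<longrightarrow> R = S"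
    using X_variety[unfolded variety_model_def] by (elim exE conjE)
  show "\<Gamma> = ?L" by (rule sep[rule_format, OF \<Gamma>_in L W])
qed

text \<open>On a chart the element is \<open>a / s\<close> with \<open>a\<close> and
  \<open>s\<close> regular and \<open>s\<close> a unit of \<Gamma>; its possible poles are zeros of
  \<open>s\<close>, which \<open>unit_generically_invertible\<close> confines to special fibres. X
  has finitely many charts, so the product of their polynomials serves for all points over
  \<open>v\<close>.\<close>

lemma regular_generically_finite:
  assumes h: "h \<in> \<Gamma>"
  shows "\<exists>c. c \<notin> I \<and> (\<forall>e v. point_over F X \<Gamma> v e \<and> peval c v \<noteq> 0 \<longrightarrow> h \<in> e)"
proof -
  obtain \<A> where \<A>: "finite \<A>" "X = (\<Union>A\<in>\<A>. affine_model A)"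
    "\<forall>A\<in>\<A>. (\<exists>G. finite G \<and> A = generated_algebra G) \<and> (\<forall>h. \<exists>a\<in>A. \<exists>b\<in>A. h = a / b)"
    using X_variety[unfolded variety_model_def] by (elim exE conjE) (rule that, assumption+)
  have "\<exists>c. c \<notin> I \<and> (\<forall>e v. point_over F X \<Gamma> v e \<and> e \<in> affine_model A \<and> peval c v \<noteq> 0 \<longrightarrow> h \<in> e)"
    if A: "A \<in> \<A>" for A
  proof (cases "\<exists>e\<in>affine_model A. e \<subseteq> \<Gamma>")
    case True
    have sub: "affine_model A \<subseteq> X" using A \<A>(2) by blast
    obtain G where "A = generated_algebra G" using A \<A>(3) by blast
    then have alg: "complex_subalgebra A" by (simp add: complex_subalgebra_generated_algebra)
    note chart = chart_at_point[OF sub alg]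
    have "\<Gamma> = localization A (\<mm> \<inter> A)" using True chart(1) by blast
    then have "h \<in> localization A (\<mm> \<inter> A)" using h by simp
    then obtain a s where *: "h = a / s" "a \<in> A" "s \<in> A" "s \<notin> \<mm>" unfolding localization_def by blast
    have "s \<in> \<Gamma> - \<mm>" using * True chart(3) by blast
    then obtain c where c: "c \<notin> I" "\<forall>e v. point_over F X \<Gamma> v e \<and> s \<in> e \<and> peval c v \<noteq> 0 \<longrightarrow> inverse s \<in> e"
      using unit_generically_invertible by blast
    have "h \<in> e" if e: "point_over F X \<Gamma> v e" "e \<in> affine_model A" "peval c v \<noteq> 0" for e v
    proof -
      interpret e: closed_point e by (rule point_closed[OF e(1)])
      have "A \<subseteq> e" using e chart(3) by (simp add: point_over_def)
      then show ?thesis using * c(2) e e.closed(5) unfolding divide_inverse by blast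
    qed
    with c(1) show ?thesis by blast
  next
    case False
    then show ?thesis using one_notin_I unfolding point_over_def by blast
  qed
  then obtain c where c: "\<And>A. A \<in> \<A> \<Longrightarrow> c A \<notin> I"
    "\<And>A e v. A \<in> \<A> \<Longrightarrow> point_over F X \<Gamma> v e \<Longrightarrow> e \<in> affine_model A \<Longrightarrow> peval (c A) v \<noteq> 0 \<Longrightarrow> h \<in> e"
    by metis
  have "prod c \<A> \<notin> I" using c(1) by (simp add: I_prod_iff \<A>(1))
  moreover have "h \<in> e" if "point_over F X \<Gamma> v e" "peval (prod c \<A>) v \<noteq> 0" for e v
    using that point_in_X[OF that(1)] c(2) \<A>(1,2) by (auto simp: peval_hom)
  ultimately show ?thesis by blast
qed

lemma regular_generically_finite_set:
  assumes "finite H" "H \<subseteq> \<Gamma>"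
  shows "\<exists>c. c \<notin> I \<and> (\<forall>e v. point_over F X \<Gamma> v e \<and> peval c v \<noteq> 0 \<longrightarrow> H \<subseteq> e)"
proof -
  have "\<forall>h\<in>H. \<exists>c. c \<notin> I \<and> (\<forall>e v. point_over F X \<Gamma> v e \<and> peval c v \<noteq> 0 \<longrightarrow> h \<in> e)"
    using assms(2) regular_generically_finite by blast
  then obtain c where c: "\<And>h. h \<in> H \<Longrightarrow> c h \<notin> I"
    "\<And>h e v. h \<in> H \<Longrightarrow> point_over F X \<Gamma> v e \<Longrightarrow> peval (c h) v \<noteq> 0 \<Longrightarrow> h \<in> e"
    by metis
  have "prod c H \<notin> I" using c(1) assms(1) by (simp add: I_prod_iff)
  moreover have "H \<subseteq> e" if "point_over F X \<Gamma> v e" "peval (prod c H) v \<noteq> 0" for e v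
    using that c(2) assms(1) by (auto simp: peval_hom)
  ultimately show ?thesis by blast
qed

end

section \<open>Local parameters on the target\<close>

lemma ring_at_eq_localization:
  fixes v :: "('n::{finite,linorder}) cspace"
  shows "complex_subalgebra (range (rat_of_poly :: 'n cpoly \<Rightarrow> _))"
    "prime_ideal_of (range rat_of_poly) (rat_of_poly ` {p. peval p v = 0})"
    "ring_at v = localization (range rat_of_poly) (rat_of_poly ` {p. peval p v = 0})"
proof -
  show "complex_subalgebra (range (rat_of_poly :: 'n cpoly \<Rightarrow> _))"
    by (auto simp: complex_subalgebra_def cst_def rat_of_poly_hom[symmetric])
  show "prime_ideal_of (range rat_of_poly) (rat_of_poly ` {p. peval p v = 0})"
    unfolding prime_ideal_of_def
  proof (intro conjI ballI impI)
    show "1 \<notin> rat_of_poly ` {p. peval p v = 0}"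
      using rat_of_poly_eq_iff[of 1] by (auto simp: rat_of_poly_hom(1)[symmetric] peval_hom)
    show "0 \<in> rat_of_poly ` {p. peval p v = 0}"
      by (rule image_eqI[of _ _ 0]) (auto simp: rat_of_poly_hom peval_hom)
  qed (auto simp: rat_of_poly_hom[symmetric] peval_hom image_iff)
  show "ring_at v = localization (range rat_of_poly) (rat_of_poly ` {p. peval p v = 0})"
  proof (intro set_eqI iffI)
    fix h assume "h \<in> ring_at v"
    then obtain p q where *: "h = rat_of_poly p / rat_of_poly q" "peval q v \<noteq> 0" by (auto simp: ring_at_def)
    then have "rat_of_poly q \<in> range rat_of_poly - rat_of_poly ` {p. peval p v = 0}" by auto
    then show "h \<in> localization (range rat_of_poly) (rat_of_poly ` {p. peval p v = 0})"
      using *(1) unfolding localization_def by blast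
  qed (auto simp: ring_at_def localization_def)
qed

lemma ring_at_props:
  fixes v :: "('n::{finite,linorder}) cspace"
  shows "local_subalgebra (ring_at v)" "rat_of_poly p \<in> ring_at v"
    "rat_of_poly p \<in> nonunits (ring_at v) \<longleftrightarrow> peval p v = 0"
proof -
  note lp = localization_props[OF ring_at_eq_localization(1) ring_at_eq_localization(2)[of v], folded ring_at_eq_localization(3)[of v]]
  show "local_subalgebra (ring_at v)" by (rule lp)
  show "rat_of_poly p \<in> ring_at v" using lp(2) by blast
  show "rat_of_poly p \<in> nonunits (ring_at v) \<longleftrightarrow> peval p v = 0" using lp(4) by force
qed

lemma frac_deriv_ring_at:
  assumes \<delta>: "derivation \<delta>" and h: "h \<in> ring_at v"
  shows "frac_deriv \<delta> h \<in> ring_at v"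
proof -
  obtain p q where *: "h = rat_of_poly p / rat_of_poly q" "peval q v \<noteq> 0" using h by (auto simp: ring_at_def)
  then have "q \<noteq> 0" by (auto simp: peval_hom)
  have "h = Fraction_Field.Fract p q" by (simp add: *(1) rat_of_poly_def)
  then have "frac_deriv \<delta> h = rat_of_poly (\<delta> p * q - p * \<delta> q) / rat_of_poly (q * q)"
    using \<open>q \<noteq> 0\<close> by (simp add: frac_deriv_Fract[OF \<delta>] rat_of_poly_def)
  then show ?thesis using *(2) unfolding ring_at_def by (auto simp: peval_hom intro!: exI)
qed

lemma ideal_span_closed:
  assumes R: "complex_subalgebra R" and B: "finite B"
  shows "b \<in> B \<Longrightarrow> r \<in> R \<Longrightarrow> r * b \<in> ideal_span R B"
    and "x \<in> ideal_span R B \<Longrightarrow> y \<in> ideal_span R B \<Longrightarrow> x + y \<in> ideal_span R B"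
    and "r \<in> R \<Longrightarrow> x \<in> ideal_span R B \<Longrightarrow> r * x \<in> ideal_span R B"
    and "(\<And>i. i \<in> S \<Longrightarrow> f i \<in> ideal_span R B) \<Longrightarrow> sum f S \<in> ideal_span R B"
proof -
  note cl = complex_subalgebraD[OF R]
  show "r * b \<in> ideal_span R B" if "b \<in> B" "r \<in> R"
    unfolding ideal_span_def using that B cl(2)
    by (intro CollectI exI[of _ "\<lambda>x. if x = b then r else 0"]) (auto simp: if_distrib[of "\<lambda>x. x * _"] cong: if_cong)
  show add: "x + y \<in> ideal_span R B" if xy: "x \<in> ideal_span R B" "y \<in> ideal_span R B" for x y
  proof -
    obtain f g where "x = (\<Sum>b\<in>B. f b * b)" "\<forall>b\<in>B. f b \<in> R" "y = (\<Sum>b\<in>B. g b * b)" "\<forall>b\<in>B. g b \<in> R"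
      using xy unfolding ideal_span_def by blast
    then show ?thesis unfolding ideal_span_def using cl(7)
      by (intro CollectI exI[of _ "\<lambda>b. f b + g b"]) (auto simp: sum.distrib distrib_right)
  qed
  show "r * x \<in> ideal_span R B" if rx: "r \<in> R" "x \<in> ideal_span R B" for r x
  proof -
    obtain f where "x = (\<Sum>b\<in>B. f b * b)" "\<forall>b\<in>B. f b \<in> R" using rx unfolding ideal_span_def by blast
    then show ?thesis unfolding ideal_span_def using cl(5) rx(1)
      by (intro CollectI exI[of _ "\<lambda>b. r * f b"]) (auto simp: sum_distrib_left mult.assoc)
  qed
  have zero: "0 \<in> ideal_span R B"
    unfolding ideal_span_def using cl(2) by (intro CollectI exI[of _ "\<lambda>_. 0"]) auto
  show "(\<And>i. i \<in> S \<Longrightarrow> f i \<in> ideal_span R B) \<Longrightarrow> sum f S \<in> ideal_span R B"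
    by (induction S rule: infinite_finite_induct) (auto simp: zero add)
qed

definition new_coord_poly :: "'n cmatrix \<Rightarrow> 'n cspace \<Rightarrow> 'n \<Rightarrow> ('n::finite) cpoly" where
  "new_coord_poly A v i = (\<Sum>j\<in>UNIV. cpoly_const (A $ i $ j) * (cpoly_var j - cpoly_const (v $ j)))"

lemma new_coord_coord: "new_coord A v coord i = rat_of_poly (new_coord_poly A v i)"
  by (simp add: new_coord_def new_coord_poly_def rat_of_poly_hom coord_eq cst_def)

lemma new_comp_eq: "new_comp F A v i = pullback F (new_coord_poly A v i)"
  by (simp add: new_coord_def new_coord_poly_def ring_homD[OF ring_hom_pullback])

lemma peval_new_coord_poly: "peval (new_coord_poly A v i) y = (A *v (y - v)) $ i"
  by (simp add: new_coord_poly_def peval_hom matrix_vector_mult_def)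

lemma derivation_dir: "derivation (\<lambda>p :: 'n::finite cpoly. \<Sum>j\<in>UNIV. cpoly_const (b j) * pdiff j p)"
  by (auto simp: derivation_def pdiff_add pdiff_mult algebra_simps sum.distrib sum_distrib_left)

lemma pdiff_new_coord_poly: "pdiff j (new_coord_poly A v i) = cpoly_const (A $ i $ j)"
proof -
  have "pdiff j (cpoly_const (A $ i $ k) * (cpoly_var k - cpoly_const (v $ k)))
      = (if k = j then cpoly_const (A $ i $ j) else 0)" for k
    by (simp add: pdiff_mult derivationD(6)[OF derivation_pdiff])
  then show ?thesis by (simp add: new_coord_poly_def derivationD(8)[OF derivation_pdiff])
qed

lemma poly_taylor_first_order:
  fixes p :: "'n::finite cpoly"
  shows "\<exists>g. p - cpoly_const (peval p v) = (\<Sum>j\<in>UNIV. g j * (cpoly_var j - cpoly_const (v $ j)))"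
proof (induction p rule: cpoly_induct)
  case (const c)
  show ?case by (rule exI[of _ "\<lambda>_. 0"]) simp
next
  case (var i)
  have "(\<Sum>j\<in>UNIV. (if j = i then 1 else 0) * (cpoly_var j - cpoly_const (v $ j))) =
      (\<Sum>j\<in>UNIV. if j = i then cpoly_var j - cpoly_const (v $ j) else 0)"
    by (rule sum.cong) auto
  then show ?case by (intro exI[of _ "\<lambda>j. if j = i then 1 else 0"]) simp
next
  case (add p q)
  then obtain g h where gh: "p - cpoly_const (peval p v) = (\<Sum>j\<in>UNIV. g j * (cpoly_var j - cpoly_const (v $ j)))"
    "q - cpoly_const (peval q v) = (\<Sum>j\<in>UNIV. h j * (cpoly_var j - cpoly_const (v $ j)))" by blast
  have "p + q - cpoly_const (peval (p + q) v) = (p - cpoly_const (peval p v)) + (q - cpoly_const (peval q v))"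
    by (simp add: peval_hom single_add)
  also have "\<dots> = (\<Sum>j\<in>UNIV. (g j + h j) * (cpoly_var j - cpoly_const (v $ j)))"
    unfolding gh by (simp only: distrib_right sum.distrib)
  finally show ?case by (intro exI[of _ "\<lambda>j. g j + h j"])
next
  case (mult p q)
  then obtain g h where gh: "p - cpoly_const (peval p v) = (\<Sum>j\<in>UNIV. g j * (cpoly_var j - cpoly_const (v $ j)))"
    "q - cpoly_const (peval q v) = (\<Sum>j\<in>UNIV. h j * (cpoly_var j - cpoly_const (v $ j)))" by blast
  have "p * q - cpoly_const (peval (p * q) v) =
      (p - cpoly_const (peval p v)) * q + cpoly_const (peval p v) * (q - cpoly_const (peval q v))"
    by (simp add: peval_hom mult_single algebra_simps)
  also have "\<dots> = (\<Sum>j\<in>UNIV. (g j * q + cpoly_const (peval p v) * h j) * (cpoly_var j - cpoly_const (v $ j)))"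
    unfolding gh sum_distrib_left sum_distrib_right sum.distrib[symmetric]
    by (rule sum.cong) (simp_all add: algebra_simps)
  finally show ?case by (intro exI[of _ "\<lambda>j. g j * q + cpoly_const (peval p v) * h j"])
qed

text \<open>Where the gradient of \<open>p0\<close> does not vanish, \<open>p0\<close> is itself a
  local equation, so the condition on an arbitrary \<psi> can be transferred to
  \<open>p0\<close>.\<close>

lemma local_equation_generic:
  assumes le: "local_equation V v \<psi>" and v: "v \<in> V" and p0: "p0 \<in> vanishing_ideal V" "peval (pdiff j p0) v \<noteq> 0"
  shows "\<psi> \<in> nonunits (ring_at v)"
    and "\<exists>s. s \<in> ring_at v - nonunits (ring_at v) \<and> rat_of_poly p0 = \<psi> * s"
proof -
  interpret L: local_subalgebra "ring_at v" by (rule ring_at_props)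
  note le' = le[unfolded local_equation_def]
  have "\<psi> \<in> {\<psi> * s | s. s \<in> ring_at v}" using L.closed(3) by force
  then obtain p q where "\<psi> = rat_of_poly p / rat_of_poly q" "p \<in> vanishing_ideal V" "peval q v \<noteq> 0"
    unfolding le'[symmetric] by blast
  moreover from this have "rat_of_poly q \<in> ring_at v - nonunits (ring_at v)" "rat_of_poly p \<in> nonunits (ring_at v)"
    using v by (auto simp: ring_at_props vanishing_ideal_def)
  ultimately show \<psi>: "\<psi> \<in> nonunits (ring_at v)"
    using L.unit_inverse L.nonunits_closed(4) unfolding divide_inverse by simp
  have "rat_of_poly p0 / rat_of_poly 1 \<in> {rat_of_poly p / rat_of_poly q | p q. p \<in> vanishing_ideal V \<and> peval q v \<noteq> 0}"
    using p0 by (intro CollectI exI[of _ p0] exI[of _ 1]) (auto simp: peval_hom)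
  then obtain s where s: "rat_of_poly p0 = \<psi> * s" "s \<in> ring_at v" unfolding le' by (auto simp: rat_of_poly_hom)
  let ?E = "frac_deriv (pdiff j)"
  note E = derivationD[OF derivation_frac_deriv[OF derivation_pdiff[of j]]]
  have "s \<notin> nonunits (ring_at v)"
  proof
    assume sn: "s \<in> nonunits (ring_at v)"
    have "rat_of_poly (pdiff j p0) = ?E (rat_of_poly p0)" by (simp add: frac_deriv_rat_of_poly derivation_pdiff)
    also have "\<dots> = ?E \<psi> * s + \<psi> * ?E s" unfolding s(1) by (simp add: E)
    also have "\<dots> \<in> nonunits (ring_at v)"
      using \<psi> sn s(2) frac_deriv_ring_at[OF derivation_pdiff] L.nonunits_closed(8)
      by (intro L.nonunits_add L.nonunits_closed(3)[of _ s] L.nonunits_closed(4)[of _ \<psi>]) auto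
    finally show False using p0(2) ring_at_props(3) by blast
  qed
  with s show "\<exists>s. s \<in> ring_at v - nonunits (ring_at v) \<and> rat_of_poly p0 = \<psi> * s" by blast
qed

text \<open>The sum is the derivative of \<open>p0\<close> at \<open>v\<close> along the new
  y_1-axis. If it were 0, the derivation dual to the new coordinate with index \<open>i1\<close>
  would send \<psi> and all the other new coordinates into the maximal ideal. These generate the
  maximal ideal, so it would be preserved, although that coordinate lies in it and has derivative
  1.\<close>

lemma suitable_change_transversal:
  fixes A B :: "('n::{finite,linorder}) cmatrix"
  assumes le: "local_equation V v \<psi>" and v: "v \<in> V" and p0: "p0 \<in> vanishing_ideal V" "peval (pdiff j0 p0) v \<noteq> 0"
    and suitable: "suitable_change i1 \<psi> v A" and B: "A ** B = mat 1"
  shows "(\<Sum>j\<in>UNIV. B $ j $ i1 * peval (pdiff j p0) v) \<noteq> 0"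
proof
  assume c0: "(\<Sum>j\<in>UNIV. B $ j $ i1 * peval (pdiff j p0) v) = 0"
  interpret L: local_subalgebra "ring_at v" by (rule ring_at_props)
  let ?m = "nonunits (ring_at v)"
  \<comment> \<open>The derivative in the direction of column \<open>i1\<close> of the inverse
    matrix \<open>B\<close>, that is, with respect to the new coordinate \<open>i1\<close>.\<close>
  let ?\<delta> = "\<lambda>p :: 'n cpoly. \<Sum>j\<in>UNIV. cpoly_const (B $ j $ i1) * pdiff j p"
  let ?E = "frac_deriv ?\<delta>"
  note der = derivation_dir[of "\<lambda>j. B $ j $ i1"]
  note E = derivationD[OF derivation_frac_deriv[OF der]]
  have Erat: "?E (rat_of_poly p) = rat_of_poly (?\<delta> p)" for p
    by (rule frac_deriv_rat_of_poly[OF der])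
  have Ein: "?E h \<in> ring_at v" if "h \<in> ring_at v" for h by (rule frac_deriv_ring_at[OF der that])
  have Ey: "?E (new_coord A v coord i) = (if i = i1 then 1 else 0)" for i
  proof -
    have "?\<delta> (new_coord_poly A v i) = cpoly_const ((A ** B) $ i $ i1)"
      by (simp add: pdiff_new_coord_poly mult_single matrix_matrix_mult_def mult.commute
        ring_homD(8)[OF ring_hom_cpoly_const])
    then have "?\<delta> (new_coord_poly A v i) = (if i = i1 then 1 else 0)" unfolding B by (simp add: mat_def)
    then show ?thesis unfolding new_coord_coord Erat by (simp add: rat_of_poly_hom)
  qed
  obtain s where s: "s \<in> ring_at v - ?m" "rat_of_poly p0 = \<psi> * s" and \<psi>: "\<psi> \<in> ?m"
    using local_equation_generic[OF le v p0] by blast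
  have "?E (rat_of_poly p0) \<in> ?m" unfolding Erat ring_at_props(3) using c0 by (simp add: peval_hom)
  then have "?E \<psi> * s + \<psi> * ?E s \<in> ?m" unfolding s(2) by (simp add: E)
  moreover have "\<psi> * ?E s \<in> ?m" using \<psi> s Ein L.nonunits_closed(4) by blast
  ultimately have "?E \<psi> * s \<in> ?m" using L.nonunits_closed(6) by fastforce
  then have E\<psi>: "?E \<psi> \<in> ?m" using L.nonunits_mult_iff Ein \<psi> L.nonunits_closed(8) s by blast
  let ?gens = "insert \<psi> (new_coord A v coord ` (UNIV - {i1}))"
  have span: "ideal_span (ring_at v) ?gens = ?m"
    using suitable by (simp add: suitable_change_def local_parameters_omitting_def)
  have y_in: "new_coord A v coord i \<in> ?m" for i
    unfolding new_coord_coord ring_at_props(3) peval_new_coord_poly by simp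
  have Em: "?E h \<in> ?m" if h: "h \<in> ?m" for h
  proof -
    obtain r where r: "h = (\<Sum>b\<in>?gens. r b * b)" "\<forall>b\<in>?gens. r b \<in> ring_at v"
      using h[folded span] unfolding ideal_span_def by blast
    have "?E h = (\<Sum>b\<in>?gens. ?E (r b) * b + r b * ?E b)" unfolding r(1) by (simp only: E)
    also have "\<dots> \<in> ?m"
    proof (intro L.nonunits_closed(7) L.nonunits_add L.nonunits_closed(3))
      fix b assume b: "b \<in> ?gens"
      show "?E (r b) \<in> ring_at v" "r b \<in> ring_at v" using r(2) b Ein by blast+
      show "b \<in> ?m" using b y_in \<psi> by auto
      have "b = \<psi> \<or> (\<exists>i. i \<noteq> i1 \<and> b = new_coord A v coord i)" using b by blast
      then show "?E b \<in> ?m" using E\<psi> Ey L.nonunits_closed(1) by (elim disjE exE) simp_all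
    qed
    finally show ?thesis .
  qed
  show False using Em[OF y_in[of i1]] L.nonunits_closed(2) by (simp add: Ey)
qed

text \<open>Swapping \<open>i1\<close> with \<open>j0\<close> is enough: the axis then points in a
  direction in which \<open>p0\<close> has nonzero derivative. The omitted coordinate is recovered
  from \<psi> and the others by solving the Taylor formula of \<open>p0\<close> for it.\<close>

lemma ex_suitable_change:
  fixes v :: "('n::{finite,linorder}) cspace"
  assumes le: "local_equation V v \<psi>" and v: "v \<in> V" and p0: "p0 \<in> vanishing_ideal V" "peval (pdiff j0 p0) v \<noteq> 0"
  shows "\<exists>A. suitable_change i1 \<psi> v A"
proof -
  interpret L: local_subalgebra "ring_at v" by (rule ring_at_props)
  let ?m = "nonunits (ring_at v)"
  define \<sigma> where "\<sigma> = Transposition.transpose i1 j0"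
  define A :: "'n cmatrix" where "A = (\<chi> i j. if j = \<sigma> i then 1 else 0)"
  let ?y = "\<lambda>j. cpoly_var j - cpoly_const (v $ j)"
  have y: "new_coord_poly A v i = ?y (\<sigma> i)" for i
  proof -
    have "new_coord_poly A v i = (\<Sum>j\<in>UNIV. if j = \<sigma> i then ?y j else 0)"
      unfolding new_coord_poly_def A_def by (rule sum.cong) auto
    then show ?thesis by simp
  qed
  have "A ** A = mat 1"
  proof -
    have "(A ** A) $ i $ j = (\<Sum>k\<in>UNIV. if k = \<sigma> i then (if j = \<sigma> k then 1 else 0) else 0)" for i j
      unfolding matrix_matrix_mult_def A_def vec_lambda_beta by (rule sum.cong) auto
    then show ?thesis by (auto simp: vec_eq_iff mat_def \<sigma>_def)
  qed
  then have inv: "invertible A" by (auto simp: invertible_def)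
  let ?gens = "insert \<psi> (new_coord A v coord ` (UNIV - {i1}))"
  have fin: "finite ?gens" by simp
  note span = ideal_span_closed[OF L.subalgebra fin]
  obtain s where s: "s \<in> ring_at v - ?m" "rat_of_poly p0 = \<psi> * s" and \<psi>: "\<psi> \<in> ?m"
    using local_equation_generic[OF le v p0] by blast
  have ym: "rat_of_poly (?y j) \<in> ?m" for j unfolding ring_at_props(3) by (simp add: peval_hom)
  have y_span: "rat_of_poly (?y j) \<in> ideal_span (ring_at v) ?gens" if "j \<noteq> j0" for j
  proof -
    have "\<sigma> j \<noteq> i1" "\<sigma> (\<sigma> j) = j" using that unfolding \<sigma>_def by (auto simp: Transposition.transpose_def)
    then have "rat_of_poly (?y j) \<in> ?gens"
      using new_coord_coord[of A v "\<sigma> j"] y[of "\<sigma> j"] by (intro insertI2 image_eqI[of _ _ "\<sigma> j"]) auto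
    from span(1)[OF this L.closed(3)] show ?thesis by simp
  qed
  have y0_span: "rat_of_poly (?y j0) \<in> ideal_span (ring_at v) ?gens"
  proof -
    obtain g where g: "p0 - cpoly_const (peval p0 v) = (\<Sum>j\<in>UNIV. g j * ?y j)" using poly_taylor_first_order by blast
    moreover have "peval p0 v = 0" using p0(1) v by (simp add: vanishing_ideal_def)
    ultimately have p0g: "p0 = (\<Sum>j\<in>UNIV. g j * ?y j)" by simp
    \<comment> \<open>Differentiating the Taylor formula at \<open>v\<close> isolates the
      coefficient \<open>g j0\<close>. It does not vanish there, so one may divide by it in the
      local ring.\<close>
    have "peval (pdiff j0 p0) v = peval (g j0) v"
    proof -
      have "peval (pdiff j0 (g j * ?y j)) v = (if j = j0 then peval (g j) v else 0)" for j
        by (auto simp: pdiff_mult peval_hom derivationD(6)[OF derivation_pdiff])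
      then show ?thesis unfolding p0g derivationD(8)[OF derivation_pdiff] peval_hom by simp
    qed
    then have "rat_of_poly (g j0) \<in> ring_at v - ?m" using p0(2) by (auto simp: ring_at_props)
    then have unit: "inverse (rat_of_poly (g j0)) \<in> ring_at v" "rat_of_poly (g j0) \<noteq> 0"
      unfolding unit_iff by auto
    have "p0 = g j0 * ?y j0 + (\<Sum>j\<in>UNIV - {j0}. g j * ?y j)" unfolding p0g by (rule sum.remove) auto
    then have "rat_of_poly p0 = rat_of_poly (g j0) * rat_of_poly (?y j0) + (\<Sum>j\<in>UNIV - {j0}. rat_of_poly (g j) * rat_of_poly (?y j))"
      by (simp only: rat_of_poly_hom)
    then have "rat_of_poly (?y j0) = inverse (rat_of_poly (g j0)) *
       (s * \<psi> + (\<Sum>j\<in>UNIV - {j0}. (- rat_of_poly (g j)) * rat_of_poly (?y j)))"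
      using unit(2) s(2) by (simp add: sum_negf field_simps)
    also have "\<dots> \<in> ideal_span (ring_at v) ?gens"
      using s(1) unit(1) ring_at_props(2) L.closed(6) y_span
      by (intro span(3) span(2) span(4) span(1)[of \<psi>]) auto
    finally show ?thesis .
  qed
  have "ideal_span (ring_at v) ?gens = ?m"
  proof (intro set_eqI iffI)
    fix h assume "h \<in> ideal_span (ring_at v) ?gens"
    then obtain r where r: "h = (\<Sum>b\<in>?gens. r b * b)" "\<forall>b\<in>?gens. r b \<in> ring_at v"
      unfolding ideal_span_def by blast
    have "b \<in> ?m" if "b \<in> ?gens" for b using that \<psi> ym by (auto simp: new_coord_coord y)
    then show "h \<in> ?m" unfolding r(1) using r(2) by (intro L.nonunits_closed(7) L.nonunits_closed(3)) auto
  next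
    fix h assume h: "h \<in> ?m"
    then obtain p q where pq: "h = rat_of_poly p / rat_of_poly q" "peval q v \<noteq> 0" by (auto simp: nonunits_def ring_at_def)
    then have q: "rat_of_poly q \<in> ring_at v - ?m" by (auto simp: ring_at_props)
    have "rat_of_poly p = h * rat_of_poly q" using pq q unfolding unit_iff by simp
    then have "rat_of_poly p \<in> ?m" using h q L.nonunits_closed(4) by auto
    then have "peval p v = 0" by (simp add: ring_at_props)
    moreover obtain g where "p - cpoly_const (peval p v) = (\<Sum>j\<in>UNIV. g j * ?y j)" using poly_taylor_first_order by blast
    ultimately have "p = (\<Sum>j\<in>UNIV. g j * ?y j)" by simp
    then have "rat_of_poly p = (\<Sum>j\<in>UNIV. rat_of_poly (g j) * rat_of_poly (?y j))" by (simp only: rat_of_poly_hom)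
    also have "\<dots> \<in> ideal_span (ring_at v) ?gens"
    proof (intro span(4) span(3))
      show "rat_of_poly (?y j) \<in> ideal_span (ring_at v) ?gens" for j using y_span y0_span by (cases "j = j0") auto
    qed (rule ring_at_props)
    finally have "inverse (rat_of_poly q) * rat_of_poly p \<in> ideal_span (ring_at v) ?gens"
      using q unfolding unit_iff by (intro span(3)) auto
    then show "h \<in> ideal_span (ring_at v) ?gens" using pq(1) by (simp add: divide_inverse mult.commute)
  qed
  with inv show ?thesis unfolding suitable_change_def local_parameters_omitting_def by blast
qed

section \<open>The logarithmic derivative of \<open>x\<^sub>1\<close> along \<open>\<Gamma>\<close>\<close>

context keller_divisor
begin

abbreviation "x1 \<equiv> coord i1"

definition "w = \<phi> p0 ^ m * x1 ^ k"

definition "\<epsilon> j = \<phi> p0 * D j w / w"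

lemma x1_nonzero: "x1 \<noteq> 0"
  unfolding coord_eq rat_of_poly_eq_0_iff by (metis lookup_single_eq lookup_zero zero_neq_one)

lemma w_unit: "w \<in> \<Gamma> - \<mm>"
proof -
  obtain v where v: "v \<in> \<Gamma> - \<mm>" "\<phi> p0 = \<pi> ^ k * v" by (rule ramification)
  obtain t where t: "t \<in> \<Gamma> - \<mm>" "inverse x1 = \<pi> ^ m * t" using x1_order has_order_iff by blast
  then have t0: "t \<noteq> 0" unfolding unit_iff by auto
  have "x1 = inverse (\<pi> ^ m) * inverse t" using t(2) by (metis inverse_inverse_eq inverse_mult_distrib)
  then have "w = v ^ m * inverse t ^ k * (\<pi> ^ (k * m) * inverse (\<pi> ^ m) ^ k)"
    unfolding w_def v(2) by (simp add: power_mult_distrib power_mult)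
  also have "\<pi> ^ (k * m) * inverse (\<pi> ^ m) ^ k = 1"
    using pi_nonzero by (simp add: power_inverse power_mult[symmetric] mult.commute)
  finally show ?thesis using unit_mult unit_power v(1) t(1) unit_inverse by simp
qed

lemma w_nonzero: "w \<noteq> 0"
  using w_unit unfolding unit_iff by blast

text \<open>The function \<open>\<phi> p0\<close> has order \<open>k\<close> and
  \<open>D j w\<close> has a pole of order at most \<open>k - 1\<close>, so exactly one factor \<pi>
  is guaranteed to remain.\<close>

lemma epsilon_nonunit: "\<epsilon> j \<in> \<mm>"
proof -
  obtain v where v: "v \<in> \<Gamma> - \<mm>" "\<phi> p0 = \<pi> ^ k * v" "1 \<le> k" by (rule ramification)
  then obtain k' where k': "k = Suc k'" by (cases k) auto
  have "\<epsilon> j = \<pi> * (v * inverse w * (\<pi> ^ k' * D j w))"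
    by (simp add: \<epsilon>_def v(2) k' divide_inverse)
  moreover have "\<pi> ^ k' * D j w \<in> \<Gamma>" using derivation_order[of w j] w_unit k' by simp
  moreover have "inverse w \<in> \<Gamma>" using w_unit unfolding unit_iff by blast
  ultimately show ?thesis using v(1) pi_nonunit closed(5) nonunits_closed(4) by auto
qed

text \<open>Pure field arithmetic: \<open>d\<close> is the product rule for \<open>z\<close>, with
  \<open>a\<close> and \<open>b\<close> standing for the exponents m and k.\<close>

lemma log_derivative_identity:
  fixes d :: "'a::field"
  assumes "d = a * p ^ j * dp * x ^ Suc i + p ^ Suc j * (b * x ^ i * dx)" "p \<noteq> 0" "x \<noteq> 0" "z = p ^ Suc j * x ^ Suc i"
  shows "b * z * dx / x ^ (Suc i + 1) = p ^ j * (p * d / z - a * dp)"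
proof -
  have "p * d / z = a * dp + b * p * dx / x" using assms(2,3) unfolding assms(1,4) by (simp add: field_simps)
  then show ?thesis using assms(2,3) unfolding assms(4) by (simp add: field_simps)
qed

text \<open>The identity for k p D(x_1)/x_1, multiplied by p^(m-1); on the left p^m is replaced by
  w/x_1^k. In this form no negative power of p occurs, and the right side is regular wherever
  \<open>\<epsilon> j\<close> and the pullbacks are.\<close>

lemma log_derivative_x1:
  "of_nat k * w * D j x1 / x1 ^ (k + 1) = \<phi> p0 ^ (m - 1) * (\<epsilon> j - of_nat m * \<phi> (pdiff j p0))"
proof -
  obtain k' where k': "k = Suc k'" using ramification by (metis One_nat_def Suc_le_D)
  obtain m' where m': "m = Suc m'" using m by (cases m) auto
  have p: "\<phi> p0 \<noteq> 0" using p0_nonzero by simp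
  have "D j w = of_nat m * \<phi> p0 ^ m' * \<phi> (pdiff j p0) * x1 ^ k + \<phi> p0 ^ m * (of_nat k * x1 ^ k' * D j x1)"
    unfolding w_def target_deriv_simps(2,7) target_deriv_pullback[OF keller] by (simp add: m' k')
  then have "D j w = of_nat m * \<phi> p0 ^ m' * \<phi> (pdiff j p0) * x1 ^ Suc k' + \<phi> p0 ^ Suc m' * (of_nat k * x1 ^ k' * D j x1)"
    by (simp only: m' k')
  moreover have "w = \<phi> p0 ^ Suc m' * x1 ^ Suc k'" unfolding w_def by (simp only: m' k')
  ultimately have "of_nat k * w * D j x1 / x1 ^ (Suc k' + 1) = \<phi> p0 ^ m' * (\<phi> p0 * D j w / w - of_nat m * \<phi> (pdiff j p0))"
    by (rule log_derivative_identity[OF _ p x1_nonzero])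
  moreover have "m - 1 = m'" "k + 1 = Suc k' + 1" using m' k' by simp_all
  ultimately show ?thesis unfolding \<epsilon>_def by (simp only:)
qed

lemma log_derivative_x1_direction:
  "of_nat k * w * (\<Sum>j\<in>UNIV. cst (b j) * D j x1) * inverse x1 ^ (k + 1) =
    \<phi> p0 ^ (m - 1) * ((\<Sum>j\<in>UNIV. cst (b j) * \<epsilon> j) - of_nat m * \<phi> (\<Sum>j\<in>UNIV. cpoly_const (b j) * pdiff j p0))"
proof -
  have "of_nat k * w * (\<Sum>j\<in>UNIV. cst (b j) * D j x1) * inverse x1 ^ (k + 1) =
    (\<Sum>j\<in>UNIV. cst (b j) * (of_nat k * w * D j x1 / x1 ^ (k + 1)))"
    by (simp add: sum_distrib_left sum_distrib_right divide_inverse power_inverse mult_ac)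
  also have "\<dots> = (\<Sum>j\<in>UNIV. cst (b j) * (\<phi> p0 ^ (m - 1) * (\<epsilon> j - of_nat m * \<phi> (pdiff j p0))))"
    by (simp only: log_derivative_x1)
  also have "\<dots> = \<phi> p0 ^ (m - 1) * ((\<Sum>j\<in>UNIV. cst (b j) * \<epsilon> j) - of_nat m * \<phi> (\<Sum>j\<in>UNIV. cpoly_const (b j) * pdiff j p0))"
    by (simp add: pullback_hom sum_distrib_left right_diff_distrib sum_subtractf mult_ac)
  finally show ?thesis .
qed

text \<open>Besides the functions in the logarithmic derivative, the products of the coordinates
  with a power of 1/x_1 are made regular. At a point off \<Gamma> where x_1 is regular, multiplying
  back by that power of x_1 shows that all coordinates are regular, so the point lies in
  X_0.\<close>

lemma generic_regularity:
  "\<exists>Q N. Q \<notin> I \<and> (\<forall>e v. point_over F X \<Gamma> v e \<and> peval Q v \<noteq> 0 \<longrightarrow>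
     inverse x1 \<in> e \<and> w \<in> e \<and> inverse w \<in> e \<and> range \<epsilon> \<subseteq> e \<and> range (\<lambda>i. coord i * inverse x1 ^ N) \<subseteq> e \<and>
     peval (pdiff j0 p0) v \<noteq> 0)"
proof -
  obtain t where t: "t \<in> \<Gamma> - \<mm>" "inverse x1 = \<pi> ^ m * t" using x1_order has_order_iff by blast
  have t\<Gamma>: "inverse x1 \<in> \<Gamma>" using t pi_in closed(5) by auto
  obtain N where N: "\<forall>h\<in>range coord. \<pi> ^ N * h \<in> \<Gamma>" using pole_order_finite[of "range coord"] by auto
  have "coord i * inverse x1 ^ N \<in> \<Gamma>" for i
  proof -
    \<comment> \<open>The order of 1/x_1 is at least 1, so its N-th power contains \<pi>^N and
      cancels poles of order up to N.\<close>
    obtain m' where m': "m = Suc m'" using m by (cases m) auto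
    have "inverse x1 ^ N = \<pi> ^ N * \<pi> ^ (m' * N) * t ^ N"
      unfolding t(2) m' by (simp add: power_mult_distrib power_mult)
    then have "coord i * inverse x1 ^ N = (\<pi> ^ N * coord i) * (\<pi> ^ (m' * N) * t ^ N)"
      by (simp only: mult_ac)
    moreover have "\<pi> ^ N * coord i \<in> \<Gamma>" using N by simp
    moreover have "\<pi> ^ (m' * N) * t ^ N \<in> \<Gamma>" using t(1) pi_in(2) closed(5,8) by blast
    ultimately show ?thesis using closed(5) by metis
  qed
  then have H: "{inverse x1, w, inverse w} \<union> range \<epsilon> \<union> range (\<lambda>i. coord i * inverse x1 ^ N) \<subseteq> \<Gamma>"
    using t\<Gamma> w_unit epsilon_nonunit nonunits_closed(8) unfolding unit_iff by blast
  have "finite ({inverse x1, w, inverse w} \<union> range \<epsilon> \<union> range (\<lambda>i. coord i * inverse x1 ^ N))" by simp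
  from regular_generically_finite_set[OF this H]
  obtain c where c: "c \<notin> I" "\<forall>e v. point_over F X \<Gamma> v e \<and> peval c v \<noteq> 0 \<longrightarrow>
     {inverse x1, w, inverse w} \<union> range \<epsilon> \<union> range (\<lambda>i. coord i * inverse x1 ^ N) \<subseteq> e" by blast
  have "c * pdiff j0 p0 \<notin> I" using c(1) p0(2) by (simp add: I_mult_iff)
  then show ?thesis
    using c(2) by (intro exI[of _ "c * pdiff j0 p0"] exI[of _ N]) (simp add: peval_hom, blast)
qed

end

section \<open>Multivariate power series in one distinguished coordinate\<close>

lemma has_sum_split_coordinate:
  fixes c :: "('n::finite \<Rightarrow> nat) \<Rightarrow> complex" and z :: "'n \<Rightarrow> complex"
  shows "((\<lambda>\<alpha>. c \<alpha> * (\<Prod>i\<in>UNIV. z i ^ \<alpha> i)) has_sum s) UNIV \<longleftrightarrow>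
    ((\<lambda>(j, \<alpha>). c (\<alpha>(l := j)) * z l ^ j * (\<Prod>i\<in>UNIV - {l}. z i ^ \<alpha> i)) has_sum s) (UNIV \<times> {\<alpha>. \<alpha> l = 0})"
proof (rule has_sum_reindex_bij_witness[where i = "\<lambda>(j, \<alpha>). \<alpha>(l := j)" and j = "\<lambda>\<alpha>. (\<alpha> l, \<alpha>(l := 0))"])
  fix \<alpha> :: "'n \<Rightarrow> nat"
  have "(\<Prod>i\<in>UNIV. z i ^ \<alpha> i) = z l ^ \<alpha> l * (\<Prod>i\<in>UNIV - {l}. z i ^ \<alpha> i)" by (rule prod.remove) auto
  also have "(\<Prod>i\<in>UNIV - {l}. z i ^ \<alpha> i) = (\<Prod>i\<in>UNIV - {l}. z i ^ (\<alpha>(l := 0)) i)" by (rule prod.cong) auto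
  finally show "(case (\<alpha> l, \<alpha>(l := 0)) of (j, \<alpha>) \<Rightarrow> c (\<alpha>(l := j)) * z l ^ j * (\<Prod>i\<in>UNIV - {l}. z i ^ \<alpha> i)) =
      c \<alpha> * (\<Prod>i\<in>UNIV. z i ^ \<alpha> i)" by simp
qed auto

text \<open>At fixed remaining coordinates, the coefficient of the \<open>j\<close>-th power of
  coordinate \<open>l\<close>. As \<open>infsum\<close> is 0 for a divergent family, the value is
  meaningful only together with \<open>coordinate_coeff_has_sum\<close>.\<close>

definition coordinate_coeff :: "(('n::finite \<Rightarrow> nat) \<Rightarrow> complex) \<Rightarrow> 'n \<Rightarrow> ('n \<Rightarrow> complex) \<Rightarrow> nat \<Rightarrow> complex" where
  "coordinate_coeff c l z j = infsum (\<lambda>\<alpha>. c (\<alpha>(l := j)) * (\<Prod>i\<in>UNIV - {l}. z i ^ \<alpha> i)) {\<alpha>. \<alpha> l = 0}"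

lemma coordinate_coeff_has_sum:
  fixes c :: "('n::finite \<Rightarrow> nat) \<Rightarrow> complex"
  assumes "((\<lambda>\<alpha>. c \<alpha> * (\<Prod>i\<in>UNIV. (z(l := t)) i ^ \<alpha> i)) has_sum s) UNIV" "t \<noteq> 0"
  shows "((\<lambda>\<alpha>. c (\<alpha>(l := j)) * (\<Prod>i\<in>UNIV - {l}. z i ^ \<alpha> i)) has_sum coordinate_coeff c l z j) {\<alpha>. \<alpha> l = 0}"
proof -
  let ?M = "\<lambda>\<alpha>. \<Prod>i\<in>UNIV - {l}. z i ^ \<alpha> i"
  have e: "(\<Prod>i\<in>UNIV - {l}. (z(l := t)) i ^ \<alpha> i) = ?M \<alpha>" for \<alpha> :: "'n \<Rightarrow> nat" by (rule prod.cong) auto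
  have "((\<lambda>(j, \<alpha>). c (\<alpha>(l := j)) * t ^ j * ?M \<alpha>) has_sum s) (UNIV \<times> {\<alpha>. \<alpha> l = 0})"
    using assms(1) unfolding has_sum_split_coordinate[of c "z(l := t)" s l] e by simp
  then have "(\<lambda>(j, \<alpha>). c (\<alpha>(l := j)) * t ^ j * ?M \<alpha>) summable_on (UNIV \<times> {\<alpha>. \<alpha> l = 0})"
    by (rule has_sum_imp_summable)
  then have "(\<lambda>\<alpha>. c (\<alpha>(l := j)) * t ^ j * ?M \<alpha>) summable_on {\<alpha>. \<alpha> l = 0}"
    by (rule summable_on_SigmaD1) simp
  then have "(\<lambda>\<alpha>. inverse (t ^ j) * (c (\<alpha>(l := j)) * t ^ j * ?M \<alpha>)) summable_on {\<alpha>. \<alpha> l = 0}"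
    by (rule summable_on_cmult_right)
  then have "(\<lambda>\<alpha>. c (\<alpha>(l := j)) * ?M \<alpha>) summable_on {\<alpha>. \<alpha> l = 0}"
    using assms(2) by (simp add: field_simps)
  then show ?thesis unfolding coordinate_coeff_def by (rule has_sum_infsum)
qed

lemma power_series_in_coordinate:
  fixes c :: "('n::finite \<Rightarrow> nat) \<Rightarrow> complex"
  assumes r: "0 < r" and f: "\<And>t. norm t < r \<Longrightarrow> ((\<lambda>\<alpha>. c \<alpha> * (\<Prod>i\<in>UNIV. (z(l := t)) i ^ \<alpha> i)) has_sum f t) UNIV"
    and t: "norm t < r"
  shows "(\<lambda>j. coordinate_coeff c l z j * t ^ j) sums f t"
proof (rule has_sum_imp_sums)
  let ?M = "\<lambda>\<alpha>. \<Prod>i\<in>UNIV - {l}. z i ^ \<alpha> i"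
  \<comment> \<open>The coefficients do not depend on \<open>t\<close>, but extracting them divides
    by a power of the parameter. They are computed at r/2, so that the given \<open>t\<close> may be
    0.\<close>
  have t0: "norm (of_real (r / 2) :: complex) < r" "of_real (r / 2) \<noteq> (0::complex)" using r by auto
  note cc = coordinate_coeff_has_sum[OF f[OF t0(1)] t0(2)]
  have e: "(\<Prod>i\<in>UNIV - {l}. (z(l := t)) i ^ \<alpha> i) = ?M \<alpha>" for \<alpha> :: "'n \<Rightarrow> nat" by (rule prod.cong) auto
  have "((\<lambda>(j, \<alpha>). c (\<alpha>(l := j)) * t ^ j * ?M \<alpha>) has_sum f t) (UNIV \<times> {\<alpha>. \<alpha> l = 0})"
    using f[OF t] unfolding has_sum_split_coordinate[of c "z(l := t)" _ l] e by simp
  then show "((\<lambda>j. coordinate_coeff c l z j * t ^ j) has_sum f t) UNIV"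
  proof (rule has_sum_SigmaD)
    fix j
    have "((\<lambda>\<alpha>. t ^ j * (c (\<alpha>(l := j)) * ?M \<alpha>)) has_sum (t ^ j * coordinate_coeff c l z j)) {\<alpha>. \<alpha> l = 0}"
      by (rule has_sum_cmult_right[OF cc])
    then show "((\<lambda>\<alpha>. case (j, \<alpha>) of (j, \<alpha>) \<Rightarrow> c (\<alpha>(l := j)) * t ^ j * ?M \<alpha>) has_sum
        coordinate_coeff c l z j * t ^ j) {\<alpha>. \<alpha> l = 0}"
      by (simp add: mult_ac)
  qed
qed

section \<open>Coefficients of a power series read off from its size\<close>

lemma power_series_shift_limit:
  fixes a :: "nat \<Rightarrow> complex"
  assumes r: "0 < r" and f: "\<And>t. t \<noteq> 0 \<Longrightarrow> norm t < r \<Longrightarrow> (\<lambda>j. a j * t ^ j) sums f t" and z: "\<And>i. i < N \<Longrightarrow> a i = 0"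
  shows "((\<lambda>t. f t / t ^ N) \<longlongrightarrow> a N) (at 0)"
proof -
  have "(\<lambda>j. a (j + N) * t ^ j) sums (f t / t ^ N)" if t: "t \<noteq> 0" "norm t < r" for t
  proof -
    have "(\<lambda>j. a (j + N) * t ^ (j + N)) sums f t"
      using sums_zero_iff_shift[of N "\<lambda>j. a j * t ^ j" "f t"] z f[OF t] by simp
    then have "(\<lambda>j. a (j + N) * t ^ (j + N) / t ^ N) sums (f t / t ^ N)" by (rule sums_divide)
    then show ?thesis using t(1) by (simp add: power_add)
  qed
  from powser_limit_0_strong[OF r this] show ?thesis by simp
qed

text \<open>Once the earlier coefficients are known to vanish, f(t)/t^j tends to \<open>a j\<close>,
  while the bound makes it O(t^(N-j)).\<close>

lemma low_order_coeffs_vanish: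
  fixes a :: "nat \<Rightarrow> complex"
  assumes r: "0 < r" and f: "\<And>t. t \<noteq> 0 \<Longrightarrow> norm t < r \<Longrightarrow> (\<lambda>j. a j * t ^ j) sums f t"
    and bound: "\<And>t. t \<noteq> 0 \<Longrightarrow> norm t < r \<Longrightarrow> norm (f t) \<le> C * norm t ^ N"
    and "j < N"
  shows "a j = 0"
  using \<open>j < N\<close>
proof (induction j rule: less_induct)
  case (less j)
  have lim: "((\<lambda>t. f t / t ^ j) \<longlongrightarrow> a j) (at 0)"
    using less by (intro power_series_shift_limit[OF r f]) auto
  have "((\<lambda>t :: complex. C * norm t ^ (N - j)) \<longlongrightarrow> C * norm (0::complex) ^ (N - j)) (at 0)" by (intro tendsto_intros)
  moreover have "C * norm (0::complex) ^ (N - j) = 0" using less.prems by simp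
  ultimately have "((\<lambda>t :: complex. C * norm t ^ (N - j)) \<longlongrightarrow> 0) (at 0)" by (simp only:)
  moreover have "\<forall>\<^sub>F t in at 0. norm (f t / t ^ j) \<le> C * norm t ^ (N - j)"
    unfolding eventually_at
  proof (intro exI[of _ r] conjI ballI impI r)
    fix t :: complex assume t: "t \<noteq> 0 \<and> dist t 0 < r"
    have "norm (f t) \<le> C * (norm t ^ (N - j) * norm t ^ j)"
      using bound[of t] t less.prems by (simp add: power_add[symmetric])
    then show "norm (f t / t ^ j) \<le> C * norm t ^ (N - j)"
      using t by (simp add: norm_divide norm_power divide_le_eq mult.assoc)
  qed
  ultimately have "((\<lambda>t. f t / t ^ j) \<longlongrightarrow> 0) (at 0)" by (rule Lim_null_comparison[rotated])
  with lim show "a j = 0" by (metis LIM_unique)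
qed

lemma leading_coeff_nonzero:
  fixes a :: "nat \<Rightarrow> complex"
  assumes r: "0 < r" and f: "\<And>t. t \<noteq> 0 \<Longrightarrow> norm t < r \<Longrightarrow> (\<lambda>j. a j * t ^ j) sums f t"
    and z: "\<And>i. i < N \<Longrightarrow> a i = 0" and "0 < B"
    and bound: "\<And>t. t \<noteq> 0 \<Longrightarrow> norm t < r \<Longrightarrow> B * norm t ^ N \<le> norm (f t)"
  shows "a N \<noteq> 0"
proof
  assume "a N = 0"
  then have "((\<lambda>t. f t / t ^ N) \<longlongrightarrow> 0) (at 0)" using power_series_shift_limit[OF r f z, of N] by simp
  then have "\<forall>\<^sub>F t in at 0. norm (f t / t ^ N) < B" using \<open>0 < B\<close> by (simp add: tendsto_iff)
  then obtain d where d: "0 < d" "\<And>t. t \<noteq> 0 \<Longrightarrow> norm t < d \<Longrightarrow> norm (f t / t ^ N) < B"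
    unfolding eventually_at by auto
  define t :: complex where "t = of_real (min d r / 2)"
  have t: "t \<noteq> 0" "norm t < d" "norm t < r" using d(1) r by (auto simp: t_def)
  have "B \<le> norm (f t / t ^ N)" using bound[OF t(1,3)] t(1) by (simp add: norm_divide norm_power le_divide_eq)
  with d(2)[OF t(1,2)] show False by simp
qed

text \<open>For fixed remaining coordinates the slices with exponent below \<open>N\<close> each sum
  to 0, so the whole strip can be removed without changing the total. The individual coefficients in
  the strip are never shown to vanish; summing slice by slice is enough.\<close>

lemma has_sum_divide_coordinate_power:
  fixes c :: "('n::finite \<Rightarrow> nat) \<Rightarrow> complex"
  assumes r: "0 < r" and f: "\<And>t. norm t < r \<Longrightarrow> ((\<lambda>\<alpha>. c \<alpha> * (\<Prod>i\<in>UNIV. (z(l := t)) i ^ \<alpha> i)) has_sum f t) UNIV"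
    and bound: "\<And>t. t \<noteq> 0 \<Longrightarrow> norm t < r \<Longrightarrow> norm (f t) \<le> C * norm t ^ N"
    and t: "t \<noteq> 0" "norm t < r"
  shows "((\<lambda>(j, \<alpha>). c (\<alpha>(l := j + N)) * t ^ j * (\<Prod>i\<in>UNIV - {l}. z i ^ \<alpha> i)) has_sum (f t / t ^ N))
    (UNIV \<times> {\<alpha>. \<alpha> l = 0})"
proof -
  let ?M = "\<lambda>\<alpha>. \<Prod>i\<in>UNIV - {l}. z i ^ \<alpha> i" and ?A = "{\<alpha> :: 'n \<Rightarrow> nat. \<alpha> l = 0}"
  let ?g = "\<lambda>(j, \<alpha>). c (\<alpha>(l := j)) * t ^ j * ?M \<alpha>"
  have e: "(\<Prod>i\<in>UNIV - {l}. (z(l := t)) i ^ \<alpha> i) = ?M \<alpha>" for \<alpha> :: "'n \<Rightarrow> nat" by (rule prod.cong) auto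
  have all: "(?g has_sum f t) (UNIV \<times> ?A)"
    using f[OF t(2)] unfolding has_sum_split_coordinate[of c "z(l := t)" _ l] e by simp
  note cc = coordinate_coeff_has_sum[OF f[OF t(2)] t(1)]
  have zero: "coordinate_coeff c l z j = 0" if "j < N" for j
    by (rule low_order_coeffs_vanish[OF r power_series_in_coordinate[OF r f] bound that])
  have low: "(?g has_sum 0) ({..<N} \<times> ?A)"
  proof -
    have "?g summable_on ({..<N} \<times> ?A)"
      by (rule summable_on_subset_banach[OF has_sum_imp_summable[OF all]]) auto
    then have s: "(?g has_sum infsum ?g ({..<N} \<times> ?A)) ({..<N} \<times> ?A)" by (rule has_sum_infsum)
    then have "((\<lambda>j. 0) has_sum infsum ?g ({..<N} \<times> ?A)) {..<N}"
    proof (rule has_sum_SigmaD)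
      fix j assume "j \<in> {..<N}"
      then have "((\<lambda>\<alpha>. t ^ j * (c (\<alpha>(l := j)) * ?M \<alpha>)) has_sum (t ^ j * 0)) ?A"
        using has_sum_cmult_right[OF cc[of j], of "t ^ j"] zero[of j] by simp
      then show "((\<lambda>\<alpha>. ?g (j, \<alpha>)) has_sum 0) ?A" by (simp add: mult_ac)
    qed
    then have "infsum ?g ({..<N} \<times> ?A) = 0" by (simp add: has_sum_finite_iff)
    with s show ?thesis by simp
  qed
  have "(?g has_sum (f t - 0)) (UNIV \<times> ?A - {..<N} \<times> ?A)" by (rule has_sum_Diff[OF all low]) auto
  moreover have "UNIV \<times> ?A - {..<N} \<times> ?A = {N..} \<times> ?A" by auto
  ultimately have "(?g has_sum f t) ({N..} \<times> ?A)" by simp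
  then have "((\<lambda>x. inverse (t ^ N) * ?g x) has_sum (inverse (t ^ N) * f t)) ({N..} \<times> ?A)"
    by (rule has_sum_cmult_right)
  moreover have "((\<lambda>x. inverse (t ^ N) * ?g x) has_sum (inverse (t ^ N) * f t)) ({N..} \<times> ?A) \<longleftrightarrow>
    ((\<lambda>(j, \<alpha>). c (\<alpha>(l := j + N)) * t ^ j * ?M \<alpha>) has_sum (f t / t ^ N)) (UNIV \<times> ?A)"
  proof (rule has_sum_reindex_bij_witness[where i = "\<lambda>(j, \<alpha>). (j + N, \<alpha>)" and j = "\<lambda>(j, \<alpha>). (j - N, \<alpha>)"])
    fix x assume "x \<in> {N..} \<times> ?A"
    then obtain j \<alpha> where x: "x = (j, \<alpha>)" "N \<le> j" by auto
    have tj: "t ^ j = t ^ N * t ^ (j - N)" using x(2) by (simp add: power_add[symmetric])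
    have eq: "inverse (t ^ N) * ?g x = c (\<alpha>(l := j)) * t ^ (j - N) * ?M \<alpha>"
      unfolding x(1) prod.case tj using t(1) by simp
    show "(case case x of (j, \<alpha>) \<Rightarrow> (j - N, \<alpha>) of (j, \<alpha>) \<Rightarrow> c (\<alpha>(l := j + N)) * t ^ j * ?M \<alpha>) = inverse (t ^ N) * ?g x"
      by (simp only: eq) (simp only: x(1) prod.case le_add_diff_inverse2[OF x(2)])
  next
    show "inverse (t ^ N) * f t = f t / t ^ N" by (simp add: divide_inverse)
  qed auto
  ultimately show ?thesis by blast
qed

text \<open>Complex summable families are absolutely summable. The point is to measure how far a
  power series is from its constant term by means of its terms at one other point, where it is known
  to converge.\<close>

lemma has_sum_dominated_tail:
  fixes f g :: "'a \<Rightarrow> complex"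
  assumes f: "(f has_sum s) A" and g: "g summable_on A" and "i \<in> A" and "0 \<le> \<rho>"
    and bound: "\<And>x. x \<in> A - {i} \<Longrightarrow> norm (f x) \<le> \<rho> * norm (g x)"
  shows "norm (s - f i) \<le> \<rho> * infsum (\<lambda>x. norm (g x)) A"
proof -
  have "(f has_sum f i) {i}" by (simp add: has_sum_finite_iff)
  then have fd: "(f has_sum (s - f i)) (A - {i})" using f \<open>i \<in> A\<close> by (intro has_sum_Diff) auto
  have abs: "(\<lambda>x. norm (g x)) summable_on A" using g summable_on_iff_abs_summable_on_complex by blast
  have abs': "(\<lambda>x. norm (g x)) summable_on (A - {i})"
    by (rule summable_on_subset_banach[OF abs]) auto
  have "norm (s - f i) \<le> \<rho> * infsum (\<lambda>x. norm (g x)) (A - {i})"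
    by (rule norm_infsum_le[OF fd has_sum_cmult_right[OF has_sum_infsum[OF abs']]]) (rule bound)
  also have "\<dots> \<le> \<rho> * infsum (\<lambda>x. norm (g x)) A"
    using \<open>0 \<le> \<rho>\<close> abs abs' by (intro mult_left_mono infsum_mono2) auto
  finally show ?thesis .
qed

text \<open>Shrinking all coordinates by \<rho> multiplies a monomial by a power of \<rho> equal to
  its degree; nonconstant monomials gain at least one factor, and \<rho> is at most 1.\<close>

lemma monomial_contraction:
  fixes y y0 :: "'n::finite \<Rightarrow> complex"
  assumes \<rho>: "0 \<le> \<rho>" "\<rho> \<le> 1" and t: "norm t \<le> \<rho> * norm t0" and y: "\<And>i. i \<in> S \<Longrightarrow> norm (y i) \<le> \<rho> * norm (y0 i)"
    and nontrivial: "j \<noteq> 0 \<or> (\<exists>i\<in>S. \<alpha> i \<noteq> (0::nat))"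
  shows "norm (t ^ j * (\<Prod>i\<in>S. y i ^ \<alpha> i)) \<le> \<rho> * norm (t0 ^ j * (\<Prod>i\<in>S. y0 i ^ \<alpha> i))"
proof -
  have "norm (t ^ j * (\<Prod>i\<in>S. y i ^ \<alpha> i)) = norm t ^ j * (\<Prod>i\<in>S. norm (y i) ^ \<alpha> i)"
    by (simp add: norm_mult norm_power prod_norm[symmetric])
  also have "\<dots> \<le> (\<rho> * norm t0) ^ j * (\<Prod>i\<in>S. (\<rho> * norm (y0 i)) ^ \<alpha> i)"
    using t y \<rho> by (intro mult_mono power_mono prod_mono prod_nonneg) (auto intro!: power_mono)
  also have "\<dots> = \<rho> ^ (j + sum \<alpha> S) * (norm t0 ^ j * (\<Prod>i\<in>S. norm (y0 i) ^ \<alpha> i))"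
    by (simp add: power_mult_distrib prod.distrib power_add power_sum mult_ac)
  also have "\<dots> \<le> \<rho> * (norm t0 ^ j * (\<Prod>i\<in>S. norm (y0 i) ^ \<alpha> i))"
  proof (intro mult_right_mono)
    have "finite S" by (rule finite)
    then have "1 \<le> j + sum \<alpha> S" using nontrivial by (cases "j = 0") (auto simp: Suc_le_eq sum_eq_0_iff neq0_conv[symmetric] simp del: neq0_conv)
    from power_decreasing[OF this \<rho>] show "\<rho> ^ (j + sum \<alpha> S) \<le> \<rho>" by simp
  qed (auto intro!: mult_nonneg_nonneg prod_nonneg)
  also have "norm t0 ^ j * (\<Prod>i\<in>S. norm (y0 i) ^ \<alpha> i) = norm (t0 ^ j * (\<Prod>i\<in>S. y0 i ^ \<alpha> i))"
    by (simp add: norm_mult norm_power prod_norm[symmetric])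
  finally show ?thesis .
qed

text \<open>Hurwitz: a zero of \<open>Y 0\<close> is a limit of zeros of \<open>Y t\<close> as \<open>t \<rightarrow> 0\<close>.\<close>

lemma zeros_persist:
  fixes Y :: "complex \<Rightarrow> complex \<Rightarrow> complex"
  assumes \<delta>: "0 < \<delta>" and cont: "continuous_on (ball 0 \<delta> \<times> ball 0 \<delta>) (\<lambda>(t, r). Y t r)"
    and hol: "\<And>t. norm t < \<delta> \<Longrightarrow> Y t holomorphic_on ball 0 \<delta>"
    and zero: "Y 0 0 = 0" "\<And>r. r \<noteq> 0 \<Longrightarrow> norm r < \<delta> \<Longrightarrow> Y 0 r \<noteq> 0" and \<eta>: "0 < \<eta>"
  shows "\<exists>t r. t \<noteq> 0 \<and> norm t < \<eta> \<and> norm r < \<eta> \<and> Y t r = 0"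
proof (rule ccontr)
  assume none: "\<not> ?thesis"
  define \<rho> where "\<rho> = min \<delta> \<eta>"
  have \<rho>: "0 < \<rho>" "\<rho> \<le> \<delta>" "\<rho> \<le> \<eta>" using \<delta> \<eta> by (auto simp: \<rho>_def)
  \<comment> \<open>Nonzero parameters tending to 0. They stay in the closed ball of radius
    \<rho>/2, on which compactness turns joint continuity into uniform convergence of
    \<open>Y (T n)\<close> to \<open>Y 0\<close>.\<close>
  define T :: "nat \<Rightarrow> complex" where "T n = of_real (\<rho> / real (n + 2))" for n
  have T: "T n \<noteq> 0" "norm (T n) \<le> \<rho> / 2" for n
    using \<rho> by (auto simp: T_def norm_divide divide_simps simp del: of_real_divide)
  have Tlim: "T \<longlonglongrightarrow> 0"
  proof -
    have "(\<lambda>n. \<rho> / real (n + 2)) \<longlonglongrightarrow> 0" by real_asymp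
    then show ?thesis unfolding T_def using tendsto_of_real[where ?'a = complex] by (metis of_real_0)
  qed
  have "Y 0 0 \<noteq> 0"
  proof (rule Hurwitz_no_zeros[of "ball 0 \<rho>" "\<lambda>n. Y (T n)" "Y 0" 0])
    show "Y (T n) holomorphic_on ball 0 \<rho>" for n
      using T(2)[of n] \<rho> by (intro holomorphic_on_subset[OF hol]) auto
    show "Y 0 holomorphic_on ball 0 \<rho>" using \<rho> \<delta> by (intro holomorphic_on_subset[OF hol]) auto
    show "Y (T n) z \<noteq> 0" if "z \<in> ball 0 \<rho>" for n z
    proof
      assume "Y (T n) z = 0"
      moreover have "norm (T n) < \<eta>" "norm z < \<eta>" using T(2)[of n] that \<rho> by auto
      ultimately show False using none T(1) by blast
    qed
    show "\<not> Y 0 constant_on ball 0 \<rho>"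
    proof
      assume "Y 0 constant_on ball 0 \<rho>"
      then obtain c where c: "\<forall>z\<in>ball 0 \<rho>. Y 0 z = c" by (auto simp: constant_on_def)
      have "Y 0 (of_real (\<rho> / 2)) = Y 0 0" using c \<rho> by simp
      moreover have "Y 0 (of_real (\<rho> / 2)) \<noteq> 0" using \<rho> by (intro zero) auto
      ultimately show False using zero(1) by simp
    qed
    show "uniform_limit K (\<lambda>n. Y (T n)) (Y 0) sequentially" if K: "compact K" "K \<subseteq> ball 0 \<rho>" for K
    proof -
      have cpt: "compact (cball (0::complex) (\<rho> / 2) \<times> K)" using K by (intro compact_Times) auto
      have "continuous_on (cball (0::complex) (\<rho> / 2) \<times> K) (\<lambda>(t, r). Y t r)"
        using K \<rho> by (intro continuous_on_subset[OF cont]) auto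
      then have uc: "uniformly_continuous_on (cball (0::complex) (\<rho> / 2) \<times> K) (\<lambda>(t, r). Y t r)"
        by (rule compact_uniformly_continuous[OF _ cpt])
      show ?thesis
        unfolding uniform_limit_iff
      proof (intro allI impI)
        fix e :: real assume "0 < e"
        then obtain d where d: "0 < d" "\<And>x x'. x \<in> cball 0 (\<rho> / 2) \<times> K \<Longrightarrow> x' \<in> cball 0 (\<rho> / 2) \<times> K \<Longrightarrow>
            dist x' x < d \<Longrightarrow> dist ((\<lambda>(t, r). Y t r) x') ((\<lambda>(t, r). Y t r) x) < e"
          using uc unfolding uniformly_continuous_on_def by metis
        have "\<forall>\<^sub>F n in sequentially. dist (T n) 0 < d" using Tlim d(1) by (simp add: tendsto_iff)
        then show "\<forall>\<^sub>F n in sequentially. \<forall>z\<in>K. dist (Y (T n) z) (Y 0 z) < e"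
        proof eventually_elim
          case (elim n)
          show ?case
          proof
            fix z assume "z \<in> K"
            then show "dist (Y (T n) z) (Y 0 z) < e"
              using d(2)[of "(0, z)" "(T n, z)"] elim T(2)[of n] \<rho> by (auto simp: dist_Pair_Pair)
          qed
        qed
      qed
    qed
  qed (use \<rho> in auto)
  with zero(1) show False by simp
qed

section \<open>Keller maps as local homeomorphisms\<close>

text \<open>A Hadamard factorization: secant slopes that depend continuously on both endpoints and
  restrict to the partial derivatives on the diagonal. Local injectivity and differentiability of
  lifts both follow from it by linear algebra.\<close>

lemma poly_secant:
  fixes p :: "'n::finite cpoly"
  shows "\<exists>M :: 'n \<Rightarrow> 'n cspace \<times> 'n cspace \<Rightarrow> complex. (\<forall>k. continuous_on UNIV (M k)) \<and>
    (\<forall>x y. peval p x - peval p y = (\<Sum>k\<in>UNIV. M k (x, y) * (x $ k - y $ k))) \<and>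
    (\<forall>k x. M k (x, x) = peval (pdiff k p) x)"
proof (induction p rule: cpoly_induct)
  case (const c)
  show ?case by (intro exI[of _ "\<lambda>_ _. 0"]) (simp add: peval_hom)
next
  case (var i)
  have "(\<Sum>k\<in>UNIV. (if k = i then 1 else 0) * (x $ k - y $ k)) = (\<Sum>k\<in>UNIV. if k = i then x $ k - y $ k else 0)"
    for x y :: "'n cspace" by (rule sum.cong) auto
  then show ?case by (intro exI[of _ "\<lambda>k _. if k = i then 1 else 0"]) (auto simp: peval_hom)
next
  case (add p q)
  then obtain M N where *: "\<forall>k. continuous_on UNIV (M k)" "\<forall>k. continuous_on UNIV (N k)"
    "\<forall>x y. peval p x - peval p y = (\<Sum>k\<in>UNIV. M k (x, y) * (x $ k - y $ k))"
    "\<forall>x y. peval q x - peval q y = (\<Sum>k\<in>UNIV. N k (x, y) * (x $ k - y $ k))"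
    "\<forall>k x. M k (x, x) = peval (pdiff k p) x" "\<forall>k x. N k (x, x) = peval (pdiff k q) x"
    by (elim exE conjE) (rule that)
  have "peval (p + q) x - peval (p + q) y = (peval p x - peval p y) + (peval q x - peval q y)" for x y
    by (simp add: peval_hom)
  then have "peval (p + q) x - peval (p + q) y = (\<Sum>k\<in>UNIV. (M k (x, y) + N k (x, y)) * (x $ k - y $ k))" for x y
    unfolding *(3)[rule_format] *(4)[rule_format] by (simp only: distrib_right sum.distrib)
  then show ?case using *(1,2,5,6)
    by (intro exI[of _ "\<lambda>k z. M k z + N k z"]) (auto simp: peval_hom pdiff_add intro!: continuous_intros)
next
  case (mult p q)
  then obtain M N where *: "\<forall>k. continuous_on UNIV (M k)" "\<forall>k. continuous_on UNIV (N k)"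
    "\<forall>x y. peval p x - peval p y = (\<Sum>k\<in>UNIV. M k (x, y) * (x $ k - y $ k))"
    "\<forall>x y. peval q x - peval q y = (\<Sum>k\<in>UNIV. N k (x, y) * (x $ k - y $ k))"
    "\<forall>k x. M k (x, x) = peval (pdiff k p) x" "\<forall>k x. N k (x, x) = peval (pdiff k q) x"
    by (elim exE conjE) (rule that)
  obtain Mp where Mp: "\<forall>k. continuous_on UNIV (Mp k)"
    "\<forall>x y. peval p x - peval p y = (\<Sum>k\<in>UNIV. Mp k (x, y) * (x $ k - y $ k))" using *(1,3) by blast
  have cont: "continuous_on UNIV (\<lambda>z. peval r (fst z :: 'n cspace))" "continuous_on UNIV (\<lambda>z. peval r (snd z :: 'n cspace))"
    for r :: "'n cpoly" unfolding peval_def poly_subst_def by (intro continuous_intros)+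
  have "peval (p * q) x - peval (p * q) y = (peval p x - peval p y) * peval q x + peval p y * (peval q x - peval q y)" for x y
    by (simp add: peval_hom algebra_simps)
  then have "peval (p * q) x - peval (p * q) y =
      (\<Sum>k\<in>UNIV. (M k (x, y) * peval q x + peval p y * N k (x, y)) * (x $ k - y $ k))" for x y
    unfolding *(3)[rule_format] *(4)[rule_format] sum_distrib_left sum_distrib_right sum.distrib[symmetric]
    by (simp add: algebra_simps)
  then show ?case using *(1,2,5,6) cont
    by (intro exI[of _ "\<lambda>k z. M k z * peval q (fst z) + peval p (snd z) * N k z"])
      (auto simp: peval_hom pdiff_mult intro!: continuous_intros)
qed

lemma poly_map_secant_matrix:
  fixes F :: "'n::finite \<Rightarrow> 'n cpoly"
  shows "\<exists>M :: 'n cspace \<times> 'n cspace \<Rightarrow> 'n cmatrix. (\<forall>i k. continuous_on UNIV (\<lambda>z. M z $ i $ k)) \<and>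
    (\<forall>x y. M (x, y) *v (x - y) = poly_map F x - poly_map F y) \<and>
    (\<forall>x i k. M (x, x) $ i $ k = peval (pdiff k (F i)) x)"
proof -
  obtain M where M: "\<And>i. (\<forall>k. continuous_on UNIV (M i k)) \<and>
    (\<forall>x y. peval (F i) x - peval (F i) y = (\<Sum>k\<in>UNIV. M i k (x, y) * (x $ k - y $ k))) \<and>
    (\<forall>k x. M i k (x, x) = peval (pdiff k (F i)) x)"
    using choice[of "\<lambda>i M. (\<forall>k. continuous_on UNIV (M k)) \<and>
    (\<forall>x y. peval (F i) x - peval (F i) y = (\<Sum>k\<in>UNIV. M k (x, y) * (x $ k - y $ k))) \<and>
    (\<forall>k x. M k (x, x) = peval (pdiff k (F i)) x)"] poly_secant by blast
  show ?thesis
    by (intro exI[of _ "\<lambda>z. \<chi> i k. M i k z"])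
      (use M in \<open>auto simp: vec_eq_iff matrix_vector_mult_def poly_map_def\<close>)
qed

lemma isCont_det:
  fixes M :: "'a::t2_space \<Rightarrow> ('b::{comm_ring_1,real_normed_algebra_1} , 'n::finite) vec ^ 'n"
  assumes "\<And>i k. isCont (\<lambda>z. M z $ i $ k) a"
  shows "isCont (\<lambda>z. det (M z)) a"
  unfolding det_def by (intro continuous_intros assms)

lemma keller_map_jacobian:
  assumes "keller_map F"
  shows "det (\<chi> i k. peval (pdiff k (F i)) x) = 1"
  using assms det_ring_hom[OF ring_hom_peval, of "\<chi> i k. pdiff k (F i)" x]
  by (simp add: keller_map_def peval_hom)

text \<open>The secant matrix has determinant 1 on the diagonal, so it is invertible for nearby
  pairs; two points with the same image differ by a vector in its kernel.\<close>

lemma keller_map_locally_injective: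
  fixes F :: "'n::{finite,linorder} \<Rightarrow> 'n cpoly"
  assumes "keller_map F"
  shows "\<exists>r>0. inj_on (poly_map F) (ball a r)"
proof -
  obtain M :: "'n cspace \<times> 'n cspace \<Rightarrow> 'n cmatrix" where "(\<forall>i k. continuous_on UNIV (\<lambda>z. M z $ i $ k)) \<and>
    (\<forall>x y. M (x, y) *v (x - y) = poly_map F x - poly_map F y) \<and>
    (\<forall>x i k. M (x, x) $ i $ k = peval (pdiff k (F i)) x)" using poly_map_secant_matrix[of F] by (rule exE)
  then have M: "\<And>i k. continuous_on UNIV (\<lambda>z. M z $ i $ k)"
    "\<And>x y. M (x, y) *v (x - y) = poly_map F x - poly_map F y"
    "\<And>x i k. M (x, x) $ i $ k = peval (pdiff k (F i)) x" by simp_all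
  have "M (a, a) = (\<chi> i k. peval (pdiff k (F i)) a)" by (simp add: vec_eq_iff M(3))
  then have d0: "det (M (a, a)) \<noteq> 0" using keller_map_jacobian[OF assms, of a] by simp
  have "continuous_on UNIV (\<lambda>z. det (M z))" 
    using M(1) by (auto simp: continuous_on_eq_continuous_at intro!: isCont_det)
  then have "open ((\<lambda>z. det (M z)) -` (- {0}))" by (rule open_vimage[OF open_Compl[OF closed_singleton]])
  moreover have "(a, a) \<in> (\<lambda>z. det (M z)) -` (- {0})" using d0 by simp
  ultimately obtain r where r: "r > 0" "ball (a, a) r \<subseteq> (\<lambda>z. det (M z)) -` (- {0})" by (rule openE)
  have "x = y" if xy: "x \<in> ball a (r / 2)" "y \<in> ball a (r / 2)" "poly_map F x = poly_map F y" for x y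
  proof -
    have "dist (a, a) (x, y) \<le> dist a x + dist a y"
      unfolding dist_Pair_Pair by (rule sqrt_sum_squares_le_sum) auto
    then have "(x, y) \<in> ball (a, a) r" using xy by auto
    then have "det (M (x, y)) \<noteq> 0" using r(2) by auto
    moreover have "M (x, y) *v (x - y) = 0" using M(2)[of x y] xy(3) by simp
    ultimately have "x - y = 0" by (metis invertible_det_nz invertible_def matrix_left_invertible_ker)
    then show ?thesis by simp
  qed
  then show ?thesis using r(1) by (intro exI[of _ "r / 2"]) (auto intro!: inj_onI)
qed

text \<open>A merely continuous lift of a line is differentiable: the secant matrix maps its
  increment to \<open>(r - r0)\<close> times the direction, so Cramer's rule writes the difference
  quotient as a quotient of continuous determinants. The limit is found by solving the same system
  at \<open>r0\<close> with the inverse Jacobian.\<close>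

lemma keller_lift_derivative:
  fixes F :: "'n::{finite,linorder} \<Rightarrow> 'n cpoly" and x :: "complex \<Rightarrow> 'n cspace"
  assumes keller: "keller_map F" and x: "isCont x r0" and S: "open S" "r0 \<in> S"
    and F: "\<And>r. r \<in> S \<Longrightarrow> poly_map F (x r) = c + r *s b"
  shows "((\<lambda>r. x r $ k) has_field_derivative (\<Sum>j\<in>UNIV. peval (jacobian_inverse F k j) (x r0) * b $ j)) (at r0)"
proof -
  obtain M :: "'n cspace \<times> 'n cspace \<Rightarrow> 'n cmatrix" where "(\<forall>i k. continuous_on UNIV (\<lambda>z. M z $ i $ k)) \<and>
    (\<forall>x y. M (x, y) *v (x - y) = poly_map F x - poly_map F y) \<and>
    (\<forall>x i k. M (x, x) $ i $ k = peval (pdiff k (F i)) x)" using poly_map_secant_matrix[of F] by (rule exE)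
  then have M: "\<And>i k. continuous_on UNIV (\<lambda>z. M z $ i $ k)"
    "\<And>x y. M (x, y) *v (x - y) = poly_map F x - poly_map F y"
    "\<And>x i k. M (x, x) $ i $ k = peval (pdiff k (F i)) x" by simp_all
  define D where "D r = M (x r, x r0)" for r
  define L :: "'n cspace" where "L = (\<chi> k. \<Sum>j\<in>UNIV. peval (jacobian_inverse F k j) (x r0) * b $ j)"
  have "D r0 = (\<chi> i k. peval (pdiff k (F i)) (x r0))" by (simp add: vec_eq_iff D_def M(3))
  then have d0: "det (D r0) = 1" using keller_map_jacobian[OF keller, of "x r0"] by simp
  have entry: "isCont (\<lambda>r. D r $ i $ k) r0" for i k
    unfolding D_def
    by (rule continuous_at_compose[of r0 "\<lambda>r. (x r, x r0)" "\<lambda>z. M z $ i $ k", unfolded o_def])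
      (use M(1)[of i k] x in \<open>auto intro!: continuous_intros simp: continuous_on_eq_continuous_at\<close>)
  have Ck: "isCont (\<lambda>r. det (\<chi> i j. if j = k then b $ i else D r $ i $ j)) r0"
  proof (rule isCont_det)
    show "isCont (\<lambda>r. (\<chi> i j. if j = k then b $ i else D r $ i $ j) $ i $ j) r0" for i j
      by (cases "j = k") (simp_all add: entry)
  qed
  have Cd: "isCont (\<lambda>r. det (D r)) r0"
    by (rule isCont_det[OF entry])
  have L: "D r0 *v L = b"
  proof (subst vec_eq_iff, intro allI)
    fix i
    have "(D r0 *v L) $ i = (\<Sum>j\<in>UNIV. peval (\<Sum>k\<in>UNIV. pdiff k (F i) * jacobian_inverse F k j) (x r0) * b $ j)"
      unfolding matrix_vector_mult_def L_def D_def
      by (simp add: M(3) sum_distrib_left sum_distrib_right peval_hom mult.assoc, subst sum.swap, simp)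
    also have "\<dots> = (\<Sum>j\<in>UNIV. if j = i then b $ j else 0)"
      unfolding jacobian_inverse[OF keller] by (rule sum.cong) (auto simp: peval_hom)
    finally show "(D r0 *v L) $ i = b $ i" by simp
  qed
  then have Lk: "det (\<chi> i j. if j = k then b $ i else D r0 $ i $ j) = L $ k"
    using cramer[of "D r0" L b] d0 by (simp add: vec_eq_iff)
  have "\<forall>\<^sub>F r in at r0. r \<in> S" using S by (simp add: eventually_at_topological) blast
  moreover have "\<forall>\<^sub>F r in at r0. det (D r) \<noteq> 0"
    using Cd d0 by (intro tendsto_imp_eventually_ne[of _ 1]) (auto simp: isCont_def)
  moreover have "\<forall>\<^sub>F r in at r0. r \<noteq> r0" by (simp add: eventually_at_filter)
  ultimately have "\<forall>\<^sub>F r in at r0. det (\<chi> i j. if j = k then b $ i else D r $ i $ j) / det (D r) = (x r $ k - x r0 $ k) / (r - r0)"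
  proof eventually_elim
    case (elim r)
    have e: "D r *v (x r - x r0) = (r - r0) *s b"
      unfolding D_def M(2) using F[OF elim(1)] F[OF S(2)] by (simp add: vec_eq_iff algebra_simps)
    have "D r *v (inverse (r - r0) *s (x r - x r0)) = b"
      unfolding vector_scalar_commute e vector_smult_assoc using elim(3) by simp
    then have "inverse (r - r0) *s (x r - x r0) = (\<chi> k. det (\<chi> i j. if j = k then b $ i else D r $ i $ j) / det (D r))"
      using cramer[OF elim(2)] by blast
    then have "(inverse (r - r0) *s (x r - x r0)) $ k = det (\<chi> i j. if j = k then b $ i else D r $ i $ j) / det (D r)"
      by simp
    then show ?case by (simp add: divide_inverse mult.commute[of _ "inverse (r - r0)"] right_diff_distrib)
  qed
  moreover have "((\<lambda>r. det (\<chi> i j. if j = k then b $ i else D r $ i $ j) / det (D r)) \<longlongrightarrow> L $ k / 1) (at r0)"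
    using Ck Cd d0 Lk by (intro tendsto_divide) (auto simp: isCont_def)
  ultimately have "((\<lambda>r. (x r $ k - x r0 $ k) / (r - r0)) \<longlongrightarrow> L $ k) (at r0)"
    by (simp add: tendsto_cong)
  then show ?thesis unfolding has_field_derivative_iff L_def by simp
qed

text \<open>The increment of \<open>u ^ m\<close> is the increment of \<open>u\<close> times the
  factor \<open>T\<close>, which is continuous with limit m u(r)^(m-1), nonzero. Continuity of the
  branch is thus enough.\<close>

lemma has_field_derivative_root:
  fixes u :: "complex \<Rightarrow> complex"
  assumes u: "isCont u r" "u r \<noteq> 0" and m: "1 \<le> m" and p: "((\<lambda>s. u s ^ m) has_field_derivative d) (at r)"
  shows "(u has_field_derivative d / (of_nat m * u r ^ (m - 1))) (at r)"
proof -
  define T where "T s = (\<Sum>i<m. u r ^ (m - Suc i) * u s ^ i)" for s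
  have fac: "u s ^ m - u r ^ m = (u s - u r) * T s" for s
    unfolding T_def by (rule power_diff_sumr2)
  have T0: "T r = of_nat m * u r ^ (m - 1)"
  proof -
    have "T r = (\<Sum>i<m. u r ^ (m - 1))" unfolding T_def by (rule sum.cong) (auto simp: power_add[symmetric])
    then show ?thesis by simp
  qed
  have Tc: "isCont T r" unfolding T_def using u(1) by (intro continuous_intros)
  have Tnz: "T r \<noteq> 0" using T0 u(2) m by simp
  have "\<forall>\<^sub>F s in at r. T s \<noteq> 0"
    using Tc Tnz by (intro tendsto_imp_eventually_ne[of _ "T r"]) (auto simp: isCont_def)
  then have "\<forall>\<^sub>F s in at r. ((u s ^ m - u r ^ m) / (s - r)) / T s = (u s - u r) / (s - r)"
    by eventually_elim (simp add: fac)
  moreover have "((\<lambda>s. ((u s ^ m - u r ^ m) / (s - r)) / T s) \<longlongrightarrow> d / T r) (at r)"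
    using p Tc Tnz unfolding has_field_derivative_iff isCont_def by (intro tendsto_divide)
  ultimately have "((\<lambda>s. (u s - u r) / (s - r)) \<longlongrightarrow> d / T r) (at r)" by (simp add: tendsto_cong)
  then show ?thesis unfolding has_field_derivative_iff T0 .
qed

section \<open>The classical topology\<close>

lemma openin_classical_value:
  "open W \<Longrightarrow> openin (classical_topology X) {p \<in> closed_points X. h \<in> p \<and> value_at p h \<in> W}"
  unfolding classical_topology_def by (rule topology_generated_by_Basis) blast

lemma openin_classical_subset: "openin (classical_topology X) U \<Longrightarrow> U \<subseteq> closed_points X"
  using openin_subset[of "classical_topology X" U]
  unfolding classical_topology_def by (auto simp: subset_iff)

lemma continuous_map_value:
  assumes "\<And>z. z \<in> topspace Y \<Longrightarrow> h \<in> \<gamma> z" and \<gamma>: "continuous_map Y (classical_topology X) \<gamma>"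
  shows "continuous_map Y euclidean (\<lambda>z. value_at (\<gamma> z) h)"
  unfolding continuous_map_def
proof (intro conjI allI impI)
  fix W :: "complex set" assume "openin euclidean W"
  then have "openin Y {z \<in> topspace Y. \<gamma> z \<in> {p \<in> closed_points X. h \<in> p \<and> value_at p h \<in> W}}"
    by (intro openin_continuous_map_preimage[OF \<gamma>] openin_classical_value) simp
  moreover have "\<gamma> z \<in> closed_points X" if "z \<in> topspace Y" for z
    using continuous_map_image_subset_topspace[OF \<gamma>] that openin_classical_subset[OF openin_topspace] by blast
  ultimately show "openin Y {z \<in> topspace Y. value_at (\<gamma> z) h \<in> W}"
    using assms(1) by (simp cong: conj_cong)
qed simp

text \<open>\<Psi> is the inverse of the parameter homeomorphism, restricted to a ball that it maps
  into the given neighbourhood. Openness of its images of smaller balls later supplies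
  neighbourhoods of \<open>e\<close>.\<close>

lemma analytic_chart:
  fixes \<theta> :: "'n::{finite,linorder} \<Rightarrow> 'n ratfun set \<Rightarrow> complex"
  assumes par: "analytic_parameters X e \<theta>" and U: "openin (classical_topology X) U" "e \<in> U"
  obtains \<delta> \<Psi> where "0 < \<delta>" "\<Psi> (0 :: 'n cspace) = e"
    "continuous_map (top_of_set (ball 0 \<delta>)) (classical_topology X) \<Psi>"
    "\<And>z. z \<in> ball 0 \<delta> \<Longrightarrow> \<Psi> z \<in> U" "\<And>z i. z \<in> ball 0 \<delta> \<Longrightarrow> \<theta> i (\<Psi> z) = z $ i"
    "\<And>\<delta>'. \<delta>' \<le> \<delta> \<Longrightarrow> openin (classical_topology X) (\<Psi> ` ball 0 \<delta>')"
proof -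
  let ?T = "classical_topology X" and ?\<Theta> = "\<lambda>p. (\<chi> i. \<theta> i p) :: 'n cspace"
  obtain U0 W where UW: "openin ?T U0" "e \<in> U0" "open W"
    "homeomorphic_map (subtopology ?T U0) (top_of_set W) ?\<Theta>"
    using par unfolding analytic_parameters_def by (elim conjE exE)
  obtain \<Psi> where \<Psi>: "homeomorphic_maps (subtopology ?T U0) (top_of_set W) ?\<Theta> \<Psi>"
    using UW(4) homeomorphic_map_maps by blast
  have top: "topspace (subtopology ?T U0) = U0" using openin_subset[OF UW(1)] by auto
  have maps: "continuous_map (subtopology ?T U0) (top_of_set W) ?\<Theta>" "continuous_map (top_of_set W) (subtopology ?T U0) \<Psi>"
    and inv: "\<And>p. p \<in> U0 \<Longrightarrow> \<Psi> (?\<Theta> p) = p" "\<And>z. z \<in> W \<Longrightarrow> ?\<Theta> (\<Psi> z) = z"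
    using \<Psi> top unfolding homeomorphic_maps_def by auto
  have \<Theta>e: "?\<Theta> e = 0" using par by (simp add: analytic_parameters_def vec_eq_iff)
  have \<Psi>T: "continuous_map (top_of_set W) ?T \<Psi>" and \<Psi>U0: "\<Psi> ` W \<subseteq> U0"
    using maps(2) by (auto simp: continuous_map_in_subtopology)
  have "openin (top_of_set W) {z \<in> topspace (top_of_set W). \<Psi> z \<in> U}"
    by (rule openin_continuous_map_preimage[OF \<Psi>T U(1)])
  then have open': "open {z \<in> W. \<Psi> z \<in> U}" using UW(3) by (simp add: openin_open_eq)
  have "?\<Theta> e \<in> W" using continuous_map_image_subset_topspace[OF maps(1)] UW(2) top by auto
  then have "0 \<in> W" using \<Theta>e by simp
  moreover have \<Psi>0: "\<Psi> 0 = e" using inv(1)[OF UW(2)] \<Theta>e by simp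
  ultimately obtain \<delta> where \<delta>: "0 < \<delta>" "ball 0 \<delta> \<subseteq> {z \<in> W. \<Psi> z \<in> U}"
    using open' U(2) unfolding open_contains_ball by blast
  show thesis
  proof (rule that[of \<delta> \<Psi>, OF \<delta>(1) \<Psi>0])
    show "continuous_map (top_of_set (ball 0 \<delta>)) ?T \<Psi>"
      by (rule continuous_map_from_subtopology_mono[OF \<Psi>T]) (use \<delta> in auto)
    show "\<Psi> z \<in> U" if "z \<in> ball 0 \<delta>" for z using that \<delta> by auto
    show "\<theta> i (\<Psi> z) = z $ i" if "z \<in> ball 0 \<delta>" for z i
      using inv(2)[of z] that \<delta>(2) by (auto simp: vec_eq_iff)
    show "openin ?T (\<Psi> ` ball 0 \<delta>')" if "\<delta>' \<le> \<delta>" for \<delta>'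
    proof -
      have sub: "ball 0 \<delta>' \<subseteq> W" using that \<delta>(2) subset_ball[of \<delta>' \<delta> 0] by blast
      have "openin (top_of_set W) (ball 0 \<delta>')" using sub UW(3) by (simp add: openin_open_eq)
      then have "openin (subtopology ?T U0) {p \<in> topspace (subtopology ?T U0). ?\<Theta> p \<in> ball 0 \<delta>'}"
        by (rule openin_continuous_map_preimage[OF maps(1)])
      then have "openin ?T {p \<in> U0. ?\<Theta> p \<in> ball 0 \<delta>'}"
        unfolding top using UW(1) by (simp add: openin_open_subtopology)
      moreover have "{p \<in> U0. ?\<Theta> p \<in> ball 0 \<delta>'} = \<Psi> ` ball 0 \<delta>'"
      proof (intro set_eqI iffI)
        fix p assume "p \<in> {p \<in> U0. ?\<Theta> p \<in> ball 0 \<delta>'}"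
        then show "p \<in> \<Psi> ` ball 0 \<delta>'" using inv(1)[of p] by (metis (mono_tags, lifting) image_eqI mem_Collect_eq)
      next
        fix p assume "p \<in> \<Psi> ` ball 0 \<delta>'"
        then obtain z where "z \<in> ball 0 \<delta>'" "p = \<Psi> z" by blast
        then have z: "z \<in> W" using sub by blast
        then have "\<Psi> z \<in> U0" using \<Psi>U0 by blast
        then show "p \<in> {p \<in> U0. ?\<Theta> p \<in> ball 0 \<delta>'}" using inv(2)[OF z] \<open>z \<in> ball 0 \<delta>'\<close> \<open>p = \<Psi> z\<close> by simp
      qed
      ultimately show ?thesis by simp
    qed
  qed
qed

section \<open>The evolution of \<open>u\<close> near a generic point of \<open>\<Gamma>\<close>\<close>

text \<open>P, W, t and h are to be the absolute values of p, w, 1/u and H; \<open>g\<close> is that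
  of the bracket in \<open>H_eq\<close>, and \<open>a\<close> is k. The first relation makes P
  comparable with t^k, and then the second makes h comparable with t^(k(m-1)).\<close>

lemma root_size_bounds:
  fixes P W g h t :: real
  assumes m: "1 \<le> m" and P: "0 \<le> P" and t: "0 \<le> t" and pw: "P ^ m = W * t ^ (m * k)"
    and W: "0 < W1" "W1 \<le> W" "W \<le> W2" and g: "0 < g1" "g1 \<le> g" "g \<le> g2" and a: "0 < a"
    and h: "a * W * h = P ^ (m - 1) * g"
  shows "(min 1 W1) ^ (m - 1) * g1 / (a * W2) * t ^ (k * (m - 1)) \<le> h"
    "h \<le> (max 1 W2) ^ (m - 1) * g2 / (a * W1) * t ^ (k * (m - 1))"
proof -
  \<comment> \<open>Truncating at 1 gives \<alpha>^m \<le> W \<le> \<beta>^m, since m is at least 1.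
    Bounds on P itself follow by comparing m-th powers, without taking roots of W.\<close>
  define \<alpha> where "\<alpha> = min 1 W1"
  define \<beta> where "\<beta> = max 1 W2"
  have \<alpha>: "0 < \<alpha>" "\<alpha> \<le> 1" "\<alpha> \<le> W" and \<beta>: "1 \<le> \<beta>" "W \<le> \<beta>" using W by (auto simp: \<alpha>_def \<beta>_def)
  obtain m' where m': "m = Suc m'" using m by (cases m) auto
  have "\<alpha> ^ m \<le> W" using power_decreasing[of 1 m \<alpha>] m \<alpha> by simp
  then have "(\<alpha> * t ^ k) ^ Suc m' \<le> P ^ Suc m'"
    using mult_right_mono[of "\<alpha> ^ m" W "t ^ (m * k)"] t pw
    unfolding m'[symmetric] power_mult_distrib power_mult[symmetric] mult.commute[of k m] by simp
  then have lo: "\<alpha> * t ^ k \<le> P" using P by (rule power_le_imp_le_base)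
  have "W \<le> \<beta> ^ m" using power_increasing[of 1 m \<beta>] m \<beta> by simp
  then have "P ^ Suc m' \<le> (\<beta> * t ^ k) ^ Suc m'"
    using mult_right_mono[of W "\<beta> ^ m" "t ^ (m * k)"] t pw
    unfolding m'[symmetric] power_mult_distrib power_mult[symmetric] mult.commute[of k m] by simp
  then have hi: "P \<le> \<beta> * t ^ k" by (rule power_le_imp_le_base) (use \<beta> t in simp)
  have lo': "\<alpha> ^ (m - 1) * t ^ (k * (m - 1)) \<le> P ^ (m - 1)"
    using power_mono[OF lo, of "m - 1"] \<alpha> t by (simp add: power_mult_distrib power_mult)
  have hi': "P ^ (m - 1) \<le> \<beta> ^ (m - 1) * t ^ (k * (m - 1))"
    using power_mono[OF hi, of "m - 1"] P by (simp add: power_mult_distrib power_mult)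
  have heq: "h = P ^ (m - 1) * g / (a * W)" using h a W by (simp add: field_simps)
  have "(\<alpha> ^ (m - 1) * t ^ (k * (m - 1))) * g1 / (a * W2) \<le> h"
    unfolding heq using lo' g W a \<alpha> t P by (intro frac_le mult_mono) auto
  then show "(min 1 W1) ^ (m - 1) * g1 / (a * W2) * t ^ (k * (m - 1)) \<le> h"
    by (simp add: \<alpha>_def mult_ac)
  have "h \<le> (\<beta> ^ (m - 1) * t ^ (k * (m - 1))) * g2 / (a * W1)"
    unfolding heq using hi' g W a \<beta> t P by (intro frac_le mult_mono) auto
  then show "h \<le> (max 1 W2) ^ (m - 1) * g2 / (a * W1) * t ^ (k * (m - 1))"
    by (simp add: \<beta>_def mult_ac)
qed

lemma norm_update_coordinate:
  fixes z :: "'n::finite cspace"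
  shows "norm (\<chi> i. if i = l then t else z $ i) \<le> norm z + norm t"
proof -
  have "(\<chi> i. if i = l then t else z $ i) = (\<chi> i. if i = l then 0 else z $ i) + axis l t"
    by (simp add: vec_eq_iff axis_def)
  then have "norm (\<chi> i. if i = l then t else z $ i) \<le> norm (\<chi> i. if i = l then 0 else z $ i) + norm (axis l t)"
    by (metis norm_triangle_ineq)
  moreover have "norm (\<chi> i. if i = l then 0 else z $ i) \<le> norm z"
    by (rule norm_le_componentwise_cart) auto
  moreover have "norm (axis l t) \<le> norm t"
  proof -
    have "norm (axis l t) \<le> (\<Sum>i\<in>UNIV. norm (axis l t $ i))"
      unfolding norm_vec_def by (rule L2_set_le_sum) auto
    also have "\<dots> = (\<Sum>i\<in>UNIV. if i = l then norm t else 0)" by (rule sum.cong) (auto simp: axis_def)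
    finally show ?thesis by simp
  qed
  ultimately show ?thesis by linarith
qed

lemma coordinate_coeff_origin:
  fixes c :: "('n::finite \<Rightarrow> nat) \<Rightarrow> complex"
  shows "coordinate_coeff c l (($) 0) j = c ((\<lambda>_. 0)(l := j))"
proof -
  have "((\<lambda>\<alpha>. c (\<alpha>(l := j)) * (\<Prod>i\<in>UNIV - {l}. 0 $ i ^ \<alpha> i)) has_sum c ((\<lambda>_. 0)(l := j))) {\<alpha>. \<alpha> l = 0}"
  proof (rule has_sum_finite_neutralI[of "{\<lambda>_. 0}"])
    fix \<alpha> :: "'n \<Rightarrow> nat" assume "\<alpha> \<in> {\<alpha>. \<alpha> l = 0} - {\<lambda>_. 0}"
    then obtain i where "\<alpha> i \<noteq> 0" "\<alpha> l = 0" by (auto simp: fun_eq_iff)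
    then have "i \<noteq> l" by auto
    note i = this \<open>\<alpha> i \<noteq> 0\<close>
    then have "(\<Prod>i\<in>UNIV - {l}. (0 :: 'n cspace) $ i ^ \<alpha> i) = 0" using i by (intro prod_zero) auto
    then show "c (\<alpha>(l := j)) * (\<Prod>i\<in>UNIV - {l}. 0 $ i ^ \<alpha> i) = 0" by simp
  qed (auto simp: fun_upd_def)
  then show ?thesis unfolding coordinate_coeff_def by (rule infsumI)
qed

text \<open>\<open>B\<close> is the inverse of \<open>A\<close>; its column \<open>i1\<close> is the
  direction of the new y_1-axis in the old coordinates. \<open>N0\<close> is the exponent of 1/x_1
  that clears the poles of the coordinates.\<close>

locale keller_point = keller_divisor F V \<Gamma> \<pi> X i1 m p0 j0
  for F :: "'n::{finite,linorder} \<Rightarrow> 'n cpoly" and V :: "('n cspace) set" and \<Gamma> :: "'n ratfun set"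
    and \<pi> :: "'n ratfun" and X :: "'n ratfun set set" and i1 :: 'n and m :: nat and p0 :: "'n cpoly" and j0 :: 'n +
  fixes v :: "'n cspace" and e :: "'n ratfun set" and A B :: "'n cmatrix" and u :: "'n ratfun set \<Rightarrow> complex"
    and l :: 'n and N0 :: nat
  assumes pt: "point_over F X \<Gamma> v e"
    and regular: "inverse (coord i1) \<in> e" "w \<in> e" "inverse w \<in> e" "range \<epsilon> \<subseteq> e" "range (\<lambda>i. coord i * inverse (coord i1) ^ N0) \<subseteq> e"
    and AB: "A ** B = mat 1"
    and transversal: "(\<Sum>j\<in>UNIV. B $ j $ i1 * peval (pdiff j p0) v) \<noteq> 0"
    and root: "root_branch X \<Gamma> e i1 m u"
    and parameters: "analytic_parameters X e (parameters_at_infinity F A v \<Gamma> u l)"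
begin

abbreviation "T \<equiv> classical_topology X"
abbreviation "\<theta> \<equiv> parameters_at_infinity F A v \<Gamma> u l"
abbreviation "b j \<equiv> B $ j $ i1"
abbreviation "d0 \<equiv> \<Sum>j\<in>UNIV. cpoly_const (b j) * pdiff j p0"
abbreviation "\<epsilon>b \<equiv> \<Sum>j\<in>UNIV. cst (b j) * \<epsilon> j"
abbreviation "Dx1 \<equiv> \<Sum>j\<in>UNIV. cst (b j) * D j x1"

text \<open>Since \<open>u\<^sup>m = x\<^sub>1\<close> and \<open>dx\<^sub>1/dr\<close> is the value of \<open>Dx1\<close>, one has \<open>du/dr = u\<^sup>k\<^sup>+\<^sup>1 (H / m) u\<^sup>N\<close>; so the
  exponent is \<open>k\<close> as soon as \<open>H\<close> has exactly the size of \<open>u\<^sup>-\<^sup>N\<close>.\<close>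

definition "H = Dx1 * inverse x1 ^ (k + 1)"

definition "N = k * (m - 1)"

lemma k_pos: "1 \<le> k"
  using ramification by metis

lemma H_eq: "of_nat k * w * H = \<phi> p0 ^ (m - 1) * (\<epsilon>b - of_nat m * \<phi> d0)"
  using log_derivative_x1_direction[of b] by (simp add: H_def mult.assoc)

text \<open>The defining formula does not show that \<open>H\<close> is regular on \<Gamma>. The
  identity \<open>H_eq\<close> does, as \<open>k\<close> and \<open>w\<close> are invertible where
  the hypotheses hold.\<close>

lemma H_mem:
  assumes "closed_point p" "w \<in> p" "inverse w \<in> p" "range \<epsilon> \<subseteq> p" "\<And>i. rat_of_poly (F i) \<in> p"
  shows "H \<in> p"
proof -
  interpret p: closed_point p by fact
  have \<phi>: "\<phi> q \<in> p" for q by (rule p.pullback_value) (rule assms)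
  have k0: "(of_nat k :: 'n ratfun) \<noteq> 0" "inverse (of_nat k) \<in> p"
    using p.of_nat_unit[of k] k_pos unfolding unit_iff by auto
  have "H = inverse (of_nat k) * inverse w * (of_nat k * w * H)" using k0(1) w_nonzero by (simp add: field_simps)
  also have "\<dots> \<in> p"
    unfolding H_eq using k0 assms(3,4) \<phi> by (intro p.closed) auto
  finally show ?thesis .
qed

lemma point_mem: "closed_point e" "e \<in> closed_points X" "e \<subseteq> \<Gamma>" "\<And>i. rat_of_poly (F i) \<in> e"
  using pt point_closed by (auto simp: point_over_def)

lemma value_w: "value_at e w \<noteq> 0"
proof -
  interpret e: closed_point e by (rule point_mem)
  show ?thesis using e.value_at_inverse[OF regular(2,3) w_nonzero] by auto
qed

lemma value_\<epsilon>b: "\<epsilon>b \<in> e" "value_at e \<epsilon>b = 0"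
proof -
  interpret e: closed_point e by (rule point_mem)
  show 1: "\<epsilon>b \<in> e" using regular(4) by (intro e.closed) auto
  have "\<epsilon>b \<in> \<mm>" using closed(1) epsilon_nonunit by (intro nonunits_closed(7) nonunits_closed(3)) auto
  then show "value_at e \<epsilon>b = 0" using point_nonunit(2)[OF pt 1] by blast
qed

lemma value_d0: "value_at e (\<phi> d0) = (\<Sum>j\<in>UNIV. b j * peval (pdiff j p0) v)"
  using point_pullback(2)[OF pt, of d0] by (simp add: peval_hom)

lemma x1_notin_divisor: "x1 \<notin> \<Gamma>"
proof
  assume x: "x1 \<in> \<Gamma>"
  obtain t where t: "t \<in> \<Gamma> - \<mm>" "inverse x1 = \<pi> ^ m * t" using x1_order has_order_iff by blast
  then have "inverse x1 \<in> \<mm>" using power_pi_nonunit[of t m] m by auto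
  then have "x1 * inverse x1 \<in> \<mm>" using x nonunits_closed(3) by blast
  then show False using x1_nonzero nonunits_closed(2) by simp
qed

text \<open>The facts about points near \<open>e\<close>, on \<Gamma> and off it, with constants
  independent of the point. Vanishing of the pullback of \<open>p0\<close> on \<Gamma> and its
  nonvanishing off \<Gamma> decide where the preimage of the axis leaves \<Gamma>.\<close>

definition good :: "real \<Rightarrow> real \<Rightarrow> 'n ratfun set \<Rightarrow> bool" where
  "good c C p \<longleftrightarrow> closed_point p \<and> (\<forall>i. rat_of_poly (F i) \<in> p) \<and> H \<in> p \<and>
     (p \<subseteq> \<Gamma> \<longrightarrow> value_at p (\<phi> p0) = 0) \<and>
     (\<not> p \<subseteq> \<Gamma> \<longrightarrow> range coord \<subseteq> p \<and> u p \<noteq> 0 \<and> u p ^ m = value_at p x1 \<and> value_at p (\<phi> p0) \<noteq> 0 \<and>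
        c * norm (\<theta> l p) ^ N \<le> norm (value_at p H) \<and> norm (value_at p H) \<le> C * norm (\<theta> l p) ^ N)"

lemma theta_l: "\<not> p \<subseteq> \<Gamma> \<Longrightarrow> \<theta> l p = inverse (u p)" "p \<subseteq> \<Gamma> \<Longrightarrow> \<theta> l p = 0"
  by (auto simp: parameters_at_infinity_def)

lemma theta_other: "i \<noteq> l \<Longrightarrow> \<theta> i p = value_at p (new_comp F A v i)"
  by (auto simp: parameters_at_infinity_def)

lemma divisor_function_vanishes:
  assumes p: "p \<in> closed_points X" "\<And>i. rat_of_poly (F i) \<in> p" "p \<subseteq> \<Gamma>"
  shows "value_at p (\<phi> p0) = 0"
proof -
  have pt': "point_over F X \<Gamma> (\<chi> i. value_at p (rat_of_poly (F i))) p" using p by (simp add: point_over_def)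
  show ?thesis
    by (rule point_nonunit(2)[OF pt' point_pullback(1)[OF pt']]) (use p0(1) pullback_nonunit_iff in blast)
qed

lemma openin_regular:
  "finite G \<Longrightarrow> openin T {p \<in> closed_points X. G \<subseteq> p}"
proof (induction G rule: finite_induct)
  case empty
  have "1 \<in> p" if "p \<in> closed_points X" for p
  proof -
    interpret closed_point p by (rule closed_point_of_model[OF X_variety that])
    show ?thesis by (rule closed)
  qed
  then have "{p \<in> closed_points X. {} \<subseteq> p} = {p \<in> closed_points X. 1 \<in> p \<and> value_at p 1 \<in> UNIV}" by auto
  then show ?case using openin_classical_value[of UNIV X 1] by simp
next
  case (insert h G)
  have "{p \<in> closed_points X. insert h G \<subseteq> p} =
    {p \<in> closed_points X. h \<in> p \<and> value_at p h \<in> UNIV} \<inter> {p \<in> closed_points X. G \<subseteq> p}" by auto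
  then show ?case using insert openin_classical_value[of UNIV X h] by (simp add: openin_Int)
qed

text \<open>All requirements are open conditions that hold at \<open>e\<close>: there
  \<open>w\<close> is nonzero, \<open>\<epsilon>b\<close> vanishes and, by transversality, the
  derivative of \<open>p0\<close> along the axis does not.\<close>

lemma good_neighbourhood:
  "\<exists>U c C. openin T U \<and> e \<in> U \<and> 0 < c \<and> (\<forall>p\<in>U. good c C p) \<and>
     continuous_map (subtopology T (U - {p. p \<subseteq> \<Gamma>})) euclidean u"
proof -
  interpret e: closed_point e by (rule point_mem)
  obtain Ur where Ur: "openin T Ur" "e \<in> Ur" "continuous_map (subtopology T (Ur - {p. p \<subseteq> \<Gamma>})) euclidean u"
    "\<And>p. p \<in> Ur \<Longrightarrow> \<not> p \<subseteq> \<Gamma> \<Longrightarrow> x1 \<in> p \<and> u p ^ m = value_at p x1"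
    using root unfolding root_branch_def by blast
  define W0 where "W0 = norm (value_at e w)"
  define c0 where "c0 = value_at e (\<phi> d0)"
  have W0: "0 < W0" using value_w by (simp add: W0_def)
  have c0: "c0 \<noteq> 0" using transversal value_d0 by (simp add: c0_def)
  \<comment> \<open>Regularity of these functions, together with that of \<open>w\<close>, gives
    regularity of \<open>H\<close> and, off \<Gamma>, of all coordinates.\<close>
  define G where "G = {inverse x1, inverse w} \<union> range \<epsilon> \<union> range (\<lambda>i. rat_of_poly (F i)) \<union> range (\<lambda>i. coord i * inverse x1 ^ N0)"
  define U where "U = Ur \<inter> {p \<in> closed_points X. G \<subseteq> p}
    \<inter> {p \<in> closed_points X. w \<in> p \<and> value_at p w \<in> {z. W0 / 2 < norm z \<and> norm z < 2 * W0}}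
    \<inter> {p \<in> closed_points X. \<epsilon>b \<in> p \<and> value_at p \<epsilon>b \<in> ball 0 (norm c0 / 4)}
    \<inter> {p \<in> closed_points X. \<phi> d0 \<in> p \<and> value_at p (\<phi> d0) \<in> ball c0 (norm c0 / 4)}"
  have "open {z :: complex. W0 / 2 < norm z \<and> norm z < 2 * W0}"
    by (intro open_Collect_conj open_Collect_less continuous_intros)
  then have Uo: "openin T U"
    unfolding U_def by (intro openin_Int Ur(1) openin_regular openin_classical_value) (auto simp: G_def)
  have Ue: "e \<in> U"
    using Ur(2) point_mem(2,4) regular W0 c0 value_\<epsilon>b point_pullback(1)[OF pt]
    by (auto simp: U_def G_def W0_def c0_def)
  define c where "c = (min 1 (W0 / 2)) ^ (m - 1) * (norm c0 / 2) / (real k * (2 * W0))"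
  define C where "C = (max 1 (2 * W0)) ^ (m - 1) * (2 * real m * norm c0) / (real k * (W0 / 2))"
  have "good c C p" if p: "p \<in> U" for p
  proof -
    have pcl: "p \<in> closed_points X" and pG: "G \<subseteq> p" and pUr: "p \<in> Ur" and pw: "w \<in> p"
      and W: "W0 / 2 < norm (value_at p w)" "norm (value_at p w) < 2 * W0"
      and E: "\<epsilon>b \<in> p" "norm (value_at p \<epsilon>b) < norm c0 / 4"
      and Gd: "norm (c0 - value_at p (\<phi> d0)) < norm c0 / 4"
      using p by (auto simp: U_def dist_norm)
    have cp: "closed_point p" by (rule closed_point_of_model[OF X_variety pcl])
    interpret p: closed_point p by (rule cp)
    have F: "rat_of_poly (F i) \<in> p" for i using pG by (auto simp: G_def)
    have \<phi>: "\<phi> q \<in> p" for q by (rule p.pullback_value) (rule F)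
    have mem: "inverse x1 \<in> p" "inverse w \<in> p" "range \<epsilon> \<subseteq> p" "\<And>i. coord i * inverse x1 ^ N0 \<in> p"
      using pG by (auto simp: G_def image_subset_iff)
    have Hp: "H \<in> p" by (rule H_mem[OF cp pw mem(2,3) F])
    have "range coord \<subseteq> p \<and> u p \<noteq> 0 \<and> u p ^ m = value_at p x1 \<and> value_at p (\<phi> p0) \<noteq> 0 \<and>
        c * norm (\<theta> l p) ^ N \<le> norm (value_at p H) \<and> norm (value_at p H) \<le> C * norm (\<theta> l p) ^ N"
      if out: "\<not> p \<subseteq> \<Gamma>"
    proof -
      have x1: "x1 \<in> p" "u p ^ m = value_at p x1" using Ur(4)[OF pUr out] by auto
      have prod1: "value_at p x1 * value_at p (inverse x1) = 1" by (rule p.value_at_inverse[OF x1(1) mem(1) x1_nonzero])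
      then have up: "u p \<noteq> 0" using x1(2) m by (auto simp: power_0_left)
      have "coord i \<in> p" for i
      proof -
        have "coord i = coord i * inverse x1 ^ N0 * x1 ^ N0" using x1_nonzero by (simp add: power_inverse)
        then show ?thesis using mem(4)[of i] x1(1) p.closed(5,8) by metis
      qed
      \<comment> \<open>The definition of \<open>w\<close> solved for p. As x_1 = u^m, it gives
        |p|^m = |w| |u|^(-mk).\<close>
      moreover have pm: "\<phi> p0 ^ m = w * inverse x1 ^ k" using x1_nonzero by (simp add: w_def power_inverse)
      then have "value_at p (\<phi> p0) ^ m = value_at p w * value_at p (inverse x1) ^ k"
        using p.value_at_power[OF \<phi>, of p0 m] pw mem(1) by (simp add: p.value_at_mult p.value_at_power p.closed)
      moreover have "value_at p (inverse x1) = inverse (u p) ^ m"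
        using prod1 up by (simp add: x1(2)[symmetric] power_inverse field_simps)
      ultimately have Pm: "norm (value_at p (\<phi> p0)) ^ m = norm (value_at p w) * norm (\<theta> l p) ^ (m * k)"
        and co: "range coord \<subseteq> p"
        unfolding theta_l(1)[OF out] by (auto simp: norm_power[symmetric] norm_mult[symmetric] power_mult)
      have th: "0 < norm (\<theta> l p)" unfolding theta_l(1)[OF out] using up by simp
      have P0: "value_at p (\<phi> p0) \<noteq> 0"
      proof
        assume "value_at p (\<phi> p0) = 0"
        then have "norm (value_at p w) * norm (\<theta> l p) ^ (m * k) = 0" using Pm m by (simp add: power_0_left)
        then show False using W W0 th by auto
      qed
      have "value_at p (of_nat k * w * H) = value_at p (\<phi> p0 ^ (m - 1) * (\<epsilon>b - of_nat m * \<phi> d0))"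
        by (simp only: H_eq)
      then have "of_nat k * value_at p w * value_at p H =
          value_at p (\<phi> p0) ^ (m - 1) * (value_at p \<epsilon>b - of_nat m * value_at p (\<phi> d0))"
        using pw Hp E(1) \<phi> by (simp add: p.value_at_mult p.value_at_power p.value_at_minus p.value_at_of_nat p.closed)
      then have "norm (of_nat k * value_at p w * value_at p H) =
          norm (value_at p (\<phi> p0) ^ (m - 1) * (value_at p \<epsilon>b - of_nat m * value_at p (\<phi> d0)))" by (simp only:)
      then have Hn: "real k * norm (value_at p w) * norm (value_at p H) =
          norm (value_at p (\<phi> p0)) ^ (m - 1) * norm (value_at p \<epsilon>b - of_nat m * value_at p (\<phi> d0))"
        by (simp add: norm_mult norm_power)
      \<comment> \<open>|\<open>\<epsilon>b\<close>| is below |c0|/4 and the derivative of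
        \<open>p0\<close> lies between 3/4 and 5/4 of |c0|. So the bracket is at least (3m -
        1)|c0|/4 and at most (5m + 1)|c0|/4 in size, and m is at least 1.\<close>
      have g: "norm c0 / 2 \<le> norm (value_at p \<epsilon>b - of_nat m * value_at p (\<phi> d0))"
        "norm (value_at p \<epsilon>b - of_nat m * value_at p (\<phi> d0)) \<le> 2 * real m * norm c0"
      proof -
        have 1: "3 / 4 * norm c0 \<le> norm (value_at p (\<phi> d0))" "norm (value_at p (\<phi> d0)) \<le> 5 / 4 * norm c0"
          using Gd norm_triangle_ineq2[of c0 "value_at p (\<phi> d0)"] norm_triangle_ineq3[of c0 "value_at p (\<phi> d0)"] by linarith+
        have 2: "norm (of_nat m * value_at p (\<phi> d0)) = real m * norm (value_at p (\<phi> d0))" by (simp add: norm_mult)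
        have 3: "norm (value_at p (\<phi> d0)) \<le> real m * norm (value_at p (\<phi> d0))"
          using m mult_right_mono[of 1 "real m" "norm (value_at p (\<phi> d0))"] by simp
        show "norm c0 / 2 \<le> norm (value_at p \<epsilon>b - of_nat m * value_at p (\<phi> d0))"
          using 1 2 3 E(2) norm_triangle_ineq2[of "of_nat m * value_at p (\<phi> d0)" "value_at p \<epsilon>b"]
          by (simp add: norm_minus_commute)
        have "real m * norm (value_at p (\<phi> d0)) \<le> 5 / 4 * (real m * norm c0)"
          using mult_left_mono[OF 1(2), of "real m"] by simp
        moreover have "norm c0 \<le> real m * norm c0"
          using m mult_right_mono[of 1 "real m" "norm c0"] by simp
        moreover have "2 * real m * norm c0 = 2 * (real m * norm c0)" by simp
        ultimately show "norm (value_at p \<epsilon>b - of_nat m * value_at p (\<phi> d0)) \<le> 2 * real m * norm c0"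
          using 2 E(2) norm_triangle_ineq4[of "value_at p \<epsilon>b" "of_nat m * value_at p (\<phi> d0)"] norm_ge_zero[of c0]
          by linarith
      qed
      have kpos: "0 < real k" using k_pos by simp
      have lw: "W0 / 2 \<le> norm (value_at p w)" "norm (value_at p w) \<le> 2 * W0" "0 < W0 / 2" using W W0 by auto
      have g0: "0 < norm c0 / 2" using c0 by simp
      note bounds = root_size_bounds[OF m norm_ge_zero norm_ge_zero Pm lw(3,1,2) g0 g kpos Hn]
      show ?thesis
        using co up x1(2) P0 bounds by (simp add: c_def C_def N_def)
    qed
    then show ?thesis
      using cp F Hp divisor_function_vanishes[OF pcl F] unfolding good_def by blast
  qed
  moreover have "0 < c" using W0 c0 k_pos by (auto simp: c_def)
  moreover have "continuous_map (subtopology T (U - {p. p \<subseteq> \<Gamma>})) euclidean u"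
    by (rule continuous_map_from_subtopology_mono[OF Ur(3)]) (auto simp: U_def)
  ultimately show ?thesis using Uo Ue by blast
qed

lemma BA: "B ** A = mat 1"
  using AB matrix_left_right_inverse by blast

lemma target_value:
  assumes "closed_point p" "\<And>i. rat_of_poly (F i) \<in> p"
  shows "value_at p (new_comp F A v i) = (A *v ((\<chi> j. value_at p (rat_of_poly (F j))) - v)) $ i"
proof -
  interpret p: closed_point p by fact
  show ?thesis unfolding new_comp_eq p.pullback_value(2)[OF assms(2)] by (rule peval_new_coord_poly)
qed

lemma poly_map_value:
  assumes "closed_point p" "range coord \<subseteq> p"
  shows "poly_map F (\<chi> i. value_at p (coord i)) = (\<chi> j. value_at p (rat_of_poly (F j)))"
proof -
  interpret p: closed_point p by fact
  show ?thesis using p.rat_of_poly_value(2)[OF assms(2)] by (simp add: poly_map_def vec_eq_iff)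
qed

text \<open>The curve lifts a line in Y_0 through f, so the derivative of x_1 along it is the value
  of \<open>Dx1\<close>, which is H x_1^(k+1); taking the m-th root gives that of u.\<close>

lemma evolution_derivative:
  assumes good: "\<forall>p\<in>U. good c C p"
    and ucont: "continuous_map (subtopology T (U - {p. p \<subseteq> \<Gamma>})) euclidean u"
    and S: "open S" "r \<in> S" and \<gamma>: "continuous_map (top_of_set S) T \<gamma>"
    and curve: "\<And>r. r \<in> S \<Longrightarrow> \<gamma> r \<in> U \<and> range coord \<subseteq> \<gamma> r \<and> value_at (\<gamma> r) (new_comp F A v i1) = r \<and>
       (\<forall>i. i \<noteq> i1 \<longrightarrow> value_at (\<gamma> r) (new_comp F A v i) = cc $ i)"
  shows "((\<lambda>r. u (\<gamma> r)) has_field_derivative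
     u (\<gamma> r) powi (int k + 1) * (value_at (\<gamma> r) H / of_nat m / \<theta> l (\<gamma> r) ^ N)) (at r)"
proof -
  have out: "\<not> \<gamma> s \<subseteq> \<Gamma>" if "s \<in> S" for s using curve[OF that] x1_notin_divisor by blast
  have gd: "good c C (\<gamma> s)" if "s \<in> S" for s using good curve[OF that] by blast
  have cp: "closed_point (\<gamma> s)" and Fs: "\<And>i. rat_of_poly (F i) \<in> \<gamma> s" and Hs: "H \<in> \<gamma> s"
    and us: "u (\<gamma> s) \<noteq> 0" "u (\<gamma> s) ^ m = value_at (\<gamma> s) x1" if "s \<in> S" for s
    using gd[OF that] out[OF that] unfolding good_def by auto
  define x where "x s = (\<chi> i. value_at (\<gamma> s) (coord i))" for s
  have xcont: "isCont x r"
  proof -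
    have "isCont (\<lambda>s. value_at (\<gamma> s) (coord i)) r" for i
    proof -
      have "continuous_map (top_of_set S) euclidean (\<lambda>s. value_at (\<gamma> s) (coord i))"
      proof (rule continuous_map_value[OF _ \<gamma>])
        fix s assume "s \<in> topspace (top_of_set S)"
        then have "range coord \<subseteq> \<gamma> s" using curve by simp
        then show "coord i \<in> \<gamma> s" by blast
      qed
      then show ?thesis using S by (simp add: continuous_on_eq_continuous_at)
    qed
    then show ?thesis unfolding x_def isCont_def by (intro vec_tendstoI) simp
  qed
  have ucts: "isCont (\<lambda>s. u (\<gamma> s)) r"
  proof -
    have "continuous_map (top_of_set S) (subtopology T (U - {p. p \<subseteq> \<Gamma>})) \<gamma>"
      by (rule continuous_map_into_subtopology[OF \<gamma>]) (use curve out in auto)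
    from continuous_map_compose[OF this ucont]
    have "continuous_on S (\<lambda>s. u (\<gamma> s))" by (simp add: o_def)
    then show ?thesis using S by (simp add: continuous_on_eq_continuous_at)
  qed
  \<comment> \<open>Applying \<open>B\<close> returns to the original coordinates of Y_0. The image
    is a line whose direction is column \<open>i1\<close> of \<open>B\<close>.\<close>
  have Fx: "poly_map F (x s) = (v + B *v (\<chi> i. if i = i1 then 0 else cc $ i)) + s *s (\<chi> j. b j)" if s: "s \<in> S" for s
  proof -
    have "poly_map F (x s) = (\<chi> j. value_at (\<gamma> s) (rat_of_poly (F j)))"
      unfolding x_def using poly_map_value[OF cp[OF s]] curve[OF s] by blast
    then have "(A *v (poly_map F (x s) - v)) $ i = (if i = i1 then s else cc $ i)" for i
      using target_value[OF cp[OF s] Fs[OF s], of i] curve[OF s] by auto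
    then have "A *v (poly_map F (x s) - v) = (\<chi> i. if i = i1 then 0 else cc $ i) + s *s axis i1 1"
      by (simp add: vec_eq_iff axis_def)
    then have "B *v (A *v (poly_map F (x s) - v)) = B *v ((\<chi> i. if i = i1 then 0 else cc $ i) + s *s axis i1 1)" by simp
    then have "poly_map F (x s) - v = B *v (\<chi> i. if i = i1 then 0 else cc $ i) + s *s (B *v axis i1 1)"
      by (simp add: matrix_vector_mul_assoc BA matrix_vector_right_distrib vector_scalar_commute)
    moreover have "B *v axis i1 1 = (\<chi> j. b j)"
      by (simp add: vec_eq_iff matrix_vector_mult_def axis_def if_distrib cong: if_cong)
    ultimately show ?thesis by (simp add: algebra_simps)
  qed
  define dd where "dd = (\<Sum>j\<in>UNIV. peval (jacobian_inverse F i1 j) (x r) * b j)"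
  have "((\<lambda>s. x s $ i1) has_field_derivative dd) (at r)"
    using keller_lift_derivative[OF keller xcont S Fx, of i1] by (simp add: dd_def)
  then have "((\<lambda>s. u (\<gamma> s) ^ m) has_field_derivative dd) (at r)"
    by (rule has_field_derivative_transform_within_open[OF _ S]) (simp add: x_def us)
  from has_field_derivative_root[OF ucts us(1)[OF S(2)] m this]
  have der: "((\<lambda>s. u (\<gamma> s)) has_field_derivative dd / (of_nat m * u (\<gamma> r) ^ (m - 1))) (at r)" .
  interpret p: closed_point "\<gamma> r" by (rule cp[OF S(2)])
  have co: "range coord \<subseteq> \<gamma> r" using curve[OF S(2)] by blast
  then have x1r: "x1 \<in> \<gamma> r" by blast
  have "value_at (\<gamma> r) Dx1 = dd"
    unfolding dd_def x_def target_deriv_coord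
    using p.rat_of_poly_value[OF co] p.closed(1,5) by (simp add: p.value_at_sum p.value_at_mult p.closed mult.commute)
  moreover have "Dx1 = H * x1 ^ (k + 1)" using x1_nonzero by (simp add: H_def power_inverse field_simps)
  ultimately have "dd = value_at (\<gamma> r) (H * x1 ^ (k + 1))" by simp
  also have "\<dots> = value_at (\<gamma> r) H * (u (\<gamma> r) ^ m) ^ (k + 1)"
    using Hs[OF S(2)] x1r us(2)[OF S(2)] by (simp add: p.value_at_mult p.value_at_power p.closed)
  finally have dd: "dd = value_at (\<gamma> r) H * u (\<gamma> r) ^ (m * (k + 1))" by (simp only: power_mult)
  obtain m' where m': "m = Suc m'" using m by (cases m) auto
  \<comment> \<open>Of the exponent m (k + 1), the root takes away m - 1; k + 1 is the expected
    power of u, and the remaining k (m - 1) is \<open>N\<close>.\<close>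
  have "m * (k + 1) = (k + 1) + k * m' + m'" by (simp add: m' algebra_simps)
  then have "dd / (of_nat m * u (\<gamma> r) ^ (m - 1)) = u (\<gamma> r) ^ (k + 1) * (value_at (\<gamma> r) H / of_nat m * u (\<gamma> r) ^ N)"
    unfolding dd N_def using us(1)[OF S(2)] by (simp add: m' power_add field_simps del: of_nat_Suc)
  also have "u (\<gamma> r) ^ (k + 1) = u (\<gamma> r) powi (int k + 1)"
    using power_int_of_nat[of "u (\<gamma> r)" "k + 1"] by (simp add: add.commute)
  also have "value_at (\<gamma> r) H / of_nat m * u (\<gamma> r) ^ N = value_at (\<gamma> r) H / of_nat m / \<theta> l (\<gamma> r) ^ N"
    unfolding theta_l(1)[OF out[OF S(2)]] by (simp add: power_inverse divide_inverse)
  finally show ?thesis using der by simp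
qed

text \<open>The expansion is that of \<open>H\<close> in the parameters at \<open>e\<close>, divided
  by the \<open>N\<close>-th power of 1/u. The upper bound on \<open>H\<close> permits the division,
  and the lower bound makes the new leading coefficient nonzero at \<open>e\<close>.\<close>

lemma evolution_exists:
  "\<exists>q. q 0 (\<lambda>_. 0) \<noteq> 0 \<and> evolution_expansion F X A v e u i1 l UNIV (int k) q"
proof -
  obtain U1 c1 C1 where U1: "openin T U1" "e \<in> U1" "0 < c1" "\<forall>p\<in>U1. good c1 C1 p"
    "continuous_map (subtopology T (U1 - {p. p \<subseteq> \<Gamma>})) euclidean u"
    using good_neighbourhood by blast
  have "H \<in> e" using U1(2,4) by (simp add: good_def)
  then obtain U2 c where U2: "openin T U2" "e \<in> U2"
    "\<forall>p\<in>U2. H \<in> p \<and> ((\<lambda>\<alpha> :: 'n \<Rightarrow> nat. c \<alpha> * (\<Prod>i\<in>UNIV. \<theta> i p ^ \<alpha> i)) has_sum value_at p H) UNIV"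
    using parameters unfolding analytic_parameters_def by blast
  obtain \<delta> \<Psi> where \<delta>: "0 < \<delta>" and \<Psi>: "\<Psi> (0 :: 'n cspace) = e"
    "continuous_map (top_of_set (ball 0 \<delta>)) T \<Psi>"
    "\<And>z. z \<in> ball 0 \<delta> \<Longrightarrow> \<Psi> z \<in> U1 \<inter> U2" "\<And>z i. z \<in> ball 0 \<delta> \<Longrightarrow> \<theta> i (\<Psi> z) = z $ i"
    "\<And>\<delta>'. \<delta>' \<le> \<delta> \<Longrightarrow> openin T (\<Psi> ` ball 0 \<delta>')"
    using analytic_chart[OF parameters openin_Int[OF U1(1) U2(1)] IntI[OF U1(2) U2(2)]] by blast
  define h where "h z = value_at (\<Psi> z) H" for z
  have hs: "((\<lambda>\<alpha>. c \<alpha> * (\<Prod>i\<in>UNIV. z $ i ^ \<alpha> i)) has_sum h z) UNIV" if "z \<in> ball 0 \<delta>" for z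
  proof -
    have "\<Psi> z \<in> U2" using \<Psi>(3)[OF that] by blast
    from U2(3)[rule_format, OF this] show ?thesis using \<Psi>(4)[OF that] by (simp add: h_def)
  qed
  have out: "\<not> \<Psi> z \<subseteq> \<Gamma>" if "z \<in> ball 0 \<delta>" "z $ l \<noteq> 0" for z
    using theta_l(2)[of "\<Psi> z"] \<Psi>(4)[OF that(1), of l] that(2) by auto
  have hb: "c1 * norm (z $ l) ^ N \<le> norm (h z)" "norm (h z) \<le> C1 * norm (z $ l) ^ N"
    if "z \<in> ball 0 \<delta>" "z $ l \<noteq> 0" for z
    using U1(4) \<Psi>(3)[OF that(1)] out[OF that] \<Psi>(4)[OF that(1), of l] unfolding good_def h_def by auto
  \<comment> \<open>Only coordinate \<open>l\<close> varies. Half of the radius is reserved for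
    \<open>z\<close> and half for \<open>t\<close>, so the updated point stays in the chart.\<close>
  define upd where "upd z t = (\<chi> i. if i = l then t else z $ i)" for z :: "'n cspace" and t :: complex
  have upd_ball: "upd z t \<in> ball 0 \<delta>" if "z \<in> ball 0 (\<delta> / 2)" "norm t < \<delta> / 2" for z t
    using norm_update_coordinate[of l t z] that by (simp add: upd_def)
  have upd_eq: "($) (upd z t) = (($) z)(l := t)" for z t by (auto simp: upd_def)
  have series: "((\<lambda>\<alpha>. c \<alpha> * (\<Prod>i\<in>UNIV. ((($) z)(l := t)) i ^ \<alpha> i)) has_sum h (upd z t)) UNIV"
    if "z \<in> ball 0 (\<delta> / 2)" "norm t < \<delta> / 2" for z t
    using hs[OF upd_ball[OF that]] unfolding upd_eq .
  have \<delta>2: "0 < \<delta> / 2" using \<delta> by simp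
  have bound: "norm (h (upd z t)) \<le> C1 * norm t ^ N" "c1 * norm t ^ N \<le> norm (h (upd z t))"
    if "z \<in> ball 0 (\<delta> / 2)" "t \<noteq> 0" "norm t < \<delta> / 2" for z t
    using hb[OF upd_ball[OF that(1,3)]] that(2) by (auto simp: upd_def)
  \<comment> \<open>The index shift is the division by the \<open>N\<close>-th power of 1/u; the
    factor 1/m comes from differentiating the m-th root.\<close>
  define q where "q j \<alpha> = c (\<alpha>(l := j + N)) / of_nat m" for j and \<alpha> :: "'n \<Rightarrow> nat"
  have "c ((\<lambda>_. 0)(l := N)) \<noteq> 0"
  proof -
    have z0: "(0 :: 'n cspace) \<in> ball 0 (\<delta> / 2)" using \<delta> by simp
    note ps = power_series_in_coordinate[OF \<delta>2 series[OF z0]]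
    have low: "coordinate_coeff c l (($) 0) j = 0" if "j < N" for j
      by (rule low_order_coeffs_vanish[OF \<delta>2 ps bound(1)[OF z0] that])
    have "coordinate_coeff c l (($) 0) N \<noteq> 0"
      by (rule leading_coeff_nonzero[OF \<delta>2 ps low U1(3) bound(2)[OF z0]])
    then show ?thesis by (simp add: coordinate_coeff_origin)
  qed
  then have q0: "q 0 (\<lambda>_. 0) \<noteq> 0" using m by (simp add: q_def)
  have "evolution_expansion F X A v e u i1 l UNIV (int k) q"
    unfolding evolution_expansion_def
  proof (intro exI[of _ "\<Psi> ` ball 0 (\<delta> / 2)"] conjI ballI allI impI, goal_cases)
    case 1
    show ?case using \<delta> by (intro \<Psi>(5)) simp
  next
    case 2
    show ?case using \<Psi>(1) \<delta> by (intro image_eqI[of _ _ 0]) auto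
  next
    case (3 cc S \<gamma> r)
    then have S: "open S" "r \<in> S" and \<gamma>: "continuous_map (top_of_set S) T \<gamma>"
      and curve: "\<And>r. r \<in> S \<Longrightarrow> \<gamma> r \<in> \<Psi> ` ball 0 (\<delta> / 2) \<and> range coord \<subseteq> \<gamma> r \<and>
        value_at (\<gamma> r) (new_comp F A v i1) = r \<and> (\<forall>i. i \<noteq> i1 \<longrightarrow> value_at (\<gamma> r) (new_comp F A v i) = cc $ i)"
      by auto
    have sub: "\<Psi> ` ball 0 (\<delta> / 2) \<subseteq> U1" using \<Psi>(3) \<delta> by auto
    obtain z where z: "z \<in> ball 0 (\<delta> / 2)" "\<gamma> r = \<Psi> z" using curve[OF S(2)] by blast
    then have z': "z \<in> ball 0 \<delta>" using \<delta> by auto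
    have outr: "\<not> \<gamma> r \<subseteq> \<Gamma>" using curve[OF S(2)] x1_notin_divisor by blast
    have zl: "z $ l = inverse (u (\<gamma> r))" "z $ l \<noteq> 0"
      using \<Psi>(4)[OF z', of l] theta_l(1)[OF outr] z(2) U1(4) curve[OF S(2)] sub outr unfolding good_def by auto
    have "norm (z $ l) < \<delta> / 2" 
      by (rule order_le_less_trans[OF Finite_Cartesian_Product.norm_nth_le]) (use z(1) in simp)
    from has_sum_divide_coordinate_power[OF \<delta>2 series[OF z(1)] bound(1)[OF z(1)] zl(2) this]
    have "((\<lambda>(j, \<alpha>). c (\<alpha>(l := j + N)) * z $ l ^ j * (\<Prod>i\<in>UNIV - {l}. z $ i ^ \<alpha> i)) has_sum (h (upd z (z $ l)) / z $ l ^ N))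
      (UNIV \<times> {\<alpha>. \<alpha> l = 0})" .
    moreover have "upd z (z $ l) = z" by (simp add: upd_def vec_eq_iff)
    ultimately have "((\<lambda>(j, \<alpha>). c (\<alpha>(l := j + N)) * z $ l ^ j * (\<Prod>i\<in>UNIV - {l}. z $ i ^ \<alpha> i)) has_sum (h z / z $ l ^ N))
      (UNIV \<times> {\<alpha>. \<alpha> l = 0})" by simp
    from has_sum_cmult_right[OF this, of "inverse (of_nat m)"]
    have sum: "((\<lambda>(j, \<alpha>). q j \<alpha> * z $ l ^ j * (\<Prod>i\<in>UNIV - {l}. z $ i ^ \<alpha> i)) has_sum (h z / of_nat m / z $ l ^ N))
      (UNIV \<times> {\<alpha>. \<alpha> l = 0})"
      by (simp add: q_def case_prod_unfold divide_inverse mult_ac)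
    have prod: "(\<Prod>i\<in>UNIV - {l}. value_at (\<gamma> r) (new_comp F A v i) ^ \<alpha> i) = (\<Prod>i\<in>UNIV - {l}. z $ i ^ \<alpha> i)" for \<alpha>
      by (intro prod.cong) (auto simp: theta_other[symmetric] z(2) \<Psi>(4)[OF z'])
    have der: "((\<lambda>r. u (\<gamma> r)) has_field_derivative u (\<gamma> r) powi (int k + 1) * (value_at (\<gamma> r) H / of_nat m / \<theta> l (\<gamma> r) ^ N)) (at r)"
      by (rule evolution_derivative[OF U1(4,5) S \<gamma>, of cc]) (use curve sub in blast)
    have eq: "value_at (\<gamma> r) H / of_nat m / \<theta> l (\<gamma> r) ^ N = h z / of_nat m / z $ l ^ N"
      using \<Psi>(4)[OF z', of l] z(2) by (simp add: h_def)
    show ?case unfolding prod zl(1)[symmetric]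
      by (intro exI[of _ "h z / of_nat m / z $ l ^ N"] conjI sum der[unfolded eq])
  qed
  with q0 show ?thesis by blast
qed

end

section \<open>Uniqueness of the exponent\<close>

text \<open>At arbitrarily large arguments a positive power exceeds every bound and a negative one
  falls below every positive number.\<close>

lemma power_int_bounded_imp_zero:
  fixes lo hi :: real
  assumes lo: "0 < lo" and t: "\<And>R. \<exists>t>R. lo \<le> t powi D \<and> t powi D \<le> hi"
  shows "D = 0"
proof (rule ccontr)
  assume "D \<noteq> 0"
  then consider n where "D = int (Suc n)" | n where "D = - int (Suc n)"
    by (cases D rule: int_cases4) (auto simp: gr0_conv_Suc)
  then show False
  proof cases
    case (1 n)
    obtain t where t: "t > max 1 hi" "t powi D \<le> hi" using t[of "max 1 hi"] by blast
    have "t ^ 1 \<le> t ^ Suc n" using t(1) by (intro power_increasing) auto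
    moreover have "t powi D = t ^ Suc n" unfolding 1 by (rule power_int_of_nat)
    ultimately show False using t by simp
  next
    case (2 n)
    obtain t where t: "t > max 1 (1 / lo)" "lo \<le> t powi D" using t[of "max 1 (1 / lo)"] by blast
    have "t ^ 1 \<le> t ^ Suc n" using t(1) by (intro power_increasing) auto
    then have "inverse (t ^ Suc n) \<le> inverse (t ^ 1)" by (rule le_imp_inverse_le) (use t(1) in simp)
    moreover have "t powi D = inverse (t ^ Suc n)" unfolding 2 by (simp only: power_int_minus power_int_of_nat)
    ultimately have "lo \<le> inverse t" using t(2) by (simp only: power_one_right order_trans)
    moreover have "inverse t < lo"
      using t(1) lo by (simp add: divide_simps mult.commute split: if_splits)
    ultimately show False by simp
  qed
qed

lemma isCont_axis: "isCont (\<lambda>r :: complex. axis i r :: 'n::finite cspace) a"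
  unfolding isCont_def
proof (rule vec_tendstoI)
  show "((\<lambda>r. axis i r $ j) \<longlongrightarrow> axis i a $ j) (at a)" for j :: 'n by (cases "j = i") (simp_all add: axis_def)
qed

section \<open>Preimages of the axis and comparison of expansions\<close>

context keller_point
begin

abbreviation "Y p i \<equiv> value_at p (new_comp F A v i)"

lemma peval_p0_v: "peval p0 v = 0"
  using divisor_function_vanishes[OF point_mem(2,4,3)] point_pullback(2)[OF pt, of p0] by simp

text \<open>On the axis, \<open>p0\<close> is \<open>r\<close> times a secant slope that is
  continuous at 0, where its value is the derivative along the axis, nonzero by
  transversality.\<close>

lemma p0_isolated_zero:
  "\<exists>\<rho>>0. \<forall>r. r \<noteq> 0 \<and> norm r < \<rho> \<longrightarrow> peval p0 (v + r *s (\<chi> j. b j)) \<noteq> 0"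
proof -
  obtain M where "(\<forall>k. continuous_on UNIV (M k)) \<and>
    (\<forall>x y. peval p0 x - peval p0 y = (\<Sum>k\<in>UNIV. M k (x, y) * (x $ k - y $ k))) \<and>
    (\<forall>k x. M k (x, x) = peval (pdiff k p0) x)" using poly_secant[of p0] by (rule exE)
  then have M: "\<And>k. continuous_on UNIV (M k)"
    "\<And>x y. peval p0 x - peval p0 y = (\<Sum>k\<in>UNIV. M k (x, y) * (x $ k - y $ k))"
    "\<And>k x. M k (x, x) = peval (pdiff k p0) x" by simp_all
  define g where "g r = (\<Sum>k\<in>UNIV. M k (v + r *s (\<chi> j. b j), v) * b k)" for r
  have line: "isCont (\<lambda>r. (v + r *s (\<chi> j. b j), v)) 0"
    unfolding isCont_def by (intro tendsto_Pair vec_tendstoI tendsto_const) (auto intro!: tendsto_eq_intros)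
  have "isCont (\<lambda>r. M k (v + r *s (\<chi> j. b j), v)) 0" for k
    by (rule continuous_at_compose[OF line, of "M k", unfolded o_def])
      (use M(1)[of k] in \<open>simp add: continuous_on_eq_continuous_at\<close>)
  then have "isCont g 0" unfolding g_def by (intro continuous_intros)
  moreover have "g 0 \<noteq> 0" using transversal by (simp add: g_def M(3) mult.commute)
  ultimately have "\<forall>\<^sub>F r in at 0. g r \<noteq> 0"
    by (intro tendsto_imp_eventually_ne[of _ "g 0"]) (auto simp: isCont_def)
  then obtain \<rho> where \<rho>: "\<rho> > 0" "\<And>r. r \<noteq> 0 \<Longrightarrow> norm r < \<rho> \<Longrightarrow> g r \<noteq> 0" unfolding eventually_at by auto
  have "peval p0 (v + r *s (\<chi> j. b j)) = r * g r" for r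
    using M(2)[of "v + r *s (\<chi> j. b j)" v] peval_p0_v by (simp add: g_def sum_distrib_left mult_ac)
  with \<rho> show ?thesis by auto
qed

lemma target_on_axis:
  assumes p: "closed_point p" "\<And>i. rat_of_poly (F i) \<in> p" and Y: "\<And>i. i \<noteq> i1 \<Longrightarrow> Y p i = 0"
  shows "value_at p (\<phi> p0) = peval p0 (v + Y p i1 *s (\<chi> j. b j))"
proof -
  interpret p: closed_point p by (rule p)
  let ?y = "\<chi> j. value_at p (rat_of_poly (F j))"
  have "A *v (?y - v) = Y p i1 *s axis i1 1"
    using Y target_value[OF p] by (auto simp: vec_eq_iff axis_def)
  then have "B *v (A *v (?y - v)) = B *v (Y p i1 *s axis i1 1)" by simp
  then have "?y - v = Y p i1 *s (B *v axis i1 1)"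
    by (simp add: matrix_vector_mul_assoc BA vector_scalar_commute)
  also have "B *v axis i1 1 = (\<chi> j. b j)"
    by (simp add: vec_eq_iff matrix_vector_mult_def axis_def if_distrib cong: if_cong)
  finally have "?y = v + Y p i1 *s (\<chi> j. b j)" by (simp add: algebra_simps)
  then show ?thesis using p.pullback_value(2)[of F p0, OF p(2)] by simp
qed

text \<open>If \<open>l \<noteq> i1\<close>, a point off \<open>\<Gamma>\<close> on the curve \<open>y\<^sub>i = 0\<close> \<open>(i \<noteq> i1)\<close> is a zero of \<open>y\<^sub>l\<close> restricted to the
  plane of the parameters \<open>u\<^sup>-\<^sup>1\<close> and \<open>y\<^sub>i\<^sub>1\<close>. By transversality that restriction has an isolated zero on
  \<open>\<Gamma>\<close>, which persists nearby.\<close>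

lemma axis_points:
  assumes \<delta>: "0 < \<delta>" and \<Psi>: "\<Psi> (0 :: 'n cspace) = e" "continuous_map (top_of_set (ball 0 \<delta>)) T \<Psi>"
    "\<And>z i. z \<in> ball 0 \<delta> \<Longrightarrow> \<theta> i (\<Psi> z) = z $ i"
    and good: "\<And>z. z \<in> ball 0 \<delta> \<Longrightarrow> good c C (\<Psi> z)" "\<And>z. z \<in> ball 0 \<delta> \<Longrightarrow> \<Psi> z \<in> closed_points X"
    and series: "\<And>z. z \<in> ball 0 \<delta> \<Longrightarrow> ((\<lambda>\<alpha>. a \<alpha> * (\<Prod>i\<in>UNIV. (z $ i) ^ \<alpha> i)) has_sum Y (\<Psi> z) l) UNIV"
    and \<eta>: "0 < \<eta>"
  shows "\<exists>z\<in>ball 0 \<delta>. norm z < \<eta> \<and> z $ l \<noteq> 0 \<and> (\<forall>i. i \<noteq> i1 \<longrightarrow> Y (\<Psi> z) i = 0)"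
proof -
  have cp: "closed_point (\<Psi> z)" and Fm: "\<And>i. rat_of_poly (F i) \<in> \<Psi> z" if "z \<in> ball 0 \<delta>" for z
    using good(1)[OF that] unfolding good_def by auto
  have Yz: "Y (\<Psi> z) i = z $ i" if "z \<in> ball 0 \<delta>" "i \<noteq> l" for z i
    using \<Psi>(3)[OF that(1), of i] theta_other[OF that(2)] by simp
  show ?thesis
  proof (cases "l = i1")
    case True
    \<comment> \<open>Here 1/u stands in the place of the only coordinate that is free on the curve;
      the other new coordinates are chart parameters and vanish on axis \<open>l\<close>.\<close>
    define t :: complex where "t = of_real (min \<delta> \<eta> / 2)"
    have t: "t \<noteq> 0" "norm t < \<delta>" "norm t < \<eta>" using \<delta> \<eta> by (auto simp: t_def)
    have nz: "norm (axis l t :: 'n cspace) \<le> norm t"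
      using norm_update_coordinate[of l t 0] by (simp add: axis_def cong: if_cong)
    show ?thesis
      by (rule bexI[of _ "axis l t"]) (use t nz True Yz[of "axis l t"] in \<open>auto simp: axis_def\<close>)
  next
    case False
    obtain \<rho> where \<rho>: "\<rho> > 0" "\<And>r. r \<noteq> 0 \<Longrightarrow> norm r < \<rho> \<Longrightarrow> peval p0 (v + r *s (\<chi> j. b j)) \<noteq> 0"
      using p0_isolated_zero by blast
    define \<delta>' where "\<delta>' = min (\<delta> / 2) \<rho>"
    have \<delta>': "0 < \<delta>'" "\<delta>' \<le> \<delta> / 2" "\<delta>' \<le> \<rho>" using \<delta> \<rho> by (auto simp: \<delta>'_def)
    define Z where "Z t r = (\<chi> i. if i = l then t else if i = i1 then r else 0)" for t r :: complex
    have nZ: "norm (Z t r) \<le> norm t + norm r" for t r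
    proof -
      have "norm (\<chi> i. if i = l then t else (\<chi> i. if i = i1 then r else (0 :: 'n cspace) $ i) $ i)
          \<le> norm (\<chi> i. if i = i1 then r else (0 :: 'n cspace) $ i) + norm t" by (rule norm_update_coordinate)
      also have "norm (\<chi> i. if i = i1 then r else (0 :: 'n cspace) $ i) \<le> norm (0 :: 'n cspace) + norm r"
        by (rule norm_update_coordinate)
      finally show ?thesis by (simp add: Z_def cong: if_cong)
    qed
    have Zb: "Z t r \<in> ball 0 \<delta>" if "norm t < \<delta>'" "norm r < \<delta>'" for t r
      using nZ[of t r] that \<delta>' by simp
    have Zupd: "(($) (Z t 0))(i1 := r) = ($) (Z t r)" for t r using False by (auto simp: Z_def)
    have "\<exists>t r. t \<noteq> 0 \<and> norm t < min \<delta>' (\<eta> / 2) \<and> norm r < min \<delta>' (\<eta> / 2) \<and> Y (\<Psi> (Z t r)) l = 0"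
    proof (rule zeros_persist[OF \<delta>'(1), of "\<lambda>t r. Y (\<Psi> (Z t r)) l"])
      have "continuous_map (top_of_set (ball 0 \<delta>)) euclidean (\<lambda>z. Y (\<Psi> z) l)"
      proof (rule continuous_map_value[OF _ \<Psi>(2)])
        fix z assume "z \<in> topspace (top_of_set (ball (0 :: 'n cspace) \<delta>))"
        then have z: "z \<in> ball 0 \<delta>" by simp
        interpret p: closed_point "\<Psi> z" by (rule cp[OF z])
        show "new_comp F A v l \<in> \<Psi> z" unfolding new_comp_eq by (rule p.pullback_value) (rule Fm[OF z])
      qed
      then have c1: "continuous_on (ball 0 \<delta>) (\<lambda>z. Y (\<Psi> z) l)" by simp
      have c2: "continuous_on (ball 0 \<delta>' \<times> ball 0 \<delta>') (\<lambda>x. Z (fst x) (snd x))"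
        unfolding Z_def continuous_on_def
      proof (intro ballI vec_tendstoI)
        fix x i
        show "((\<lambda>x. (\<chi> i. if i = l then fst x else if i = i1 then snd x else 0) $ i) \<longlongrightarrow>
          (\<chi> i. if i = l then fst x else if i = i1 then snd x else 0) $ i) (at x within ball 0 \<delta>' \<times> ball 0 \<delta>')"
          by (cases "i = l"; cases "i = i1") (auto intro!: tendsto_intros)
      qed
      have "continuous_on (ball 0 \<delta>' \<times> ball 0 \<delta>') (\<lambda>x. Y (\<Psi> (Z (fst x) (snd x))) l)"
        by (rule continuous_on_compose2[OF c1 c2]) (use Zb in auto)
      then show "continuous_on (ball 0 \<delta>' \<times> ball 0 \<delta>') (\<lambda>(t, r). Y (\<Psi> (Z t r)) l)"
        by (simp add: case_prod_unfold)
      \<comment> \<open>For fixed \<open>t\<close>, the expansion of y_l in the parameters at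
        \<open>e\<close> is a convergent power series in the single coordinate
        \<open>i1\<close>.\<close>
      show "(\<lambda>r. Y (\<Psi> (Z t r)) l) holomorphic_on ball 0 \<delta>'" if t: "norm t < \<delta>'" for t
      proof (rule power_series_holomorphic)
        fix r :: complex assume "r \<in> ball 0 \<delta>'"
        then have r: "norm r < \<delta>'" by simp
        have "((\<lambda>\<alpha>. a \<alpha> * (\<Prod>i\<in>UNIV. ((($) (Z t 0))(i1 := s)) i ^ \<alpha> i)) has_sum Y (\<Psi> (Z t s)) l) UNIV"
          if "norm s < \<delta>'" for s
          using series[OF Zb[OF t that]] unfolding Zupd .
        from power_series_in_coordinate[OF \<delta>'(1) this r]
        show "(\<lambda>n. coordinate_coeff a i1 (($) (Z t 0)) n * (r - 0) ^ n) sums Y (\<Psi> (Z t r)) l" by simp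
      qed
      have Z0: "Z 0 0 = 0" by (simp add: Z_def vec_eq_iff)
      have "Y e l = 0"
        using target_value[OF point_mem(1,4), of l] pt by (simp add: point_over_def)
      then show "Y (\<Psi> (Z 0 0)) l = 0" using \<Psi>(1) by (simp add: Z0)
      \<comment> \<open>With 1/u = 0 the point is on \<Gamma>, so the pullback of \<open>p0\<close>
        vanishes there. But a zero of y_l would put its image on the axis at parameter
        \<open>r\<close>, where \<open>p0\<close> is nonzero.\<close>
      show "Y (\<Psi> (Z 0 r)) l \<noteq> 0" if r: "r \<noteq> 0" "norm r < \<delta>'" for r
      proof
        assume Yl: "Y (\<Psi> (Z 0 r)) l = 0"
        have z: "Z 0 r \<in> ball 0 \<delta>" using Zb[of 0 r] r \<delta>' by simp
        have "Y (\<Psi> (Z 0 r)) i = 0" if "i \<noteq> i1" for i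
          using Yl Yz[OF z, of i] that by (cases "i = l") (auto simp: Z_def)
        moreover have "Y (\<Psi> (Z 0 r)) i1 = r" using Yz[OF z, of i1] False by (auto simp: Z_def)
        ultimately have "value_at (\<Psi> (Z 0 r)) (\<phi> p0) = peval p0 (v + r *s (\<chi> j. b j))"
          using target_on_axis[OF cp[OF z] Fm[OF z]] by simp
        moreover have "peval p0 (v + r *s (\<chi> j. b j)) \<noteq> 0" using \<rho>(2)[of r] r \<delta>' by simp
        moreover have "\<Psi> (Z 0 r) \<subseteq> \<Gamma>"
        proof (rule ccontr)
          assume out: "\<not> \<Psi> (Z 0 r) \<subseteq> \<Gamma>"
          then have "u (\<Psi> (Z 0 r)) \<noteq> 0" using good(1)[OF z] unfolding good_def by blast
          then show False using theta_l(1)[OF out] \<Psi>(3)[OF z, of l] by (simp add: Z_def)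
        qed
        ultimately show False using good(1)[OF z] unfolding good_def by simp
      qed
      show "0 < min \<delta>' (\<eta> / 2)" using \<delta>' \<eta> by simp
    qed
    then obtain t r where tr: "t \<noteq> 0" "norm t < min \<delta>' (\<eta> / 2)" "norm r < min \<delta>' (\<eta> / 2)" "Y (\<Psi> (Z t r)) l = 0"
      by blast
    have z: "Z t r \<in> ball 0 \<delta>" using Zb tr by simp
    have "Y (\<Psi> (Z t r)) i = 0" if "i \<noteq> i1" for i
      using tr(4) Yz[OF z, of i] that by (cases "i = l") (auto simp: Z_def)
    moreover have "norm (Z t r) < \<eta>" using nZ[of t r] tr by simp
    moreover have "Z t r $ l \<noteq> 0" using tr(1) by (simp add: Z_def)
    ultimately show ?thesis using z by blast
  qed
qed

text \<open>The map from the chart to \<open>Y\<^sub>0\<close> is injective near a point off \<open>\<Gamma>\<close>, since \<open>f\<close> is a local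
  homeomorphism there; invariance of domain then gives the lift of the coordinate line.\<close>

lemma curve_through:
  assumes \<delta>: "0 < \<delta>" and \<Psi>: "continuous_map (top_of_set (ball 0 \<delta>)) T \<Psi>"
    "\<And>z i. z \<in> ball (0 :: 'n cspace) \<delta> \<Longrightarrow> \<theta> i (\<Psi> z) = z $ i"
    and good: "\<And>z. z \<in> ball 0 \<delta> \<Longrightarrow> good c C (\<Psi> z)"
    and z0: "z0 \<in> ball 0 \<delta>" "z0 $ l \<noteq> 0" "\<And>i. i \<noteq> i1 \<Longrightarrow> Y (\<Psi> z0) i = 0"
  shows "\<exists>S \<gamma>. open S \<and> Y (\<Psi> z0) i1 \<in> S \<and> \<gamma> (Y (\<Psi> z0) i1) = \<Psi> z0 \<and> continuous_map (top_of_set S) T \<gamma> \<and>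
    (\<forall>r\<in>S. \<gamma> r \<in> \<Psi> ` ball 0 \<delta> \<and> range coord \<subseteq> \<gamma> r \<and> Y (\<gamma> r) i1 = r \<and> (\<forall>i. i \<noteq> i1 \<longrightarrow> Y (\<gamma> r) i = 0))"
proof -
  have cp: "closed_point (\<Psi> z)" and Fm: "\<And>i. rat_of_poly (F i) \<in> \<Psi> z" if "z \<in> ball 0 \<delta>" for z
    using good[OF that] unfolding good_def by auto
  have Ym: "new_comp F A v i \<in> \<Psi> z" if z: "z \<in> ball 0 \<delta>" for z i
  proof -
    interpret p: closed_point "\<Psi> z" by (rule cp[OF z])
    show ?thesis unfolding new_comp_eq by (rule p.pullback_value) (rule Fm[OF z])
  qed
  have out: "\<not> \<Psi> z \<subseteq> \<Gamma>" if "z \<in> ball 0 \<delta>" "z $ l \<noteq> 0" for z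
    using theta_l(2)[of "\<Psi> z"] \<Psi>(2)[OF that(1), of l] that(2) by auto
  have off: "range coord \<subseteq> \<Psi> z" "u (\<Psi> z) ^ m = value_at (\<Psi> z) x1" "z $ l = inverse (u (\<Psi> z))"
    if "z \<in> ball 0 \<delta>" "z $ l \<noteq> 0" for z
    using good[OF that(1)] out[OF that] theta_l(1)[OF out[OF that]] \<Psi>(2)[OF that(1), of l] unfolding good_def by auto
  define G where "G z = (\<chi> i. Y (\<Psi> z) i)" for z
  define xx where "xx z = (\<chi> i. value_at (\<Psi> z) (coord i))" for z
  define Z where "Z = {z :: 'n cspace. z \<in> ball 0 \<delta> \<and> z $ l \<noteq> 0}"
  have "Z = ball 0 \<delta> \<inter> (\<lambda>z. z $ l) -` (- {0})" by (auto simp: Z_def)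
  moreover have "open ((\<lambda>z :: 'n cspace. z $ l) -` (- {0}))"
    by (rule open_vimage[OF open_Compl[OF closed_singleton]]) (intro continuous_intros)
  ultimately have oZ: "open Z" by (simp add: open_Int)
  have Gc: "continuous_on (ball 0 \<delta>) G"
    unfolding G_def
  proof (rule continuous_on_vec_lambda)
    fix i
    have "continuous_map (top_of_set (ball 0 \<delta>)) euclidean (\<lambda>z. Y (\<Psi> z) i)"
      by (rule continuous_map_value[OF _ \<Psi>(1)]) (use Ym in auto)
    then show "continuous_on (ball 0 \<delta>) (\<lambda>z. Y (\<Psi> z) i)" by simp
  qed
  have \<Psi>Z: "continuous_map (top_of_set Z) T \<Psi>"
    by (rule continuous_map_from_subtopology_mono[OF \<Psi>(1)]) (auto simp: Z_def)
  have xc: "continuous_on Z xx"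
    unfolding xx_def
  proof (rule continuous_on_vec_lambda)
    fix i
    have "continuous_map (top_of_set Z) euclidean (\<lambda>z. value_at (\<Psi> z) (coord i))"
    proof (rule continuous_map_value[OF _ \<Psi>Z])
      fix z assume "z \<in> topspace (top_of_set Z)"
      then have "range coord \<subseteq> \<Psi> z" using off(1) by (auto simp: Z_def)
      then show "coord i \<in> \<Psi> z" by blast
    qed
    then show "continuous_on Z (\<lambda>z. value_at (\<Psi> z) (coord i))" by simp
  qed
  obtain \<rho>1 where \<rho>1: "\<rho>1 > 0" "inj_on (poly_map F) (ball (xx z0) \<rho>1)"
    using keller_map_locally_injective[OF keller] by blast
  have "((\<lambda>t. t ^ m) has_field_derivative of_nat m * (z0 $ l) ^ (m - 1)) (at (z0 $ l))"
    by (auto intro!: derivative_eq_intros)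
  from DERIV_imp_deriv[OF this] have "deriv (\<lambda>t. t ^ m) (z0 $ l) \<noteq> 0" using z0(2) m by simp
  moreover have "(\<lambda>t :: complex. t ^ m) holomorphic_on UNIV" by (intro holomorphic_intros)
  ultimately obtain \<rho>2 where \<rho>2: "\<rho>2 > 0" "inj_on (\<lambda>t. t ^ m) (ball (z0 $ l) \<rho>2)"
    using has_complex_derivative_locally_injective[of "\<lambda>t. t ^ m" UNIV "z0 $ l"] by blast
  \<comment> \<open>On \<open>W\<close> both f and the m-th power are injective. The target
    coordinates then determine the point of X_0, hence x_1 = u^m, hence 1/u; the other chart
    parameters are target coordinates themselves.\<close>
  define W where "W = Z \<inter> xx -` ball (xx z0) \<rho>1 \<inter> (\<lambda>z. z $ l) -` ball (z0 $ l) \<rho>2"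
  have "open (Z \<inter> xx -` ball (xx z0) \<rho>1)" by (rule continuous_open_preimage[OF xc oZ]) simp
  moreover have "open ((\<lambda>z :: 'n cspace. z $ l) -` ball (z0 $ l) \<rho>2)"
    by (rule open_vimage[OF open_ball]) (intro continuous_intros)
  ultimately have oW: "open W" unfolding W_def by (rule open_Int)
  have WZ: "W \<subseteq> Z" "Z \<subseteq> ball 0 \<delta>" by (auto simp: W_def Z_def)
  have "z0 \<in> W" using z0(1,2) \<rho>1(1) \<rho>2(1) by (simp add: W_def Z_def)
  have inj: "inj_on G W"
  proof (rule inj_onI)
    fix z z' assume W: "z \<in> W" "z' \<in> W" and eq: "G z = G z'"
    then have z: "z \<in> ball 0 \<delta>" "z $ l \<noteq> 0" and z': "z' \<in> ball 0 \<delta>" "z' $ l \<noteq> 0" using WZ by (auto simp: Z_def)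
    have GA: "G z = A *v (poly_map F (xx z) - v)" if "z \<in> ball 0 \<delta>" "z $ l \<noteq> 0" for z
      unfolding xx_def poly_map_value[OF cp[OF that(1)] off(1)[OF that]]
      using target_value[OF cp[OF that(1)] Fm[OF that(1)]] by (simp add: G_def vec_eq_iff)
    have "B *v (G z) = B *v (G z')" using eq by simp
    then have "poly_map F (xx z) = poly_map F (xx z')"
      unfolding GA[OF z] GA[OF z'] by (simp add: matrix_vector_mul_assoc BA)
    then have "xx z = xx z'" using \<rho>1(2) W by (auto simp: W_def inj_on_def)
    then have "xx z $ i1 = xx z' $ i1" by simp
    then have "u (\<Psi> z) ^ m = u (\<Psi> z') ^ m" using off(2)[OF z] off(2)[OF z'] by (simp add: xx_def)
    then have "(z $ l) ^ m = (z' $ l) ^ m" unfolding off(3)[OF z] off(3)[OF z'] by (simp only: power_inverse)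
    then have l: "z $ l = z' $ l" using \<rho>2(2) W by (auto simp: W_def inj_on_def)
    have "z $ i = z' $ i" for i
    proof (cases "i = l")
      case False
      then have "z $ i = G z $ i" "z' $ i = G z' $ i"
        using \<Psi>(2)[OF z(1), of i] \<Psi>(2)[OF z'(1), of i] theta_other[OF False] by (simp_all add: G_def)
      then show ?thesis using eq by simp
    qed (use l in simp)
    then show "z = z'" by (simp add: vec_eq_iff)
  qed
  have GcW: "continuous_on W G" by (rule continuous_on_subset[OF Gc]) (use WZ in blast)
  obtain g where g: "homeomorphism W (G ` W) G g"
    using invariance_of_domain_homeomorphism[OF oW GcW _ inj] by blast
  have oGW: "open (G ` W)" by (rule invariance_of_domain[OF GcW oW inj])
  \<comment> \<open>The parameters of the axis points in the open image of the chart; the inverse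
    homeomorphism lifts them to the curve.\<close>
  define S where "S = {r. axis i1 r \<in> G ` W}"
  have axc: "continuous_on UNIV (\<lambda>r :: complex. axis i1 r :: 'n cspace)"
    by (simp add: continuous_on_eq_continuous_at isCont_axis)
  have "open ((\<lambda>r. axis i1 r) -` (G ` W))" by (rule open_vimage[OF oGW axc])
  moreover have "S = (\<lambda>r. axis i1 r) -` (G ` W)" by (auto simp: S_def)
  ultimately have oS: "open S" by simp
  define r0 where "r0 = Y (\<Psi> z0) i1"
  have G0: "G z0 = axis i1 r0" using z0(3) by (auto simp: G_def r0_def axis_def vec_eq_iff)
  have r0S: "r0 \<in> S" using \<open>z0 \<in> W\<close> G0 by (auto simp: S_def intro!: image_eqI[of _ _ z0])
  define \<gamma> where "\<gamma> r = \<Psi> (g (axis i1 r))" for r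
  have gW: "g (axis i1 r) \<in> W" "G (g (axis i1 r)) = axis i1 r" if "r \<in> S" for r
    using g that unfolding S_def homeomorphism_def by auto
  have "\<gamma> r0 = \<Psi> z0"
    using g \<open>z0 \<in> W\<close> unfolding \<gamma>_def G0[symmetric] homeomorphism_def by auto
  moreover have "continuous_map (top_of_set S) T \<gamma>"
  proof -
    have "continuous_on S (\<lambda>r. g (axis i1 r))"
      by (rule continuous_on_compose2[OF _ continuous_on_subset[OF axc subset_UNIV], of "G ` W" g])
        (use g in \<open>auto simp: S_def homeomorphism_def\<close>)
    then have "continuous_map (top_of_set S) (top_of_set (ball 0 \<delta>)) (\<lambda>r. g (axis i1 r))"
      using gW(1) WZ by (auto simp: continuous_map_in_subtopology)
    from continuous_map_compose[OF this \<Psi>(1)] show ?thesis by (simp add: \<gamma>_def[abs_def] o_def)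
  qed
  moreover have "\<gamma> r \<in> \<Psi> ` ball 0 \<delta> \<and> range coord \<subseteq> \<gamma> r \<and> Y (\<gamma> r) i1 = r \<and> (\<forall>i. i \<noteq> i1 \<longrightarrow> Y (\<gamma> r) i = 0)"
    if r: "r \<in> S" for r
  proof -
    have z: "g (axis i1 r) \<in> ball 0 \<delta>" "g (axis i1 r) $ l \<noteq> 0" using gW(1)[OF r] WZ by (auto simp: Z_def)
    have "Y (\<gamma> r) i = axis i1 r $ i" for i using gW(2)[OF r] by (simp add: G_def \<gamma>_def vec_eq_iff)
    then show ?thesis using off(1)[OF z] z(1) by (auto simp: \<gamma>_def axis_def)
  qed
  ultimately show ?thesis using oS r0S unfolding r0_def by blast
qed

text \<open>Convergence of the given series is known only along curves, through the expansion
  itself. So one axis point \<open>z0\<close> is fixed, and the terms at closer axis points are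
  dominated by those at \<open>z0\<close>. The sum of the series is then close to its constant term,
  and |u|^(K-k) stays between positive bounds while |u| is arbitrarily large.\<close>

lemma exponent_unique:
  assumes q0: "q 0 (\<lambda>_. 0) \<noteq> 0" and expansion: "evolution_expansion F X A v e u i1 l {0} K q"
  shows "K = int k"
proof -
  obtain U1 c1 C1 where U1: "openin T U1" "e \<in> U1" "0 < c1" "\<forall>p\<in>U1. good c1 C1 p"
    "continuous_map (subtopology T (U1 - {p. p \<subseteq> \<Gamma>})) euclidean u"
    using good_neighbourhood by blast
  have "new_comp F A v l \<in> e" unfolding new_comp_eq by (rule point_pullback[OF pt])
  then obtain U2 a where U2: "openin T U2" "e \<in> U2"
    "\<forall>p\<in>U2. new_comp F A v l \<in> p \<and> ((\<lambda>\<alpha> :: 'n \<Rightarrow> nat. a \<alpha> * (\<Prod>i\<in>UNIV. \<theta> i p ^ \<alpha> i)) has_sum Y p l) UNIV"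
    using parameters unfolding analytic_parameters_def by blast
  obtain Uq where Uq: "openin T Uq" "e \<in> Uq" "\<forall>c\<in>{0}. \<forall>S \<gamma>. open S \<and> continuous_map (top_of_set S) T \<gamma> \<and>
      (\<forall>r\<in>S. \<gamma> r \<in> Uq \<and> range coord \<subseteq> \<gamma> r \<and> Y (\<gamma> r) i1 = r \<and> (\<forall>i. i \<noteq> i1 \<longrightarrow> Y (\<gamma> r) i = c $ i)) \<longrightarrow>
      (\<forall>r\<in>S. \<exists>s. ((\<lambda>(j, \<alpha>). q j \<alpha> * inverse (u (\<gamma> r)) ^ j * (\<Prod>i\<in>UNIV - {l}. Y (\<gamma> r) i ^ \<alpha> i)) has_sum s)
          (UNIV \<times> {\<alpha>. \<alpha> l = 0}) \<and>
        ((\<lambda>r. u (\<gamma> r)) has_field_derivative u (\<gamma> r) powi (K + 1) * s) (at r))"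
    using expansion[unfolded evolution_expansion_def] by (elim exE conjE) (rule that, assumption+)
  have UU: "openin T (U1 \<inter> U2 \<inter> Uq)" "e \<in> U1 \<inter> U2 \<inter> Uq" using U1 U2 Uq by (auto intro: openin_Int)
  obtain \<delta> \<Psi> where \<delta>: "0 < \<delta>" and \<Psi>: "\<Psi> (0 :: 'n cspace) = e"
    "continuous_map (top_of_set (ball 0 \<delta>)) T \<Psi>"
    "\<And>z. z \<in> ball 0 \<delta> \<Longrightarrow> \<Psi> z \<in> U1 \<inter> U2 \<inter> Uq" "\<And>z i. z \<in> ball 0 \<delta> \<Longrightarrow> \<theta> i (\<Psi> z) = z $ i"
    using analytic_chart[OF parameters UU] by blast
  have gd: "good c1 C1 (\<Psi> z)" and cl: "\<Psi> z \<in> closed_points X" if "z \<in> ball 0 \<delta>" for z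
    using \<Psi>(3)[OF that] U1(4) openin_classical_subset[OF U1(1)] by auto
  have ser: "((\<lambda>\<alpha>. a \<alpha> * (\<Prod>i\<in>UNIV. (z $ i) ^ \<alpha> i)) has_sum Y (\<Psi> z) l) UNIV" if "z \<in> ball 0 \<delta>" for z
  proof -
    have "\<Psi> z \<in> U2" using \<Psi>(3)[OF that] by blast
    from U2(3)[rule_format, OF this] show ?thesis using \<Psi>(4)[OF that] by simp
  qed
  have pts: "\<exists>z\<in>ball 0 \<delta>. norm z < \<eta> \<and> z $ l \<noteq> 0 \<and> (\<forall>i. i \<noteq> i1 \<longrightarrow> Y (\<Psi> z) i = 0)" if "0 < \<eta>" for \<eta>
    using axis_points[OF \<delta> \<Psi>(1,2,4) gd cl ser that] .
  define onaxis where "onaxis z \<longleftrightarrow> z \<in> ball 0 \<delta> \<and> z $ l \<noteq> 0 \<and> (\<forall>i. i \<noteq> i1 \<longrightarrow> Y (\<Psi> z) i = 0)" for z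
  have out: "\<not> \<Psi> z \<subseteq> \<Gamma>" if "onaxis z" for z
    using theta_l(2)[of "\<Psi> z"] \<Psi>(4)[of z l] that by (auto simp: onaxis_def)
  have zl: "inverse (u (\<Psi> z)) = z $ l" "u (\<Psi> z) \<noteq> 0" if "onaxis z" for z
    using theta_l(1)[OF out[OF that]] \<Psi>(4)[of z l] gd[of z] out[OF that] that by (auto simp: onaxis_def good_def)
  have zi: "Y (\<Psi> z) i = z $ i" if "onaxis z" "i \<noteq> l" for z i
    using \<Psi>(4)[of z i] theta_other[OF that(2)] that(1) by (auto simp: onaxis_def)
  define tm where "tm z = (\<lambda>(j, \<alpha>). q j \<alpha> * ((z $ l) ^ j * (\<Prod>i\<in>UNIV - {l}. (z $ i) ^ \<alpha> i)))" for z :: "'n cspace"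
  let ?I = "(UNIV :: nat set) \<times> {\<alpha> :: 'n \<Rightarrow> nat. \<alpha> l = 0}"
  have main: "\<exists>s. (tm z has_sum s) ?I \<and>
      norm (u (\<Psi> z)) powi (K - int k) * norm s = norm (value_at (\<Psi> z) H / of_nat m / \<theta> l (\<Psi> z) ^ N)" if z: "onaxis z" for z
  proof -
    have zb: "z \<in> ball 0 \<delta>" "z $ l \<noteq> 0" "\<And>i. i \<noteq> i1 \<Longrightarrow> Y (\<Psi> z) i = 0" using z by (auto simp: onaxis_def)
    obtain S \<gamma> where S: "open S" "Y (\<Psi> z) i1 \<in> S" "\<gamma> (Y (\<Psi> z) i1) = \<Psi> z" "continuous_map (top_of_set S) T \<gamma>"
      "\<forall>r\<in>S. \<gamma> r \<in> \<Psi> ` ball 0 \<delta> \<and> range coord \<subseteq> \<gamma> r \<and> Y (\<gamma> r) i1 = r \<and> (\<forall>i. i \<noteq> i1 \<longrightarrow> Y (\<gamma> r) i = 0)"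
      using curve_through[OF \<delta> \<Psi>(2,4) gd zb] by blast
    define r0 where "r0 = Y (\<Psi> z) i1"
    have r0: "r0 \<in> S" "\<gamma> r0 = \<Psi> z" using S by (simp_all add: r0_def)
    have inU: "\<gamma> r \<in> U1" "\<gamma> r \<in> Uq" if "r \<in> S" for r using S(5) that \<Psi>(3) by auto
    have der1: "((\<lambda>r. u (\<gamma> r)) has_field_derivative
        u (\<gamma> r0) powi (int k + 1) * (value_at (\<gamma> r0) H / of_nat m / \<theta> l (\<gamma> r0) ^ N)) (at r0)"
      by (rule evolution_derivative[OF U1(4,5) S(1) r0(1) S(4), of 0]) (use S(5) inU in simp)
    have "open S \<and> continuous_map (top_of_set S) T \<gamma> \<and>
      (\<forall>r\<in>S. \<gamma> r \<in> Uq \<and> range coord \<subseteq> \<gamma> r \<and> Y (\<gamma> r) i1 = r \<and> (\<forall>i. i \<noteq> i1 \<longrightarrow> Y (\<gamma> r) i = (0 :: 'n cspace) $ i))"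
      using S(1,4,5) inU by simp
    from Uq(3)[THEN bspec, OF singletonI, THEN spec[of _ S], THEN spec[of _ \<gamma>], THEN mp, OF this, THEN bspec, OF r0(1)]
    have "\<exists>s. ((\<lambda>(j, \<alpha>). q j \<alpha> * inverse (u (\<gamma> r0)) ^ j * (\<Prod>i\<in>UNIV - {l}. Y (\<gamma> r0) i ^ \<alpha> i)) has_sum s) ?I \<and>
        ((\<lambda>r. u (\<gamma> r)) has_field_derivative u (\<gamma> r0) powi (K + 1) * s) (at r0)" .
    then obtain s where s: "((\<lambda>(j, \<alpha>). q j \<alpha> * inverse (u (\<gamma> r0)) ^ j * (\<Prod>i\<in>UNIV - {l}. Y (\<gamma> r0) i ^ \<alpha> i)) has_sum s) ?I"
      "((\<lambda>r. u (\<gamma> r)) has_field_derivative u (\<gamma> r0) powi (K + 1) * s) (at r0)" by blast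
    have "(\<Prod>i\<in>UNIV - {l}. Y (\<gamma> r0) i ^ \<alpha> i) = (\<Prod>i\<in>UNIV - {l}. (z $ i) ^ \<alpha> i)" for \<alpha>
      by (intro prod.cong) (auto simp: r0 zi[OF z])
    then have "(tm z has_sum s) ?I" using s(1) zl(1)[OF z] by (simp add: tm_def r0 mult.assoc)
    \<comment> \<open>Both expansions give the derivative of the same function at
      \<open>r0\<close>.\<close>
    moreover have "u (\<Psi> z) powi (K + 1) * s = u (\<Psi> z) powi (int k + 1) * (value_at (\<Psi> z) H / of_nat m / \<theta> l (\<Psi> z) ^ N)"
      using DERIV_unique[OF s(2) der1] unfolding r0(2) .
    then have "norm (u (\<Psi> z)) powi (K + 1) * norm s =
        norm (u (\<Psi> z)) powi (int k + 1) * norm (value_at (\<Psi> z) H / of_nat m / \<theta> l (\<Psi> z) ^ N)"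
      by (metis norm_mult norm_power_int)
    moreover have "norm (u (\<Psi> z)) powi (K + 1) = norm (u (\<Psi> z)) powi (int k + 1) * norm (u (\<Psi> z)) powi (K - int k)"
      using zl(2)[OF z] by (subst power_int_add[symmetric]) (auto simp: algebra_simps)
    ultimately show ?thesis using zl(2)[OF z] by (intro exI[of _ s]) (simp add: mult.assoc)
  qed
  have size: "c1 / real m \<le> norm (value_at (\<Psi> z) H / of_nat m / \<theta> l (\<Psi> z) ^ N)"
    "norm (value_at (\<Psi> z) H / of_nat m / \<theta> l (\<Psi> z) ^ N) \<le> C1 / real m" if z: "onaxis z" for z
  proof -
    have th: "0 < norm (\<theta> l (\<Psi> z)) ^ N" using \<Psi>(4)[of z l] z by (auto simp: onaxis_def)
    have b: "c1 * norm (\<theta> l (\<Psi> z)) ^ N \<le> norm (value_at (\<Psi> z) H)" "norm (value_at (\<Psi> z) H) \<le> C1 * norm (\<theta> l (\<Psi> z)) ^ N"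
      using gd[of z] out[OF z] z by (auto simp: onaxis_def good_def)
    have e: "norm (value_at (\<Psi> z) H / of_nat m / \<theta> l (\<Psi> z) ^ N) = (norm (value_at (\<Psi> z) H) / norm (\<theta> l (\<Psi> z)) ^ N) / real m"
      by (simp add: norm_divide norm_power norm_mult)
    show "c1 / real m \<le> norm (value_at (\<Psi> z) H / of_nat m / \<theta> l (\<Psi> z) ^ N)"
      unfolding e by (intro divide_right_mono) (use b(1) th in \<open>simp_all add: le_divide_eq\<close>)
    show "norm (value_at (\<Psi> z) H / of_nat m / \<theta> l (\<Psi> z) ^ N) \<le> C1 / real m"
      unfolding e by (intro divide_right_mono) (use b(2) th in \<open>simp_all add: divide_le_eq\<close>)
  qed
  obtain z0 where z0: "onaxis z0" using pts[OF \<delta>] by (auto simp: onaxis_def)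
  \<comment> \<open>Coordinates \<open>l\<close> and \<open>i1\<close> of \<open>z0\<close> serve as
    units of length for closer points, so neither may be 0. Were y_1 also 0, the image would be
    \<open>v\<close>, where \<open>p0\<close> vanishes, against nonvanishing of its pullback off
    \<Gamma>.\<close>
  have z0i1: "z0 $ i1 \<noteq> 0"
  proof (cases "l = i1")
    case False
    show ?thesis
    proof
      assume "z0 $ i1 = 0"
      then have "Y (\<Psi> z0) i1 = 0" using zi[OF z0, of i1] False by simp
      moreover have zb: "z0 \<in> ball 0 \<delta>" using z0 by (simp add: onaxis_def)
      moreover have "value_at (\<Psi> z0) (\<phi> p0) = peval p0 (v + Y (\<Psi> z0) i1 *s (\<chi> j. b j))"
        by (rule target_on_axis) (use gd[OF zb] z0 in \<open>auto simp: good_def onaxis_def\<close>)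
      ultimately have "value_at (\<Psi> z0) (\<phi> p0) = 0" using peval_p0_v by simp
      then show False using gd[OF zb] out[OF z0] by (simp add: good_def)
    qed
  qed (use z0 in \<open>auto simp: onaxis_def\<close>)
  obtain s0 where "(tm z0 has_sum s0) ?I" using main[OF z0] by blast
  then have sum0: "tm z0 summable_on ?I" by (rule has_sum_imp_summable)
  define M where "M = infsum (\<lambda>x. norm (tm z0 x)) ?I"
  define Q where "Q = norm (q 0 (\<lambda>_. 0))"
  have Q: "0 < Q" using q0 by (simp add: Q_def)
  have M: "0 \<le> M" unfolding M_def by (rule infsum_nonneg) simp
  \<comment> \<open>Chosen so that the nonconstant terms contribute at most half of |q_0(0)|;
    \<open>M + 1\<close> keeps the denominator positive.\<close>
  define \<rho> where "\<rho> = min 1 (Q / (2 * (M + 1)))"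
  have \<rho>: "0 < \<rho>" "\<rho> \<le> 1" "\<rho> * M \<le> Q / 2"
  proof -
    show "0 < \<rho>" "\<rho> \<le> 1" using Q M by (auto simp: \<rho>_def)
    have cancel: "Q / (2 * x) * x = Q / 2" if "x \<noteq> 0" for x using that by simp
    have "\<rho> * M \<le> Q / (2 * (M + 1)) * (M + 1)" using Q M by (intro mult_mono) (auto simp: \<rho>_def)
    also have "\<dots> = Q / 2" by (rule cancel) (use M in simp)
    finally show "\<rho> * M \<le> Q / 2" .
  qed
  have "K - int k = 0"
  proof (rule power_int_bounded_imp_zero[of "c1 / real m / (2 * Q)" _ "C1 / real m / (Q / 2)"])
    show "0 < c1 / real m / (2 * Q)" using U1(3) m Q by simp
    fix R :: real
    \<comment> \<open>The first bound makes coordinates \<open>l\<close> and \<open>i1\<close> at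
      most \<rho> times those of \<open>z0\<close>, all others being 0 on the curve. The second
      makes |u|, the inverse of |z_l|, exceed \<open>R\<close>.\<close>
    define \<eta> where "\<eta> = min (\<rho> * min (norm (z0 $ l)) (norm (z0 $ i1))) (1 / (\<bar>R\<bar> + 1))"
    have \<eta>: "0 < \<eta>" using \<rho>(1) z0i1 z0 by (auto simp: \<eta>_def onaxis_def)
    obtain z where z: "onaxis z" "norm z < \<eta>" using pts[OF \<eta>] by (auto simp: onaxis_def)
    have zn: "norm (z $ i) < \<eta>" for i
      by (rule order_le_less_trans[OF Finite_Cartesian_Product.norm_nth_le z(2)])
    have contr: "norm (z $ i) \<le> \<rho> * norm (z0 $ i)" for i
    proof -
      consider "i = l" | "i = i1" | "i \<noteq> l" "i \<noteq> i1" by blast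
      then show ?thesis
      proof cases
        case 1
        then have "\<eta> \<le> \<rho> * norm (z0 $ i)" using \<rho>(1) by (auto simp: \<eta>_def min_le_iff_disj mult_left_mono)
        then show ?thesis using zn[of i] by simp
      next
        case 2
        then have "\<eta> \<le> \<rho> * norm (z0 $ i)" using \<rho>(1) by (auto simp: \<eta>_def min_le_iff_disj mult_left_mono)
        then show ?thesis using zn[of i] by simp
      next
        case 3
        then have "z $ i = 0" using zi[OF z(1), of i] z(1) by (simp add: onaxis_def)
        then show ?thesis using \<rho>(1) by simp
      qed
    qed
    obtain s where s: "(tm z has_sum s) ?I"
      "norm (u (\<Psi> z)) powi (K - int k) * norm s = norm (value_at (\<Psi> z) H / of_nat m / \<theta> l (\<Psi> z) ^ N)"
      using main[OF z(1)] by blast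
    have "norm (s - tm z (0, \<lambda>_. 0)) \<le> \<rho> * M"
      unfolding M_def
    proof (rule has_sum_dominated_tail[OF s(1) sum0])
      fix x :: "nat \<times> ('n \<Rightarrow> nat)" assume xI: "x \<in> ?I - {(0, \<lambda>_. 0)}"
      obtain j \<alpha> where "x = (j, \<alpha>)" by (cases x)
      with xI have x: "x = (j, \<alpha>)" "\<alpha> l = 0" "j \<noteq> 0 \<or> \<alpha> \<noteq> (\<lambda>_. 0)" by auto
      have nontrivial: "j \<noteq> 0 \<or> (\<exists>i\<in>UNIV - {l}. \<alpha> i \<noteq> 0)" using x(2,3) by (auto simp: fun_eq_iff)
      have "norm ((z $ l) ^ j * (\<Prod>i\<in>UNIV - {l}. (z $ i) ^ \<alpha> i)) \<le> \<rho> * norm ((z0 $ l) ^ j * (\<Prod>i\<in>UNIV - {l}. (z0 $ i) ^ \<alpha> i))"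
        by (rule monomial_contraction[OF less_imp_le[OF \<rho>(1)] \<rho>(2) contr contr nontrivial])
      from mult_left_mono[OF this norm_ge_zero[of "q j \<alpha>"]]
      show "norm (tm z x) \<le> \<rho> * norm (tm z0 x)"
        by (simp add: tm_def x(1) norm_mult mult.left_commute)
    qed (use \<rho>(1) in auto)
    then have "norm (s - q 0 (\<lambda>_. 0)) \<le> Q / 2" using \<rho>(3) by (simp add: tm_def)
    then have sn: "Q / 2 \<le> norm s" "norm s \<le> 2 * Q"
      using norm_triangle_ineq2[of "q 0 (\<lambda>_. 0)" s] norm_triangle_ineq2[of s "q 0 (\<lambda>_. 0)"] Q
      by (auto simp: Q_def norm_minus_commute)
    have up: "0 < norm (u (\<Psi> z))" using zl(2)[OF z(1)] by simp
    have "norm (z $ l) < 1 / (\<bar>R\<bar> + 1)" using zn[of l] by (simp add: \<eta>_def)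
    then have "inverse (norm (u (\<Psi> z))) < 1 / (\<bar>R\<bar> + 1)" by (metis norm_inverse zl(1)[OF z(1)])
    then have "\<bar>R\<bar> + 1 < norm (u (\<Psi> z))" using up by (simp add: field_simps)
    then have "R < norm (u (\<Psi> z))" by simp
    moreover have eq: "norm (u (\<Psi> z)) powi (K - int k) = norm (value_at (\<Psi> z) H / of_nat m / \<theta> l (\<Psi> z) ^ N) / norm s"
      unfolding s(2)[symmetric] using sn(1) Q by auto
    moreover have "c1 / real m / (2 * Q) \<le> norm (value_at (\<Psi> z) H / of_nat m / \<theta> l (\<Psi> z) ^ N) / norm s"
      using size(1)[OF z(1)] sn Q U1(3) m by (intro frac_le) auto
    moreover have "norm (value_at (\<Psi> z) H / of_nat m / \<theta> l (\<Psi> z) ^ N) / norm s \<le> C1 / real m / (Q / 2)"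
      using size(2)[OF z(1)] sn Q by (intro frac_le order_trans[OF norm_ge_zero size(2)[OF z(1)]]) auto
    ultimately show "\<exists>t>R. c1 / real m / (2 * Q) \<le> t powi (K - int k) \<and> t powi (K - int k) \<le> C1 / real m / (Q / 2)"
      by (intro exI[of _ "norm (u (\<Psi> z))"]) (simp only: eq simp_thms)
  qed
  then show ?thesis by simp
qed

end

text \<open>\<open>Z\<close> expresses genericity of \<open>v\<close> and is fixed before \<psi>,
  \<open>A\<close>, \<open>l\<close>, \<open>e\<close> and \<open>u\<close> are chosen. Existence
  covers all neighbouring parallel curves (\<open>UNIV\<close>); uniqueness uses only the curve of
  the claim (\<open>{0}\<close>).\<close>

theorem theorem30:
  fixes F :: "'n::{finite,linorder} \<Rightarrow> 'n cpoly"
    and V :: "('n cspace) set"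
    and X :: "'n ratfun set set"
    and \<Gamma> :: "'n ratfun set"
    and i1 :: 'n and m :: nat
  assumes keller: "keller_map F"
    and V_component: "irreducible_component V (finiteness_variety F)"
    and V_codim: "codim_one V"
    and X_variety: "variety_model X"
    and X_smooth: "smooth_model X"
    and X_proper: "proper_birational_morphism X projective_space"
    and \<Gamma>_divisor: "prime_divisor X \<Gamma>"
    and \<Gamma>_infinity: "\<exists>S\<in>hyperplane_at_infinity. dominates \<Gamma> S"
    and \<Gamma>_onto: "maps_generically_finite_etale_onto F \<Gamma> V"
    and m: "1 \<le> m" "has_order \<Gamma> (inverse (coord i1)) m"
  shows "\<exists>Z. zariski_closed Z \<and> \<not> V \<subseteq> Z \<and>
    (\<forall>v\<in>V - Z. \<forall>\<psi>. local_equation V v \<psi> \<longrightarrow>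
      (\<exists>A. suitable_change i1 \<psi> v A) \<and>
      (\<forall>A l e u.
         suitable_change i1 \<psi> v A \<and>
         local_parameters_omitting \<psi> A v l \<and>
         point_over F X \<Gamma> v e \<and>
         root_branch X \<Gamma> e i1 m u \<and>
         analytic_parameters X e (parameters_at_infinity F A v \<Gamma> u l) \<longrightarrow>
         (\<exists>q. q 0 (\<lambda>_. 0) \<noteq> 0 \<and>
            evolution_expansion F X A v e u i1 l UNIV
              (int (ramification_index (ring_of_component F V) \<Gamma>)) q) \<and>
         (\<forall>K q. q 0 (\<lambda>_. 0) \<noteq> 0 \<and> evolution_expansion F X A v e u i1 l {0} K q \<longrightarrow>
            K = int (ramification_index (ring_of_component F V) \<Gamma>))))"
proof (cases "\<exists>v\<in>V. \<exists>\<psi>. local_equation V v \<psi>")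
  \<comment> \<open>Without a local equation at any point of V the claim is vacuous, and the empty
    set serves as \<open>Z\<close>.\<close>
  case False
  have "V \<noteq> {}" using V_component by (auto simp: irreducible_component_def zariski_irreducible_def)
  moreover have "zariski_closed ({} :: ('n cspace) set)"
    unfolding zariski_closed_def by (rule exI[of _ "{1}"]) (auto simp: peval_hom)
  ultimately show ?thesis using False by (intro exI[of _ "{}"]) auto
next
  case True
  then obtain v0 \<psi>0 where v0: "v0 \<in> V" "local_equation V v0 \<psi>0" by blast
  interpret kc: keller_component F V
    using keller V_component V_codim
    by unfold_locales (auto simp: irreducible_component_def codim_one_def)
  obtain p0 j0 where p0: "p0 \<in> vanishing_ideal V" "pdiff j0 p0 \<notin> vanishing_ideal V"
    "\<forall>p\<in>vanishing_ideal V. \<exists>a b. b \<notin> vanishing_ideal V \<and> p * b = p0 * a"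
    using kc.local_equation_generator[OF v0(2,1)] by blast
  have \<Gamma>: "\<Gamma> \<in> X" "krull_dim \<Gamma> = 1" using \<Gamma>_divisor by (auto simp: prime_divisor_def)
  \<comment> \<open>That 1/x_1 has an order along \<Gamma> already provides a uniformizer.\<close>
  obtain \<pi> where \<pi>: "uniformizer \<Gamma> \<pi>" using m(2) by (auto simp: has_order_def)
  interpret local_subalgebra \<Gamma> by (rule variety_model_point(1)[OF X_variety \<Gamma>(1)])
  interpret kd: keller_divisor F V \<Gamma> \<pi> X i1 m p0 j0
    by unfold_locales (use \<pi> \<Gamma> variety_model_point(2)[OF X_variety \<Gamma>(1)] X_variety \<Gamma>_onto m p0 in auto)
  obtain Q N where Q: "Q \<notin> vanishing_ideal V" "\<forall>e v. point_over F X \<Gamma> v e \<and> peval Q v \<noteq> 0 \<longrightarrow>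
     inverse (coord i1) \<in> e \<and> kd.w \<in> e \<and> inverse kd.w \<in> e \<and> range kd.\<epsilon> \<subseteq> e \<and>
     range (\<lambda>i. coord i * inverse (coord i1) ^ N) \<subseteq> e \<and> peval (pdiff j0 p0) v \<noteq> 0"
    using kd.generic_regularity by (elim exE conjE) (rule that, assumption+)
  \<comment> \<open>The second factor ensures a nonzero gradient of \<open>p0\<close> at
    \<open>v\<close> even when no point of \<Gamma> lies over \<open>v\<close>; the existence of a
    suitable change is claimed there too.\<close>
  define Q' where "Q' = Q * pdiff j0 p0"
  show ?thesis
  proof (intro exI[of _ "{x. peval Q' x = 0}"] conjI ballI allI impI)
    show "zariski_closed {x. peval Q' x = 0}" by (rule zariski_closed_zeros)
    have "Q' \<notin> vanishing_ideal V" using Q(1) p0(2) by (simp add: Q'_def kc.I_mult_iff)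
    then show "\<not> V \<subseteq> {x. peval Q' x = 0}" by (auto simp: vanishing_ideal_def)
  next
    fix v \<psi> assume v: "v \<in> V - {x. peval Q' x = 0}" and \<psi>: "local_equation V v \<psi>"
    then have "v \<in> V" "peval Q v \<noteq> 0" "peval (pdiff j0 p0) v \<noteq> 0" by (auto simp: Q'_def peval_hom)
    then show "\<exists>A. suitable_change i1 \<psi> v A" using ex_suitable_change[OF \<psi> _ p0(1)] by blast
  next
    fix v \<psi> A l e u
    assume v: "v \<in> V - {x. peval Q' x = 0}" and \<psi>: "local_equation V v \<psi>"
      and *: "suitable_change i1 \<psi> v A \<and> local_parameters_omitting \<psi> A v l \<and> point_over F X \<Gamma> v e \<and>
         root_branch X \<Gamma> e i1 m u \<and> analytic_parameters X e (parameters_at_infinity F A v \<Gamma> u l)"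
    have vV: "v \<in> V" "peval Q v \<noteq> 0" "peval (pdiff j0 p0) v \<noteq> 0" using v by (auto simp: Q'_def peval_hom)
    obtain B where B: "A ** B = mat 1" using * by (auto simp: suitable_change_def invertible_def)
    have tr: "(\<Sum>j\<in>UNIV. B $ j $ i1 * peval (pdiff j p0) v) \<noteq> 0"
      using suitable_change_transversal[OF \<psi> vV(1) p0(1) vV(3) _ B] * by blast
    have "point_over F X \<Gamma> v e \<and> peval Q v \<noteq> 0" using * vV by blast
    note reg = Q(2)[THEN spec, THEN spec, THEN mp, OF this]
    interpret kp: keller_point F V \<Gamma> \<pi> X i1 m p0 j0 v e A B u l N
      by unfold_locales (use * reg B tr in blast)+
    show "\<exists>q. q 0 (\<lambda>_. 0) \<noteq> 0 \<and> evolution_expansion F X A v e u i1 l UNIV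
        (int (ramification_index (ring_of_component F V) \<Gamma>)) q"
      using kp.evolution_exists unfolding kd.k_def .
    show "K = int (ramification_index (ring_of_component F V) \<Gamma>)"
      if "q 0 (\<lambda>_. 0) \<noteq> 0 \<and> evolution_expansion F X A v e u i1 l {0} K q" for K q
      using kp.exponent_unique that unfolding kd.k_def by blast
  qed
qed

end
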